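(* Let $\frac12<\alpha<1$ and $T>0$. The process $$\xi^T_t=\frac1T\sum_{j\neq k}\sigma_j\sigma_k\langle\Lambda(x_j+\rho^j,x_k+\rho^k;T),\mathbf 1_{[0,t]}\rangle,\qquad t\ge 0,$$ built from the charged $\alpha$-stable particle system and the intersection local times described in the context, is well defined (the series converges in $L^2(\Omega)$ for each $t\ge0$), and it has a continuous modification.
   Context: $\mathcal S$ is the Schwartz space of smooth rapidly decreasing functions on $\mathbb R$. Particle system: $\{x_j\}_j$ are the points of a Poisson random field on $\mathbb R$ with Lebesgue intensity measure; $\rho^j=(\rho^j_t)_{t\ge0}$ are independent standard symmetric $\alpha$-stable Lévy processes on $\mathbb R$ with $\rho^j_0=0$ (so $E e^{iz\rho^j_t}=e^{-t|z|^\alpha}$), independent of $\{x_j\}_j$; $\sigma_j$ are i.i.d. charges with $P(\sigma_j=1)=P(\sigma_j=-1)=\frac12$, independent of $\{x_j\}_j$ and of the $\rho^j$. The sum is over pairs of distinct indices. Intersection local time: let $\mathcal F$ be the class of nonnegative symmetric $C^\infty$ functions $f$ on $\mathbb R$ with compact support and $\int_{\mathbb R} f=1$; for $f\in\mathcal F$, $\varepsilon>0$ put $f_\varepsilon(x)=\varepsilon^{-1}f(x/\varepsilon)$. For real càdlàg processes $\eta^1,\eta^2$ and a test function $\psi$ set $$\langle\Lambda^f_\varepsilon(\eta^1,\eta^2;T),\psi\rangle=\int_0^T\int_0^T f_\varepsilon(\eta^2_v-\eta^1_u)\psi(\eta^1_u)\,du\,dv.$$ For independent standard $\alpha$-stable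 $\rho^1,\rho^2$, $x,y\in\mathbb R$, and $\psi\in\mathcal S$ or $\psi$ a finite linear combination of indicators of bounded intervals, $\langle\Lambda(x+\rho^1,y+\rho^2;T),\psi\rangle$ denotes the $L^2(\Omega)$-limit of $\langle\Lambda^f_\varepsilon(x+\rho^1,y+\rho^2;T),\psi\rangle$ as $\varepsilon\to0$, which exists and does not depend on $f\in\mathcal F$; the convergence also holds in $L^2(\mathbb R^2\times\Omega,\lambda\otimes\lambda\otimes P)$ as functions of $(x,y,\omega)$ ($\lambda$ Lebesgue measure), which gives meaning to $\Lambda(x_j+\rho^j,x_k+\rho^k;T)$. *)

theory Defs
  imports "HOL-Probability.Probability"
begin

subsection \<open>Convergence in mean square\<close>

definition square_integrable :: "'a measure \<Rightarrow> ('a \<Rightarrow> real) \<Rightarrow> bool" where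
  "square_integrable N g \<longleftrightarrow> g \<in> borel_measurable N \<and> integrable N (\<lambda>z. (g z)\<^sup>2)"

definition L2_tendsto :: "'a measure \<Rightarrow> ('i \<Rightarrow> 'a \<Rightarrow> real) \<Rightarrow> ('a \<Rightarrow> real) \<Rightarrow> 'i filter \<Rightarrow> bool" where
  "L2_tendsto N X L F \<longleftrightarrow>
     square_integrable N L \<and>
     (\<forall>\<^sub>F i in F. square_integrable N (X i)) \<and>
     ((\<lambda>i. \<integral>z. (X i z - L z)\<^sup>2 \<partial>N) \<longlongrightarrow> 0) F"


subsection \<open>The particle system\<close>

definition generated_sets :: "'w measure \<Rightarrow> 'i set \<Rightarrow> ('i \<Rightarrow> 'w \<Rightarrow> real) \<Rightarrow> 'w set set" where
  "generated_sets M I X =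
     sigma_sets (space M) {X i -` A \<inter> space M | i A. i \<in> I \<and> A \<in> sets borel}"

text \<open>
  A Poisson random field on the line has infinitely many points almost surely, so its points can
  be enumerated as a sequence of random variables; any measurable enumeration is allowed.
  The Poisson weights are written out because the library's \<open>poisson_pmf\<close> assumes a positive
  rate, whereas null sets give rate \<open>0\<close>.
\<close>

definition point_count :: "(nat \<Rightarrow> 'w \<Rightarrow> real) \<Rightarrow> real set \<Rightarrow> 'w \<Rightarrow> ennreal" where
  "point_count x B \<omega> = emeasure (count_space UNIV) {j. x j \<omega> \<in> B}"

definition poisson_field :: "'w measure \<Rightarrow> (nat \<Rightarrow> 'w \<Rightarrow> real) \<Rightarrow> bool" where
  "poisson_field M x \<longleftrightarrow>
     (\<forall>j. x j \<in> borel_measurable M) \<and>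
     (\<forall>B \<in> sets borel. emeasure lborel B < \<infinity> \<longrightarrow>
        (\<forall>n::nat. measure M {\<omega> \<in> space M. point_count x B \<omega> = of_nat n} =
           measure lborel B ^ n / fact n * exp (- measure lborel B))) \<and>
     (\<forall>B :: nat \<Rightarrow> real set. range B \<subseteq> sets borel \<and> disjoint_family B \<longrightarrow>
        prob_space.indep_vars M (\<lambda>_. borel) (\<lambda>i. point_count x (B i)) UNIV)"

definition cadlag :: "(real \<Rightarrow> real) \<Rightarrow> bool" where
  "cadlag \<eta> \<longleftrightarrow>
     (\<forall>t\<ge>0. (\<eta> \<longlongrightarrow> \<eta> t) (at_right t)) \<and> (\<forall>t>0. \<exists>l. (\<eta> \<longlongrightarrow> l) (at_left t))"

text \<open>
  Processes are indexed by all reals, but only their values at nonnegative times matter.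
  A finite increasing family of times extends to a monotone sequence, so quantifying over
  monotone sequences below expresses independence of all finite families of increments.
\<close>

definition standard_stable_levy :: "'w measure \<Rightarrow> real \<Rightarrow> (real \<Rightarrow> 'w \<Rightarrow> real) \<Rightarrow> bool" where
  "standard_stable_levy M \<alpha> X \<longleftrightarrow>
     (\<forall>t\<ge>0. X t \<in> borel_measurable M) \<and>
     (\<forall>\<omega>\<in>space M. X 0 \<omega> = 0 \<and> cadlag (\<lambda>t. X t \<omega>)) \<and>
     (\<forall>s t z. 0 \<le> s \<and> s \<le> t \<longrightarrow>
        char (distr M borel (\<lambda>\<omega>. X t \<omega> - X s \<omega>)) z =
          of_real (exp (- (t - s) * \<bar>z\<bar> powr \<alpha>))) \<and>
     (\<forall>\<tau> :: nat \<Rightarrow> real. mono \<tau> \<and> 0 \<le> \<tau> 0 \<longrightarrow>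
        prob_space.indep_vars M (\<lambda>_. borel)
          (\<lambda>i \<omega>. X (\<tau> (Suc i)) \<omega> - X (\<tau> i) \<omega>) UNIV)"

datatype source = Positions | Motion nat | Charge nat

fun source_sets ::
  "'w measure \<Rightarrow> (nat \<Rightarrow> 'w \<Rightarrow> real) \<Rightarrow> (nat \<Rightarrow> real \<Rightarrow> 'w \<Rightarrow> real) \<Rightarrow> (nat \<Rightarrow> 'w \<Rightarrow> real)
    \<Rightarrow> source \<Rightarrow> 'w set set" where
  "source_sets M x \<rho> \<sigma> Positions = generated_sets M UNIV x"
| "source_sets M x \<rho> \<sigma> (Motion j) = generated_sets M {0..} (\<rho> j)"
| "source_sets M x \<rho> \<sigma> (Charge j) = generated_sets M {j} \<sigma>"

text \<open>
  The motions and charges are independent of the enumerated positions, not merely of the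
  unordered point configuration; otherwise the labelling could correlate them with the points.
\<close>

definition charged_stable_system ::
  "'w measure \<Rightarrow> real \<Rightarrow> (nat \<Rightarrow> 'w \<Rightarrow> real) \<Rightarrow> (nat \<Rightarrow> real \<Rightarrow> 'w \<Rightarrow> real)
    \<Rightarrow> (nat \<Rightarrow> 'w \<Rightarrow> real) \<Rightarrow> bool" where
  "charged_stable_system M \<alpha> x \<rho> \<sigma> \<longleftrightarrow>
     prob_space M \<and>
     poisson_field M x \<and>
     (\<forall>j. standard_stable_levy M \<alpha> (\<rho> j)) \<and>
     (\<forall>j. \<sigma> j \<in> borel_measurable M \<and>
        measure M {\<omega> \<in> space M. \<sigma> j \<omega> = 1} = 1 / 2 \<and>
        measure M {\<omega> \<in> space M. \<sigma> j \<omega> = - 1} = 1 / 2) \<and>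
     prob_space.indep_sets M (source_sets M x \<rho> \<sigma>) UNIV"


subsection \<open>Intersection local time\<close>

definition mollifiers :: "(real \<Rightarrow> real) set" where
  "mollifiers = {f. (\<forall>x. 0 \<le> f x) \<and> (\<forall>x. f (- x) = f x) \<and>
     (\<forall>n. (deriv ^^ n) f differentiable_on UNIV) \<and>
     compact (closure {x. f x \<noteq> 0}) \<and> (\<integral>x. f x \<partial>lborel) = 1}"

definition rescale :: "(real \<Rightarrow> real) \<Rightarrow> real \<Rightarrow> real \<Rightarrow> real" where
  "rescale f \<epsilon> x = inverse \<epsilon> * f (x / \<epsilon>)"

definition ilt_approx ::
  "(real \<Rightarrow> real) \<Rightarrow> real \<Rightarrow> real \<Rightarrow> (real \<Rightarrow> real) \<Rightarrow> (real \<Rightarrow> real) \<Rightarrow> (real \<Rightarrow> real) \<Rightarrow> real" where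
  "ilt_approx f \<epsilon> T \<psi> \<eta>1 \<eta>2 =
     (LINT v:{0..T}|lborel. (LINT u:{0..T}|lborel. rescale f \<epsilon> (\<eta>2 v - \<eta>1 u) * \<psi> (\<eta>1 u)))"

definition path_pair_space ::
  "'w measure \<Rightarrow> (real \<Rightarrow> 'w \<Rightarrow> real) \<Rightarrow> (real \<Rightarrow> 'w \<Rightarrow> real) \<Rightarrow> 'w measure" where
  "path_pair_space M \<rho>1 \<rho>2 =
     restr_to_subalg M (sigma (space M) (generated_sets M {0..} \<rho>1 \<union> generated_sets M {0..} \<rho>2))"

text \<open>
  The field \<open>(x, y, \<omega>) \<mapsto> \<langle>\<Lambda>(x + \<rho>1, y + \<rho>2; T), \<psi>\<rangle>(\<omega>)\<close> as a limit in \<open>L\<^sup>2(\<real>\<^sup>2 \<times> \<Omega>)\<close>, for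
  every mollifier. The limit is taken with respect to the \<open>\<sigma>\<close>-algebra generated by the two
  paths. This matters when random points are substituted for \<open>x\<close> and \<open>y\<close>: a representative that
  is only measurable for the full \<open>\<sigma>\<close>-algebra could be altered on a null set such as
  \<open>{(x, y, \<omega>). x = x\<^sub>j(\<omega>)}\<close>, whereas two representatives measurable for the smaller one still
  agree almost surely after inserting points that are independent of the paths and whose joint
  law is absolutely continuous.
\<close>

definition is_ilt ::
  "'w measure \<Rightarrow> real \<Rightarrow> (real \<Rightarrow> real) \<Rightarrow> (real \<Rightarrow> 'w \<Rightarrow> real) \<Rightarrow> (real \<Rightarrow> 'w \<Rightarrow> real)
    \<Rightarrow> (real \<times> real \<times> 'w \<Rightarrow> real) \<Rightarrow> bool" where
  "is_ilt M T \<psi> \<rho>1 \<rho>2 \<Lambda> \<longleftrightarrow>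
     (\<forall>f \<in> mollifiers.
        L2_tendsto (lborel \<Otimes>\<^sub>M lborel \<Otimes>\<^sub>M path_pair_space M \<rho>1 \<rho>2)
          (\<lambda>\<epsilon> (x, y, \<omega>). ilt_approx f \<epsilon> T \<psi> (\<lambda>u. x + \<rho>1 u \<omega>) (\<lambda>v. y + \<rho>2 v \<omega>))
          \<Lambda> (at_right 0))"

definition ilt ::
  "'w measure \<Rightarrow> real \<Rightarrow> (real \<Rightarrow> real) \<Rightarrow> (real \<Rightarrow> 'w \<Rightarrow> real) \<Rightarrow> (real \<Rightarrow> 'w \<Rightarrow> real)
    \<Rightarrow> real \<times> real \<times> 'w \<Rightarrow> real" where
  "ilt M T \<psi> \<rho>1 \<rho>2 = (SOME \<Lambda>. is_ilt M T \<psi> \<rho>1 \<rho>2 \<Lambda>)"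


subsection \<open>The process\<close>

definition distinct_pairs :: "(nat \<times> nat) set" where
  "distinct_pairs = {(j, k). j \<noteq> k}"

definition xi_partial ::
  "'w measure \<Rightarrow> real \<Rightarrow> (nat \<Rightarrow> 'w \<Rightarrow> real) \<Rightarrow> (nat \<Rightarrow> real \<Rightarrow> 'w \<Rightarrow> real) \<Rightarrow> (nat \<Rightarrow> 'w \<Rightarrow> real)
    \<Rightarrow> real \<Rightarrow> (nat \<times> nat) set \<Rightarrow> 'w \<Rightarrow> real" where
  "xi_partial M T x \<rho> \<sigma> t J \<omega> =
     (1 / T) * (\<Sum>(j, k)\<in>J. \<sigma> j \<omega> * \<sigma> k \<omega> *
        ilt M T (indicator {0..t}) (\<rho> j) (\<rho> k) (x j \<omega>, x k \<omega>, \<omega>))"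

text \<open>
  The index set of the series carries no order, so the series is summed along the net of finite
  sets of pairs.
\<close>

definition is_xi ::
  "'w measure \<Rightarrow> real \<Rightarrow> (nat \<Rightarrow> 'w \<Rightarrow> real) \<Rightarrow> (nat \<Rightarrow> real \<Rightarrow> 'w \<Rightarrow> real) \<Rightarrow> (nat \<Rightarrow> 'w \<Rightarrow> real)
    \<Rightarrow> real \<Rightarrow> ('w \<Rightarrow> real) \<Rightarrow> bool" where
  "is_xi M T x \<rho> \<sigma> t Z \<longleftrightarrow>
     L2_tendsto M (xi_partial M T x \<rho> \<sigma> t) Z (finite_subsets_at_top distinct_pairs)"

definition continuous_modification ::
  "'w measure \<Rightarrow> (real \<Rightarrow> 'w \<Rightarrow> real) \<Rightarrow> (real \<Rightarrow> 'w \<Rightarrow> real) \<Rightarrow> bool" where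
  "continuous_modification M X Y \<longleftrightarrow>
     (\<forall>t\<ge>0. Y t \<in> borel_measurable M \<and> (AE \<omega> in M. Y t \<omega> = X t \<omega>)) \<and>
     (\<forall>\<omega>\<in>space M. continuous_on {0..} (\<lambda>t. Y t \<omega>))"

end

theory Submission
  imports Defs "HOL-Computational_Algebra.Polynomial"
begin

text \<open>
  The process is a sum over pairs of particles, and everything rests on second moments. If the two
  starting points of a pair of paths are integrated over the plane, the second moment of a mollified
  intersection local time with test function \<open>\<psi>\<close> no longer sees the paths but only their increments:
  as the mollifier shrinks it tends to \<open>\<integral> \<Psi>(b) G(b)\<^sup>2 db\<close>, where \<open>\<Psi>\<close> is the autocorrelation of \<open>\<psi>\<close>
  and \<open>G\<close> the density of the occupation measure of the increments \<open>\<rho>\<^sub>v - \<rho>\<^sub>u\<close>, \<open>0 \<le> u, v \<le> T\<close>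
  (\<open>nn_integral_smear_mult\<close>).

  Self-similarity expresses \<open>G\<close> through the stable law at time one and yields the bound
  \<open>G(b) \<le> C \<bar>b\<bar>\<^sup>\<alpha>\<^sup>-\<^sup>1\<close>, with a constant that is finite because the stable law has a finite moment of
  order \<open>-\<alpha>\<close> for \<open>\<alpha> < 1\<close> (\<open>stable_negative_moment\<close>). For \<open>\<alpha> > 1/2\<close> the density is therefore square
  integrable, and since it is continuous away from zero, correlations \<open>\<integral> \<Psi>(b) G(b) G(b + w) db\<close> are
  continuous at \<open>w = 0\<close>. Hence the correlations of the approximations built from two mollifiers, equal
  or not, have one and the same limit. So the approximations form a Cauchy family in mean square, and
  the limit is the same for every mollifier (\<open>approx_field_converges\<close>). For the indicator of an
  interval of length \<open>h\<close> the function \<open>\<Psi>\<close> is at most \<open>h\<close> and vanishes outside \<open>[-h, h]\<close>, so the second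
  moment of the limit is at most of order \<open>h\<^sup>2\<^sup>\<alpha>\<close> (\<open>energy_le\<close>).

  The plane enters through the Poisson field: the joint laws of all pairs of distinct points sum to
  planar Lebesgue measure (\<open>poisson_pairs\<close>). As the paths are independent of the points and have the
  same law for all pairs, the second moments of all terms of the series add up to at most a constant
  times \<open>h\<^sup>2\<^sup>\<alpha>\<close> (\<open>sum_second_moments_le\<close>). The charges make terms of different unordered pairs
  orthogonal, so the second moment of a finite sum is at most twice the sum of the second moments
  (\<open>charged_sum_le\<close>). This gives convergence of the series. The increment of the process over
  \<open>(s, t]\<close> is the same series for the indicator of this interval, and its second moment is at most a
  constant times \<open>(t - s)\<^sup>2\<^sup>\<alpha>\<close>. Since \<open>2\<alpha> > 1\<close>, Kolmogorov's criterion
  (\<open>continuous_modification_if_increments\<close>) provides the continuous modification.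
\<close>

section \<open>Mean-square convergence\<close>

lemma square_integrableD:
  assumes "square_integrable N g"
  shows "g \<in> borel_measurable N" "integrable N (\<lambda>z. (g z)\<^sup>2)"
  using assms by (auto simp: square_integrable_def)

lemma square_integrable_mult:
  assumes f: "square_integrable N f" and g: "square_integrable N g"
  shows "integrable N (\<lambda>z. f z * g z)"
proof (rule Bochner_Integration.integrable_bound[where f = "\<lambda>z. (f z)\<^sup>2 + (g z)\<^sup>2"])
  show "integrable N (\<lambda>z. (f z)\<^sup>2 + (g z)\<^sup>2)"
    using f g by (auto simp: square_integrable_def)
  show "(\<lambda>z. f z * g z) \<in> borel_measurable N"
    using f g by (auto simp: square_integrable_def)
  have "\<bar>a * b\<bar> \<le> a\<^sup>2 + b\<^sup>2" for a b :: real
  proof -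
    have "0 \<le> (\<bar>a\<bar> - \<bar>b\<bar>)\<^sup>2" by simp
    then have "2 * (\<bar>a\<bar> * \<bar>b\<bar>) \<le> a\<^sup>2 + b\<^sup>2"
      by (simp add: power2_diff)
    then show ?thesis
      using abs_ge_zero[of "a * b"] unfolding abs_mult by linarith
  qed
  then show "AE z in N. norm (f z * g z) \<le> norm ((f z)\<^sup>2 + (g z)\<^sup>2)"
    by auto
qed

lemma square_integrable_cmult:
  "square_integrable N f \<Longrightarrow> square_integrable N (\<lambda>z. c * f z)"
  by (auto simp: square_integrable_def power_mult_distrib)

lemma square_integrable_add:
  assumes f: "square_integrable N f" and g: "square_integrable N g"
  shows "square_integrable N (\<lambda>z. f z + g z)"
  using square_integrable_mult[OF f g] f g
  by (auto simp: square_integrable_def power2_sum mult.assoc)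

lemma square_integrable_diff:
  assumes f: "square_integrable N f" and g: "square_integrable N g"
  shows "square_integrable N (\<lambda>z. f z - g z)"
  using square_integrable_mult[OF f g] f g
  by (auto simp: square_integrable_def power2_diff mult.assoc)

lemma square_integrable_sum:
  assumes "\<And>i. i \<in> I \<Longrightarrow> square_integrable N (f i)"
  shows "square_integrable N (\<lambda>z. \<Sum>i\<in>I. f i z)"
  using assms
proof (induction I rule: infinite_finite_induct)
  case (insert i I)
  then show ?case by (simp add: square_integrable_add)
qed (auto simp: square_integrable_def)

lemma power2_diff_le: "(a - c)\<^sup>2 \<le> 2 * (a - b)\<^sup>2 + 2 * (b - c)\<^sup>2" for a b c :: real
proof -
  have "0 \<le> ((a - b) - (b - c))\<^sup>2" by simp
  then show ?thesis by (simp add: power2_eq_square algebra_simps)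
qed

lemma integral_power2_diff_le:
  assumes "square_integrable N f" "square_integrable N g" "square_integrable N h"
  shows "(\<integral>z. (f z - h z)\<^sup>2 \<partial>N) \<le> 2 * (\<integral>z. (f z - g z)\<^sup>2 \<partial>N) + 2 * (\<integral>z. (g z - h z)\<^sup>2 \<partial>N)"
proof -
  note [simp] = square_integrableD(2)[OF square_integrable_diff]
  have "(\<integral>z. (f z - h z)\<^sup>2 \<partial>N) \<le> (\<integral>z. 2 * (f z - g z)\<^sup>2 + 2 * (g z - h z)\<^sup>2 \<partial>N)"
    using assms by (intro integral_mono power2_diff_le) auto
  then show ?thesis using assms by simp
qed

lemma nn_integral_square:
  assumes "square_integrable N f"
  shows "(\<integral>\<^sup>+z. ennreal ((f z)\<^sup>2) \<partial>N) = ennreal (\<integral>z. (f z)\<^sup>2 \<partial>N)"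
  using assms by (intro nn_integral_eq_integral) (auto simp: square_integrable_def)

lemma square_integrable_nn:
  assumes "f \<in> borel_measurable N" "(\<integral>\<^sup>+z. ennreal ((f z)\<^sup>2) \<partial>N) < \<infinity>"
  shows "square_integrable N f"
  using assms by (auto simp: square_integrable_def integrable_iff_bounded)

text \<open>
  The factor two is the price for using \<open>(a - c)\<^sup>2 \<le> 2 (a - b)\<^sup>2 + 2 (b - c)\<^sup>2\<close> in place of the
  triangle inequality for the norm; all estimates below are only needed up to a constant.
\<close>

lemma L2_tendsto_integral_le:
  assumes lim: "L2_tendsto N X L F" and "F \<noteq> bot"
    and bound: "\<forall>\<^sub>F i in F. (\<integral>z. (X i z)\<^sup>2 \<partial>N) \<le> c i" and c: "(c \<longlongrightarrow> c0) F"
  shows "(\<integral>z. (L z)\<^sup>2 \<partial>N) \<le> 2 * c0"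
proof (rule tendsto_lowerbound)
  show "((\<lambda>i. 2 * (\<integral>z. (X i z - L z)\<^sup>2 \<partial>N) + 2 * c i) \<longlongrightarrow> 2 * c0) F"
    using lim c unfolding L2_tendsto_def by (auto intro!: tendsto_eq_intros)
  have sq: "\<forall>\<^sub>F i in F. square_integrable N (X i)" "square_integrable N L"
    using lim by (auto simp: L2_tendsto_def)
  show "\<forall>\<^sub>F i in F. (\<integral>z. (L z)\<^sup>2 \<partial>N) \<le> 2 * (\<integral>z. (X i z - L z)\<^sup>2 \<partial>N) + 2 * c i"
    using sq(1) bound
  proof eventually_elim
    case (elim i)
    have "square_integrable N (\<lambda>_. 0)" by (simp add: square_integrable_def)
    from integral_power2_diff_le[OF sq(2) elim(1) this] elim(2)
    show ?case by (simp add: power2_commute[of "L _"])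
  qed
qed fact

lemma L2_tendsto_diff:
  assumes X: "L2_tendsto N X L F" and Y: "L2_tendsto N Y K F"
  shows "L2_tendsto N (\<lambda>i z. X i z - Y i z) (\<lambda>z. L z - K z) F"
proof -
  have sq: "square_integrable N L" "square_integrable N K"
    "\<forall>\<^sub>F i in F. square_integrable N (X i) \<and> square_integrable N (Y i)"
    using X Y by (auto simp: L2_tendsto_def eventually_conj_iff)
  have "((\<lambda>i. 2 * (\<integral>z. (X i z - L z)\<^sup>2 \<partial>N) + 2 * (\<integral>z. (Y i z - K z)\<^sup>2 \<partial>N)) \<longlongrightarrow> 2 * 0 + 2 * 0) F"
    using X Y unfolding L2_tendsto_def by (intro tendsto_intros) auto
  then have lim0: "((\<lambda>i. 2 * (\<integral>z. (X i z - L z)\<^sup>2 \<partial>N) + 2 * (\<integral>z. (Y i z - K z)\<^sup>2 \<partial>N)) \<longlongrightarrow> 0) F"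
    by simp
  have "((\<lambda>i. \<integral>z. (X i z - Y i z - (L z - K z))\<^sup>2 \<partial>N) \<longlongrightarrow> 0) F"
  proof (rule tendsto_sandwich[OF _ _ tendsto_const lim0])
    show "\<forall>\<^sub>F i in F. (\<integral>z. (X i z - Y i z - (L z - K z))\<^sup>2 \<partial>N)
        \<le> 2 * (\<integral>z. (X i z - L z)\<^sup>2 \<partial>N) + 2 * (\<integral>z. (Y i z - K z)\<^sup>2 \<partial>N)"
      using sq(3)
    proof eventually_elim
      case (elim i)
      then have "square_integrable N (\<lambda>z. X i z - L z)" "square_integrable N (\<lambda>z. Y i z - K z)"
        "square_integrable N (\<lambda>z. 0)"
        using sq by (auto intro: square_integrable_diff simp: square_integrable_def[of N "\<lambda>_. 0"])
      from integral_power2_diff_le[OF this(1) this(3) this(2)] show ?case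
        by (simp add: algebra_simps power2_commute[of "K _"])
    qed
  qed auto
  moreover have "\<forall>\<^sub>F i in F. square_integrable N (\<lambda>z. X i z - Y i z)"
    using sq(3) by eventually_elim (auto intro: square_integrable_diff)
  ultimately show ?thesis
    using sq by (auto simp: L2_tendsto_def intro: square_integrable_diff)
qed

lemma AE_summable:
  fixes g :: "nat \<Rightarrow> 'a \<Rightarrow> real"
  assumes g: "\<And>n. integrable N (g n)" "\<And>n z. 0 \<le> g n z"
    and summ: "summable (\<lambda>n. \<integral>z. g n z \<partial>N)"
  shows "AE z in N. summable (\<lambda>n. g n z)"
proof -
  have "(\<integral>\<^sup>+z. (\<Sum>n. ennreal (g n z)) \<partial>N) = (\<Sum>n. \<integral>\<^sup>+z. ennreal (g n z) \<partial>N)"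
    using g by (intro nn_integral_suminf) (auto intro: borel_measurable_integrable)
  also have "\<dots> = (\<Sum>n. ennreal (\<integral>z. g n z \<partial>N))"
    using g by (intro suminf_cong nn_integral_eq_integral) auto
  also have "\<dots> = ennreal (\<Sum>n. \<integral>z. g n z \<partial>N)"
    using g summ by (intro suminf_ennreal2) auto
  finally have "(\<integral>\<^sup>+z. (\<Sum>n. ennreal (g n z)) \<partial>N) \<noteq> \<infinity>" by simp
  moreover have "(\<lambda>z. \<Sum>n. ennreal (g n z)) \<in> borel_measurable N"
    using g by (auto intro!: borel_measurable_suminf_order borel_measurable_integrable)
  ultimately have "AE z in N. (\<Sum>n. ennreal (g n z)) \<noteq> \<infinity>"
    by (rule nn_integral_noteq_infinite[rotated])
  then show ?thesis
    by eventually_elim (use g in \<open>auto intro: summable_suminf_not_top\<close>)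
qed

text \<open>
  The inequality \<open>2 \<bar>d\<bar> \<le> 2\<^sup>-\<^sup>n + 2\<^sup>n d\<^sup>2\<close> turns the rapid decay of the second moments of the
  differences \<open>d\<close> into almost sure absolute convergence of their sum, and Fatou's lemma controls the
  distance to the pointwise limit.
\<close>

lemma L2_complete_sequence:
  fixes Y :: "nat \<Rightarrow> 'a \<Rightarrow> real"
  assumes Y: "\<And>n. square_integrable N (Y n)"
    and cauchy: "\<And>m n. n \<le> m \<Longrightarrow> (\<integral>z. (Y n z - Y m z)\<^sup>2 \<partial>N) \<le> (1/8) ^ n"
  shows "\<exists>L. square_integrable N L \<and> (\<forall>n. (\<integral>z. (Y n z - L z)\<^sup>2 \<partial>N) \<le> (1/8) ^ n)"
proof -
  have Ym [measurable]: "Y n \<in> borel_measurable N" for n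
    using Y by (auto simp: square_integrable_def)
  have sqd: "square_integrable N (\<lambda>z. Y n z - Y m z)" for n m
    using Y by (intro square_integrable_diff)
  define L where "L z = lim (\<lambda>n. Y n z)" for z
  have Lm [measurable]: "L \<in> borel_measurable N"
    unfolding L_def by (rule borel_measurable_lim_metric) simp
  have "AE z in N. summable (\<lambda>n. 2 ^ n * (Y n z - Y (Suc n) z)\<^sup>2)"
  proof (rule AE_summable)
    show "integrable N (\<lambda>z. 2 ^ n * (Y n z - Y (Suc n) z)\<^sup>2)" for n
      using square_integrableD[OF sqd[of n "Suc n"]] by auto
    show "summable (\<lambda>n. \<integral>z. 2 ^ n * (Y n z - Y (Suc n) z)\<^sup>2 \<partial>N)"
    proof (rule summable_comparison_test')
      show "summable (\<lambda>n. (1/4::real) ^ n)" by (rule summable_geometric) simp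
      fix n
      have "(2::real) ^ n * (\<integral>z. (Y n z - Y (Suc n) z)\<^sup>2 \<partial>N) \<le> 2 ^ n * (1/8) ^ n"
        using cauchy[of n "Suc n"] by (intro mult_left_mono) auto
      also have "\<dots> = (1/4) ^ n" by (simp add: power_mult_distrib[symmetric])
      finally show "norm (\<integral>z. 2 ^ n * (Y n z - Y (Suc n) z)\<^sup>2 \<partial>N) \<le> (1/4) ^ n" by simp
    qed
  qed simp
  then have lim: "AE z in N. (\<lambda>n. Y n z) \<longlonglongrightarrow> L z"
  proof eventually_elim
    case (elim z)
    have "summable (\<lambda>n. Y (Suc n) z - Y n z)"
    proof (rule summable_comparison_test')
      show "summable (\<lambda>n. (1/2) ^ n + 2 ^ n * (Y n z - Y (Suc n) z)\<^sup>2)"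
        by (intro summable_add summable_geometric elim) auto
      fix n
      let ?d = "\<bar>Y n z - Y (Suc n) z\<bar>" and ?q = "(2::real) ^ n"
      have "0 \<le> (1 - ?q * ?d)\<^sup>2" by simp
      also have "\<dots> = ?q * ((1/2) ^ n + ?q * ?d\<^sup>2 - 2 * ?d)"
        by (simp add: power2_eq_square field_simps power_divide)
      finally have "0 \<le> (1/2) ^ n + ?q * ?d\<^sup>2 - 2 * ?d"
        using zero_less_power[of "2::real" n] by (subst (asm) zero_le_mult_iff) linarith
      then show "norm (Y (Suc n) z - Y n z) \<le> (1/2) ^ n + ?q * (Y n z - Y (Suc n) z)\<^sup>2"
        unfolding real_norm_def abs_minus_commute[of "Y (Suc n) z"] power2_abs
        by (rule order.trans[rotated, OF diff_ge_0_iff_ge[THEN iffD1]]) simp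
    qed
    then have "summable (\<lambda>n. Y (Suc n) z - Y n z)" .
    from summable_LIMSEQ[OF this] have "convergent (\<lambda>n. \<Sum>i<n. Y (Suc i) z - Y i z)"
      by (rule convergentI)
    then have "convergent (\<lambda>n. Y n z - Y 0 z)"
      by (simp only: sum_lessThan_telescope[of "\<lambda>n. Y n z"])
    from convergent_add[OF this convergent_const[of "Y 0 z"]] show ?case by (simp add: L_def convergent_LIMSEQ_iff)
  qed
  have fatou: "(\<integral>\<^sup>+z. ennreal ((Y n z - L z)\<^sup>2) \<partial>N) \<le> ennreal ((1/8) ^ n)" for n
  proof -
    have "(\<integral>\<^sup>+z. ennreal ((Y n z - L z)\<^sup>2) \<partial>N)
        = (\<integral>\<^sup>+z. liminf (\<lambda>m. ennreal ((Y n z - Y m z)\<^sup>2)) \<partial>N)"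
    proof (rule nn_integral_cong_AE, use lim in eventually_elim)
      fix z assume "(\<lambda>m. Y m z) \<longlonglongrightarrow> L z"
      then have "(\<lambda>m. ennreal ((Y n z - Y m z)\<^sup>2)) \<longlonglongrightarrow> ennreal ((Y n z - L z)\<^sup>2)"
        by (intro tendsto_intros)
      from lim_imp_Liminf[OF _ this]
      show "ennreal ((Y n z - L z)\<^sup>2) = liminf (\<lambda>m. ennreal ((Y n z - Y m z)\<^sup>2))" by simp
    qed
    also have "\<dots> \<le> liminf (\<lambda>m. \<integral>\<^sup>+z. ennreal ((Y n z - Y m z)\<^sup>2) \<partial>N)"
      by (intro nn_integral_liminf) simp
    also have "\<dots> \<le> liminf (\<lambda>m. ennreal ((1/8) ^ n))"
    proof (rule Liminf_mono, rule eventually_sequentiallyI)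
      fix m assume "n \<le> m"
      then show "(\<integral>\<^sup>+z. ennreal ((Y n z - Y m z)\<^sup>2) \<partial>N) \<le> ennreal ((1/8) ^ n)"
        using cauchy[of n m] by (simp add: nn_integral_square[OF sqd] ennreal_leI)
    qed
    also have "\<dots> = ennreal ((1/8) ^ n)" by (simp add: Liminf_const)
    finally show ?thesis .
  qed
  have sqL': "square_integrable N (\<lambda>z. Y n z - L z)" for n
    using fatou[of n] by (intro square_integrable_nn) (auto intro: order.strict_trans1)
  have "square_integrable N (\<lambda>z. Y 0 z - (Y 0 z - L z))"
    by (intro square_integrable_diff Y sqL')
  then have sqL: "square_integrable N L" by simp
  have "(\<integral>z. (Y n z - L z)\<^sup>2 \<partial>N) \<le> (1/8) ^ n" for n
    using fatou[of n] by (simp add: nn_integral_square[OF sqL'] ennreal_le_iff)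
  with sqL show ?thesis by auto
qed

text \<open>
  Choosing one index in each member of a decreasing sequence of sufficiently small sets of the filter
  produces a rapidly Cauchy sequence, and the whole family approaches its limit.
\<close>

lemma L2_complete:
  fixes X :: "'i \<Rightarrow> 'a \<Rightarrow> real"
  assumes "F \<noteq> bot" and sq: "\<forall>\<^sub>F i in F. square_integrable N (X i)"
    and cauchy: "\<And>e. 0 < e \<Longrightarrow> \<exists>P. eventually P F \<and>
      (\<forall>i j. P i \<longrightarrow> P j \<longrightarrow> (\<integral>z. (X i z - X j z)\<^sup>2 \<partial>N) \<le> e)"
  shows "\<exists>L. L2_tendsto N X L F"
proof -
  obtain P where P: "\<And>n. eventually (P n) F"
    "\<And>n i j. P n i \<Longrightarrow> P n j \<Longrightarrow> (\<integral>z. (X i z - X j z)\<^sup>2 \<partial>N) \<le> (1/8) ^ n"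
    using cauchy[of "(1/8) ^ n" for n] by (simp; metis)
  define Q where "Q n i \<longleftrightarrow> square_integrable N (X i) \<and> (\<forall>m\<le>n. P m i)" for n i
  have Q: "eventually (Q n) F" for n
    unfolding Q_def using sq P(1) eventually_ball_finite_distrib[of "{..n}" "\<lambda>i m. P m i" F]
    by (intro eventually_conj) (auto simp: Ball_def)
  have "\<exists>i. Q n i" for n
    using eventually_happens'[OF \<open>F \<noteq> bot\<close> Q] .
  then obtain k where k: "Q n (k n)" for n
    by metis
  have "\<exists>L. square_integrable N L \<and> (\<forall>n. (\<integral>z. (X (k n) z - L z)\<^sup>2 \<partial>N) \<le> (1/8) ^ n)"
  proof (rule L2_complete_sequence)
    show "square_integrable N (X (k n))" for n using k by (simp add: Q_def)
    show "(\<integral>z. (X (k n) z - X (k m) z)\<^sup>2 \<partial>N) \<le> (1/8) ^ n" if "n \<le> m" for m n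
      using k[of n] k[of m] that by (intro P(2)) (auto simp: Q_def)
  qed
  then obtain L where L: "square_integrable N L" "\<And>n. (\<integral>z. (X (k n) z - L z)\<^sup>2 \<partial>N) \<le> (1/8) ^ n"
    by blast
  have "((\<lambda>i. \<integral>z. (X i z - L z)\<^sup>2 \<partial>N) \<longlongrightarrow> 0) F"
  proof (rule tendstoI)
    fix e :: real assume "0 < e"
    have "(\<lambda>n. 4 * (1/8::real) ^ n) \<longlonglongrightarrow> 4 * 0" by (intro tendsto_intros LIMSEQ_power_zero) simp
    then have "\<forall>\<^sub>F n in sequentially. 4 * (1/8::real) ^ n < e"
      using order_tendstoD(2)[of _ "4 * 0"] \<open>0 < e\<close> by fastforce
    then obtain n where n: "4 * (1/8::real) ^ n < e" by (auto simp: eventually_sequentially)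
    show "\<forall>\<^sub>F i in F. dist (\<integral>z. (X i z - L z)\<^sup>2 \<partial>N) 0 < e"
      using Q[of n]
    proof eventually_elim
      case (elim i)
      have "(\<integral>z. (X i z - L z)\<^sup>2 \<partial>N)
          \<le> 2 * (\<integral>z. (X i z - X (k n) z)\<^sup>2 \<partial>N) + 2 * (\<integral>z. (X (k n) z - L z)\<^sup>2 \<partial>N)"
        using elim k[of n] L(1) by (intro integral_power2_diff_le) (auto simp: Q_def)
      also have "\<dots> \<le> 2 * (1/8) ^ n + 2 * (1/8) ^ n"
        using elim k[of n] L(2)[of n] by (intro add_mono mult_left_mono P(2)) (auto simp: Q_def)
      finally show ?case using n by simp
    qed
  qed
  with sq L(1) show ?thesis unfolding L2_tendsto_def by blast
qed

section \<open>Continuous modifications from second moments of increments\<close>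

text \<open>
  The piecewise linear function with value \<open>a k\<close> at the integer point \<open>k\<close>. On bounded intervals
  it is a finite combination of hat functions, which makes continuity evident.
\<close>

definition linear_interpolation :: "(nat \<Rightarrow> real) \<Rightarrow> real \<Rightarrow> real" where
  "linear_interpolation a s =
     (let j = nat \<lfloor>s\<rfloor>; r = s - real j in (1 - r) * a j + r * a (Suc j))"

lemma nat_floor_bounds:
  assumes "0 \<le> s"
  shows "real (nat \<lfloor>s\<rfloor>) \<le> s" "s < real (nat \<lfloor>s\<rfloor>) + 1"
  using assms by (simp_all add: of_nat_floor)

lemma linear_interpolation_hat:
  assumes s: "0 \<le> s" "s < real K"
  shows "linear_interpolation a s = (\<Sum>k\<le>K. a k * max 0 (1 - \<bar>s - real k\<bar>))"
proof -
  define j where "j = nat \<lfloor>s\<rfloor>"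
  have j: "real j \<le> s" "s < real j + 1"
    using nat_floor_bounds[OF s(1)] by (simp_all add: j_def)
  have "(\<Sum>k\<le>K. a k * max 0 (1 - \<bar>s - real k\<bar>)) = (\<Sum>k\<in>{j, Suc j}. a k * max 0 (1 - \<bar>s - real k\<bar>))"
  proof (rule sum.mono_neutral_right)
    show "{j, Suc j} \<subseteq> {..K}" using j s by auto
    show "\<forall>k\<in>{..K} - {j, Suc j}. a k * max 0 (1 - \<bar>s - real k\<bar>) = 0"
    proof
      fix k assume "k \<in> {..K} - {j, Suc j}"
      then have "k < j \<or> Suc j < k" by auto
      then have "real k + 1 \<le> real j \<or> real j + 2 \<le> real k" by linarith
      then have "1 \<le> \<bar>s - real k\<bar>" using j by linarith
      then show "a k * max 0 (1 - \<bar>s - real k\<bar>) = 0" by simp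
    qed
  qed simp
  also have "\<dots> = a j * (1 - (s - real j)) + a (Suc j) * (s - real j)"
    using j by (simp add: abs_if max_def)
  finally show ?thesis
    by (simp add: linear_interpolation_def j_def[symmetric] Let_def mult.commute)
qed

lemma continuous_on_linear_interpolation:
  assumes "0 < c"
  shows "continuous_on {0..<real N} (\<lambda>t. linear_interpolation a (c * t))"
proof -
  obtain K where K: "c * real N \<le> real K" using real_arch_simple by blast
  have "continuous_on {0..<real N} (\<lambda>t. \<Sum>k\<le>K. a k * max 0 (1 - \<bar>c * t - real k\<bar>))"
    by (intro continuous_intros)
  moreover have "linear_interpolation a (c * t) = (\<Sum>k\<le>K. a k * max 0 (1 - \<bar>c * t - real k\<bar>))"
    if "t \<in> {0..<real N}" for t
  proof (rule linear_interpolation_hat)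
    show "0 \<le> c * t" using that assms by simp
    have "c * t < c * real N" using that assms by simp
    then show "c * t < real K" using K by simp
  qed
  ultimately show ?thesis by (subst continuous_on_cong[OF refl]) auto
qed

text \<open>
  Passing to a grid that is twice as fine changes the interpolation only through the second
  differences at the new midpoints.
\<close>

lemma linear_interpolation_refine:
  assumes s: "0 \<le> s"
  shows "\<exists>k. real k \<le> s \<and> \<bar>linear_interpolation a (2 * s) - linear_interpolation (\<lambda>k. a (2 * k)) s\<bar>
    \<le> \<bar>a (Suc (2 * k)) - a (2 * k)\<bar> + \<bar>a (Suc (Suc (2 * k))) - a (Suc (2 * k))\<bar>"
proof -
  define j where "j = nat \<lfloor>s\<rfloor>"
  have j: "real j \<le> s" "s < real j + 1"
    using nat_floor_bounds[OF s(1)] by (simp_all add: j_def)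
  define r where "r = s - real j"
  have r: "0 \<le> r" "r < 1" using j by (auto simp: r_def)
  have R: "linear_interpolation (\<lambda>k. a (2 * k)) s = (1 - r) * a (2 * j) + r * a (Suc (Suc (2 * j)))"
    by (simp add: linear_interpolation_def j_def[symmetric] Let_def r_def)
  define d where "d = (a (Suc (2 * j)) - a (2 * j)) - (a (Suc (Suc (2 * j))) - a (Suc (2 * j)))"
  have "\<exists>q. 0 \<le> q \<and> q \<le> 1 \<and> linear_interpolation a (2 * s) - linear_interpolation (\<lambda>k. a (2 * k)) s = q * d"
  proof (cases "r < 1/2")
    case True
    have "\<lfloor>2 * s\<rfloor> = int (2 * j)"
      using j True by (intro floor_unique) (auto simp: r_def)
    then have "nat \<lfloor>2 * s\<rfloor> = 2 * j" by simp
    then have L: "linear_interpolation a (2 * s) = (1 - 2 * r) * a (2 * j) + 2 * r * a (Suc (2 * j))"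
      by (simp add: linear_interpolation_def Let_def r_def algebra_simps)
    show ?thesis using r True
      unfolding L R d_def by (intro exI[of _ r]) (auto simp: algebra_simps)
  next
    case False
    have "\<lfloor>2 * s\<rfloor> = int (Suc (2 * j))"
      using j False by (intro floor_unique) (auto simp: r_def)
    then have "nat \<lfloor>2 * s\<rfloor> = Suc (2 * j)" by (simp only: nat_int)
    then have L: "linear_interpolation a (2 * s)
        = (2 - 2 * r) * a (Suc (2 * j)) + (2 * r - 1) * a (Suc (Suc (2 * j)))"
      by (simp add: linear_interpolation_def Let_def r_def algebra_simps)
    show ?thesis using r
      unfolding L R d_def by (intro exI[of _ "1 - r"]) (auto simp: algebra_simps)
  qed
  then obtain q where q: "0 \<le> q" "q \<le> 1"
    "linear_interpolation a (2 * s) - linear_interpolation (\<lambda>k. a (2 * k)) s = q * d" by blast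
  have "\<bar>q * d\<bar> \<le> 1 * \<bar>d\<bar>"
    unfolding abs_mult using q by (intro mult_right_mono) auto
  also have "\<dots> \<le> \<bar>a (Suc (2 * j)) - a (2 * j)\<bar> + \<bar>a (Suc (Suc (2 * j))) - a (Suc (2 * j))\<bar>"
    unfolding d_def mult_1_left by (rule abs_triangle_ineq4)
  finally show ?thesis using q(3) j(1) by auto
qed

text \<open>
  Kolmogorov's criterion with second moments. The interpolations on the dyadic grids of mesh
  \<open>2\<^sup>-\<^sup>n\<close> converge locally uniformly almost surely: the squared increments over \<open>[0, N)\<close> at level
  \<open>n\<close> have expected sum of order \<open>2\<^sup>-\<^sup>n\<^sup>(\<^sup>a\<^sup>-\<^sup>1\<^sup>)\<close>, and half of this exponential decay suffices to
  dominate the increments themselves. At a fixed time the interpolations converge in mean square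
  to the given process, so their limit is a modification.
\<close>

lemma (in prob_space) continuous_modification_if_increments:
  fixes X :: "real \<Rightarrow> 'a \<Rightarrow> real"
  assumes sq: "\<And>t. 0 \<le> t \<Longrightarrow> square_integrable M (X t)"
    and incr: "\<And>s t. 0 \<le> s \<Longrightarrow> s \<le> t \<Longrightarrow> (\<integral>\<omega>. (X t \<omega> - X s \<omega>)\<^sup>2 \<partial>M) \<le> C * (t - s) powr a"
    and a: "1 < a"
  shows "\<exists>Y. continuous_modification M X Y"
proof -
  \<comment> \<open>Half of the exponential decay \<open>a - 1\<close> of the expected sums of squared increments.\<close>
  define q where "q = 2 powr ((a - 1) / 2)"
  have q: "1 < q" unfolding q_def using a by (intro gr_one_powr) auto
  have q2: "2 * 2 powr (- a) * q = inverse q"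
  proof -
    have "2 * 2 powr (- a) * q * q = 2 powr (1 + - a + (a - 1) / 2 + (a - 1) / 2)"
      unfolding powr_add q_def by simp
    also have "\<dots> = 1" by (simp add: field_simps)
    finally show ?thesis using q by (simp add: field_simps)
  qed
  have "0 \<le> (\<integral>\<omega>. (X 1 \<omega> - X 0 \<omega>)\<^sup>2 \<partial>M)" by simp
  also have "\<dots> \<le> C" using incr[of 0 1] by simp
  finally have C: "0 \<le> C" .
  note sqd = square_integrable_diff[OF sq sq]
  have meas: "X t \<in> borel_measurable M" if "0 \<le> t" for t
    using sq[OF that] by (simp add: square_integrable_def)
  define V where "V N n \<omega> = (\<Sum>k<N * 2 ^ n. (X (real (Suc k) / 2 ^ n) \<omega> - X (real k / 2 ^ n) \<omega>)\<^sup>2)" for N n \<omega>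
  have V0: "0 \<le> V N n \<omega>" for N n \<omega> by (auto simp: V_def intro: sum_nonneg)
  have Vint: "integrable M (V N n)" for N n
    unfolding V_def by (intro Bochner_Integration.integrable_sum square_integrableD(2) sqd) auto
  have EV: "(\<integral>\<omega>. V N n \<omega> \<partial>M) \<le> real N * C * (2 * 2 powr (- a)) ^ n" for N n
  proof -
    have "(\<integral>\<omega>. V N n \<omega> \<partial>M)
        = (\<Sum>k<N * 2 ^ n. \<integral>\<omega>. (X (real (Suc k) / 2 ^ n) \<omega> - X (real k / 2 ^ n) \<omega>)\<^sup>2 \<partial>M)"
      unfolding V_def by (intro Bochner_Integration.integral_sum square_integrableD(2) sqd) auto
    also have "\<dots> \<le> (\<Sum>k<N * 2 ^ n. C * (2 powr (- a)) ^ n)"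
    proof (rule sum_mono)
      fix k
      have "real (Suc k) / 2 ^ n - real k / 2 ^ n = 2 powr (- real n)"
        by (simp add: powr_minus powr_realpow field_simps)
      moreover have "(2 powr (- real n)) powr a = (2 powr (- a)) ^ n"
        by (simp add: powr_powr powr_realpow[symmetric] mult.commute)
      ultimately show "(\<integral>\<omega>. (X (real (Suc k) / 2 ^ n) \<omega> - X (real k / 2 ^ n) \<omega>)\<^sup>2 \<partial>M)
          \<le> C * (2 powr (- a)) ^ n"
        using incr[of "real k / 2 ^ n" "real (Suc k) / 2 ^ n"] by (simp add: divide_right_mono)
    qed
    also have "\<dots> = real N * C * (2 * 2 powr (- a)) ^ n"
      by (simp add: power_mult_distrib)
    finally show ?thesis .
  qed
  have "AE \<omega> in M. summable (\<lambda>n. q ^ n * V N n \<omega>)" for N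
  proof (rule AE_summable)
    show "integrable M (\<lambda>\<omega>. q ^ n * V N n \<omega>)" for n using Vint by simp
    show "summable (\<lambda>n. \<integral>\<omega>. q ^ n * V N n \<omega> \<partial>M)"
    proof (rule summable_comparison_test')
      show "summable (\<lambda>n. real N * C * inverse q ^ n)"
        using q by (intro summable_mult summable_geometric) (auto simp: inverse_less_1_iff)
      fix n
      have "q ^ n * (\<integral>\<omega>. V N n \<omega> \<partial>M) \<le> q ^ n * (real N * C * (2 * 2 powr (- a)) ^ n)"
        using q by (intro mult_left_mono EV) auto
      also have "\<dots> = real N * C * inverse q ^ n"
        unfolding q2[symmetric] by (simp add: power_mult_distrib)
      finally show "norm (\<integral>\<omega>. q ^ n * V N n \<omega> \<partial>M) \<le> real N * C * inverse q ^ n"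
        using q V0 by (simp add: Bochner_Integration.integral_nonneg)
    qed
  qed (use q V0 in auto)
  then have "AE \<omega> in M. \<forall>N. summable (\<lambda>n. q ^ n * V N n \<omega>)"
    by (simp add: AE_all_countable)
  then obtain B where B: "B \<in> null_sets M" "{\<omega> \<in> space M. \<not> (\<forall>N. summable (\<lambda>n. q ^ n * V N n \<omega>))} \<subseteq> B"
    by (auto simp: eventually_ae_filter)
  define J where "J n t \<omega> = linear_interpolation (\<lambda>k. X (real k / 2 ^ n) \<omega>) (2 ^ n * t)" for n t \<omega>
  have step: "\<bar>J (Suc n) t \<omega> - J n t \<omega>\<bar> \<le> inverse q ^ Suc n + q ^ Suc n * V N (Suc n) \<omega>"
    if t: "0 \<le> t" "t < real N" for n t \<omega> N
  proof -
    define b where "b k = X (real k / 2 ^ Suc n) \<omega>" for k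
    have J1: "J (Suc n) t \<omega> = linear_interpolation b (2 * (2 ^ n * t))"
      by (simp add: J_def b_def[abs_def] mult.assoc)
    have J0: "J n t \<omega> = linear_interpolation (\<lambda>k. b (2 * k)) (2 ^ n * t)"
      by (simp add: J_def b_def)
    obtain k where k: "real k \<le> 2 ^ n * t"
      "\<bar>J (Suc n) t \<omega> - J n t \<omega>\<bar> \<le> \<bar>b (Suc (2 * k)) - b (2 * k)\<bar> + \<bar>b (Suc (Suc (2 * k))) - b (Suc (2 * k))\<bar>"
      unfolding J0 J1 using linear_interpolation_refine[of "2 ^ n * t" b] t by auto
    have "2 ^ n * t < 2 ^ n * real N" using t by simp
    with k(1) have "real k < 2 ^ n * real N" by (rule order.strict_trans1)
    then have "real k < real (N * 2 ^ n)" by (simp add: mult.commute)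
    then have kN: "k < N * 2 ^ n" by linarith
    have VS: "V N (Suc n) \<omega> = (\<Sum>k<N * 2 ^ Suc n. (b (Suc k) - b k)\<^sup>2)"
      by (simp add: V_def b_def)
    have two: "(b (Suc (2 * k)) - b (2 * k))\<^sup>2 + (b (Suc (Suc (2 * k))) - b (Suc (2 * k)))\<^sup>2 \<le> V N (Suc n) \<omega>"
    proof -
      have "(\<Sum>k\<in>{2 * k, Suc (2 * k)}. (b (Suc k) - b k)\<^sup>2) \<le> V N (Suc n) \<omega>"
        unfolding VS using kN by (intro sum_mono2) auto
      then show ?thesis by simp
    qed
    define Q where "Q = q ^ Suc n"
    have Q: "0 < Q" using q by (simp add: Q_def)
    have am: "2 * \<bar>d\<bar> \<le> inverse Q + Q * d\<^sup>2" for d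
    proof -
      have "0 \<le> (1 - Q * \<bar>d\<bar>)\<^sup>2 / Q" using Q by simp
      also have "\<dots> = inverse Q + Q * d\<^sup>2 - 2 * \<bar>d\<bar>"
        using Q by (simp add: power2_eq_square field_simps)
      finally show ?thesis by simp
    qed
    have "Q * ((b (Suc (2 * k)) - b (2 * k))\<^sup>2 + (b (Suc (Suc (2 * k))) - b (Suc (2 * k)))\<^sup>2) \<le> Q * V N (Suc n) \<omega>"
      using two Q by (intro mult_left_mono) auto
    moreover have "inverse Q + Q * V N (Suc n) \<omega> = inverse q ^ Suc n + q ^ Suc n * V N (Suc n) \<omega>"
      by (simp only: Q_def power_inverse)
    ultimately show ?thesis
      using k(2) am[of "b (Suc (2 * k)) - b (2 * k)"] am[of "b (Suc (Suc (2 * k))) - b (Suc (2 * k))"] Q V0[of N "Suc n" \<omega>]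
      unfolding distrib_left
      by (smt (verit) mult_nonneg_nonneg)
  qed
  have unif: "uniform_limit {0..<real N} (\<lambda>n t. J n t \<omega>) (\<lambda>t. lim (\<lambda>n. J n t \<omega>)) sequentially"
    if \<omega>: "\<omega> \<in> space M" "\<omega> \<notin> B" for N \<omega>
  proof -
    have "summable (\<lambda>n. q ^ n * V N n \<omega>)" using \<omega> B(2) by auto
    moreover have "summable (\<lambda>n. inverse q ^ n)"
      using q by (intro summable_geometric) (auto simp: inverse_less_1_iff)
    ultimately have "summable (\<lambda>n. inverse q ^ n + q ^ n * V N n \<omega>)" by (rule summable_add[rotated])
    then have "summable (\<lambda>n. inverse q ^ Suc n + q ^ Suc n * V N (Suc n) \<omega>)"
      by (subst summable_Suc_iff)
    then have "uniformly_convergent_on {0..<real N} (\<lambda>n t. \<Sum>i<n. J (Suc i) t \<omega> - J i t \<omega>)"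
      by (intro Weierstrass_m_test') (use step in auto)
    then have "uniformly_convergent_on {0..<real N} (\<lambda>n t. J n t \<omega> - J 0 t \<omega>)"
      by (simp only: sum_lessThan_telescope[of "\<lambda>n. J n t \<omega>" for t])
    then obtain l where "uniform_limit {0..<real N} (\<lambda>n t. J n t \<omega> - J 0 t \<omega>) l sequentially"
      by (auto simp: uniformly_convergent_on_def)
    from uniform_limit_add[OF this uniform_limit_const[of "\<lambda>t. J 0 t \<omega>"]]
    have u: "uniform_limit {0..<real N} (\<lambda>n t. J n t \<omega>) (\<lambda>t. l t + J 0 t \<omega>) sequentially" by simp
    have "lim (\<lambda>n. J n t \<omega>) = l t + J 0 t \<omega>" if "t \<in> {0..<real N}" for t
      using tendsto_uniform_limitI[OF u that] by (rule limI)
    then show ?thesis using u unfolding uniform_limit_iff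
      by (simp only: cong: ball_cong)
  qed
  \<comment> \<open>Every path has to be continuous, hence the value on the exceptional null set.\<close>
  define Y where "Y t \<omega> = (if \<omega> \<in> B then 0 else lim (\<lambda>n. J n t \<omega>))" for t \<omega>
  have Jm: "J n t \<in> borel_measurable M" if "0 \<le> t" for n t
    unfolding J_def linear_interpolation_def Let_def using that
    by (intro borel_measurable_add borel_measurable_times borel_measurable_const meas) auto
  have "continuous_modification M X Y"
    unfolding continuous_modification_def
  proof (intro conjI allI impI ballI)
    fix t :: real assume t: "0 \<le> t"
    have [measurable]: "J n t \<in> borel_measurable M" for n using Jm[OF t] .
    have [measurable]: "B \<in> sets M" using B(1) by auto
    show "Y t \<in> borel_measurable M"
      unfolding Y_def by measurable
    have "AE \<omega> in M. summable (\<lambda>n. (J n t \<omega> - X t \<omega>)\<^sup>2)"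
    proof (rule AE_summable)
      fix n
      have Jsq: "square_integrable M (J n t)"
        unfolding J_def linear_interpolation_def Let_def
        by (intro square_integrable_add square_integrable_cmult sq) auto
      show "integrable M (\<lambda>\<omega>. (J n t \<omega> - X t \<omega>)\<^sup>2)"
        using square_integrable_diff[OF Jsq sq[OF t]] by (simp add: square_integrable_def)
    next
      show "summable (\<lambda>n. \<integral>\<omega>. (J n t \<omega> - X t \<omega>)\<^sup>2 \<partial>M)"
      proof (rule summable_comparison_test')
        have "2 powr (- a) < (2::real) powr 0" using a by (intro powr_less_mono) auto
        then show "summable (\<lambda>n. C * (2 powr (- a)) ^ n)"
          by (intro summable_mult summable_geometric) auto
        fix n
        define s where "s = 2 ^ n * t"
        define j where "j = nat \<lfloor>s\<rfloor>"
        define r where "r = s - real j"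
        have "0 \<le> s" using t by (simp add: s_def)
        note j = nat_floor_bounds[OF this, folded j_def]
        have r: "0 \<le> r" "r \<le> 1" using j by (auto simp: r_def)
        define u where "u = real j / 2 ^ n"
        define v where "v = real (Suc j) / 2 ^ n"
        have "v = u + 2 powr (- real n)"
          by (simp add: u_def v_def powr_minus powr_realpow field_simps)
        moreover have "0 \<le> u" "u \<le> t" "t \<le> v"
          using j by (auto simp: u_def v_def s_def field_simps)
        ultimately have uv: "0 \<le> u" "u \<le> t" "t \<le> v" "t - u \<le> 2 powr (- real n)" "v - t \<le> 2 powr (- real n)"
          by auto
        have pw: "(2 powr (- real n)) powr a = (2 powr (- a)) ^ n"
          by (simp add: powr_powr powr_realpow[symmetric] mult.commute)
        have E1: "(\<integral>\<omega>. (X u \<omega> - X t \<omega>)\<^sup>2 \<partial>M) \<le> C * (2 powr (- a)) ^ n"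
        proof -
          have "(\<integral>\<omega>. (X t \<omega> - X u \<omega>)\<^sup>2 \<partial>M) \<le> C * (t - u) powr a" using uv by (intro incr)
          also have "\<dots> \<le> C * (2 powr (- real n)) powr a"
            using uv a C by (intro mult_left_mono powr_mono2) auto
          finally show ?thesis by (simp add: pw power2_commute)
        qed
        have E2: "(\<integral>\<omega>. (X v \<omega> - X t \<omega>)\<^sup>2 \<partial>M) \<le> C * (2 powr (- a)) ^ n"
        proof -
          have "(\<integral>\<omega>. (X v \<omega> - X t \<omega>)\<^sup>2 \<partial>M) \<le> C * (v - t) powr a" using uv t by (intro incr)
          also have "\<dots> \<le> C * (2 powr (- real n)) powr a"
            using uv a C by (intro mult_left_mono powr_mono2) auto
          finally show ?thesis by (simp add: pw)
        qed
        have conv: "((1 - r) * x + r * y - z)\<^sup>2 \<le> (1 - r) * (x - z)\<^sup>2 + r * (y - z)\<^sup>2" for x y z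
        proof -
          have "(1 - r) * (x - z)\<^sup>2 + r * (y - z)\<^sup>2 - ((1 - r) * x + r * y - z)\<^sup>2 = r * (1 - r) * (x - y)\<^sup>2"
            by (simp add: power2_eq_square algebra_simps)
          moreover have "0 \<le> r * (1 - r) * (x - y)\<^sup>2" using r by simp
          ultimately show ?thesis by linarith
        qed
        have Jt: "J n t \<omega> = (1 - r) * X u \<omega> + r * X v \<omega>" for \<omega>
          by (simp add: J_def linear_interpolation_def Let_def s_def[symmetric] j_def[symmetric]
              r_def[symmetric] u_def v_def)
        have i1: "integrable M (\<lambda>\<omega>. (X u \<omega> - X t \<omega>)\<^sup>2)" "integrable M (\<lambda>\<omega>. (X v \<omega> - X t \<omega>)\<^sup>2)"
          using uv t by (auto intro!: square_integrableD(2) sqd)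
        have Jsq: "square_integrable M (J n t)"
          unfolding Jt using uv t by (intro square_integrable_add square_integrable_cmult sq) auto
        have "(\<integral>\<omega>. (J n t \<omega> - X t \<omega>)\<^sup>2 \<partial>M)
            \<le> (\<integral>\<omega>. (1 - r) * (X u \<omega> - X t \<omega>)\<^sup>2 + r * (X v \<omega> - X t \<omega>)\<^sup>2 \<partial>M)"
          using conv i1 square_integrableD(2)[OF square_integrable_diff[OF Jsq sq[OF t]]]
          by (intro integral_mono) (auto simp: Jt)
        also have "\<dots> = (1 - r) * (\<integral>\<omega>. (X u \<omega> - X t \<omega>)\<^sup>2 \<partial>M) + r * (\<integral>\<omega>. (X v \<omega> - X t \<omega>)\<^sup>2 \<partial>M)"
          using i1 by simp
        also have "\<dots> \<le> (1 - r) * (C * (2 powr (- a)) ^ n) + r * (C * (2 powr (- a)) ^ n)"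
          using E1 E2 r by (intro add_mono mult_left_mono) auto
        also have "\<dots> = C * (2 powr (- a)) ^ n" by (simp add: algebra_simps)
        finally show "norm (\<integral>\<omega>. (J n t \<omega> - X t \<omega>)\<^sup>2 \<partial>M) \<le> C * (2 powr (- a)) ^ n"
          by (simp add: Bochner_Integration.integral_nonneg)
      qed
    qed simp
    moreover have "AE \<omega> in M. \<omega> \<notin> B" using B(1) by (rule AE_not_in)
    ultimately show "AE \<omega> in M. Y t \<omega> = X t \<omega>"
    proof eventually_elim
      case (elim \<omega>)
      have "(\<lambda>n. sqrt ((J n t \<omega> - X t \<omega>)\<^sup>2)) \<longlonglongrightarrow> sqrt 0"
        by (intro tendsto_real_sqrt summable_LIMSEQ_zero elim)
      then have "(\<lambda>n. J n t \<omega> - X t \<omega>) \<longlonglongrightarrow> 0" by (simp add: tendsto_rabs_zero_iff)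
      then have "(\<lambda>n. J n t \<omega>) \<longlonglongrightarrow> X t \<omega>" by (simp add: LIM_zero_iff)
      then show ?case using elim by (simp add: Y_def limI)
    qed
  next
    fix \<omega> assume \<omega>: "\<omega> \<in> space M"
    show "continuous_on {0..} (\<lambda>t. Y t \<omega>)"
    proof (cases "\<omega> \<in> B")
      case False
      have c: "continuous_on {0..<real N} (\<lambda>t. Y t \<omega>)" for N
        unfolding Y_def using False
        by (simp, intro uniform_limit_theorem[OF _ unif[OF \<omega> False]])
          (auto simp: J_def intro!: always_eventually continuous_on_linear_interpolation)
      show ?thesis
      proof (rule continuous_on_eq_continuous_within[THEN iffD2], rule ballI)
        fix t :: real assume t: "t \<in> {0..}"
        obtain N where N: "t < real N" using reals_Archimedean2 by blast
        have "continuous (at t within {0..<real N}) (\<lambda>t. Y t \<omega>)"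
          using c[of N] t N by (simp add: continuous_on_eq_continuous_within)
        moreover have "at t within {0..<real N} = at t within {0..}"
          by (rule at_within_nhd[of _ "{..<real N}"]) (use N in auto)
        ultimately show "continuous (at t within {0..}) (\<lambda>t. Y t \<omega>)"
          by (simp add: continuous_within)
      qed
    qed (simp add: Y_def)
  qed
  then show ?thesis by blast
qed

section \<open>A negative moment of the symmetric stable law\<close>

lemma nn_integral_powr_from_0:
  assumes "0 < \<gamma>" "0 \<le> h"
  shows "(\<integral>\<^sup>+x. ennreal (x powr (\<gamma> - 1)) * indicator {0..h} x \<partial>lborel) = ennreal (h powr \<gamma> / \<gamma>)"
  using nn_integral_has_integral_lebesgue'[OF _ has_integral_powr_from_0[of "\<gamma> - 1" h]] assms by simp

lemma nn_integral_abs_powr_le: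
  assumes "0 < \<gamma>" "0 \<le> h"
  shows "(\<integral>\<^sup>+x. ennreal (\<bar>x\<bar> powr (\<gamma> - 1)) * indicator {-h..h} x \<partial>lborel) \<le> ennreal (2 * h powr \<gamma> / \<gamma>)"
proof -
  let ?f = "\<lambda>x::real. ennreal (x powr (\<gamma> - 1)) * indicator {0..h} x"
  have "(\<integral>\<^sup>+x. ennreal (\<bar>x\<bar> powr (\<gamma> - 1)) * indicator {-h..h} x \<partial>lborel) \<le> (\<integral>\<^sup>+x. ?f x + ?f (0 + -1 * x) \<partial>lborel)"
    by (intro nn_integral_mono) (auto simp: indicator_def)
  also have "\<dots> = (\<integral>\<^sup>+x. ?f x \<partial>lborel) + (\<integral>\<^sup>+x. ?f (0 + -1 * x) \<partial>lborel)"
    by (intro nn_integral_add) auto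
  also have "(\<integral>\<^sup>+x. ?f (0 + -1 * x) \<partial>lborel) = (\<integral>\<^sup>+x. ?f x \<partial>lborel)"
    by (subst (2) nn_integral_real_affine[where c = "-1" and t = 0]) auto
  also have "(\<integral>\<^sup>+x. ?f x \<partial>lborel) + (\<integral>\<^sup>+x. ?f x \<partial>lborel) = ennreal (2 * h powr \<gamma> / \<gamma>)"
    using assms by (simp add: nn_integral_powr_from_0 ennreal_plus[symmetric] del: ennreal_plus)
  finally show ?thesis .
qed

lemma exp_minus_le_inverse_square:
  assumes "0 < (y::real)"
  shows "exp (- y) \<le> 2 / y\<^sup>2"
proof -
  have "y\<^sup>2 / 2 \<le> exp y"
    using exp_lower_Taylor_quadratic[of y] assms by simp
  then have "exp (- y) \<le> inverse (y\<^sup>2 / 2)"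
    unfolding exp_minus using assms by (intro le_imp_inverse_le) auto
  then show ?thesis by simp
qed

text \<open>The weight \<open>\<delta>\<^sup>-\<^sup>\<alpha>\<^sup>-\<^sup>1\<close> on the positive half-line is homogeneous under dilations.\<close>

definition dilation_weight :: "real \<Rightarrow> real \<Rightarrow> ennreal" where
  "dilation_weight \<alpha> \<delta> = ennreal (\<delta> powr (- \<alpha> - 1)) * indicator {0<..} \<delta>"

lemma dilation_weight_measurable [measurable]: "dilation_weight \<alpha> \<in> borel_measurable borel"
  unfolding dilation_weight_def by measurable

lemma nn_integral_dilation_weight:
  assumes [measurable]: "g \<in> borel_measurable borel" and a: "0 < a"
  shows "(\<integral>\<^sup>+\<delta>. dilation_weight \<alpha> \<delta> * g (a / \<delta>) \<partial>lborel)
    = ennreal (a powr (- \<alpha>)) * (\<integral>\<^sup>+\<delta>. dilation_weight \<alpha> \<delta> * g (1 / \<delta>) \<partial>lborel)"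
proof -
  have "(\<integral>\<^sup>+\<delta>. dilation_weight \<alpha> \<delta> * g (a / \<delta>) \<partial>lborel)
      = ennreal a * (\<integral>\<^sup>+\<delta>. dilation_weight \<alpha> (a * \<delta>) * g (1 / \<delta>) \<partial>lborel)"
    using a by (subst nn_integral_real_affine[where c = a and t = 0]) auto
  also have "\<dots> = ennreal a * (\<integral>\<^sup>+\<delta>. ennreal (a powr (- \<alpha> - 1)) * (dilation_weight \<alpha> \<delta> * g (1 / \<delta>)) \<partial>lborel)"
    using a by (intro arg_cong[where f = "(*) (ennreal a)"] nn_integral_cong)
      (auto simp: dilation_weight_def powr_mult ennreal_mult indicator_def zero_less_mult_iff mult_ac)
  also have "\<dots> = ennreal a * ennreal (a powr (- \<alpha> - 1)) * (\<integral>\<^sup>+\<delta>. dilation_weight \<alpha> \<delta> * g (1 / \<delta>) \<partial>lborel)"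
    by (simp add: nn_integral_cmult mult.assoc)
  also have "ennreal a * ennreal (a powr (- \<alpha> - 1)) = ennreal (a powr (- \<alpha>))"
    using a by (simp add: ennreal_mult[symmetric] powr_diff)
  finally show ?thesis .
qed

lemma nn_integral_std_normal_powr_finite:
  assumes \<alpha>: "0 < \<alpha>" "\<alpha> < 1"
  shows "(\<integral>\<^sup>+z. ennreal (\<bar>z\<bar> powr (- \<alpha>)) \<partial>std_normal_distribution) < \<infinity>"
proof -
  interpret N: prob_space std_normal_distribution
    using real_dist_normal_dist by (simp add: real_distribution_def)
  have le1: "std_normal_density z \<le> 1" for z
  proof -
    have "std_normal_density z \<le> 1 / sqrt (2 * pi) * 1"
      unfolding std_normal_density_def by (intro mult_left_mono) auto
    also have "\<dots> \<le> 1" using pi_gt3 by (simp add: real_le_rsqrt)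
    finally show ?thesis .
  qed
  have "(\<integral>\<^sup>+z. ennreal (\<bar>z\<bar> powr (- \<alpha>)) \<partial>std_normal_distribution)
      \<le> (\<integral>\<^sup>+z. ennreal (\<bar>z\<bar> powr (- \<alpha>)) * indicator {-1..1} z + 1 \<partial>std_normal_distribution)"
  proof (intro nn_integral_mono)
    fix z :: real
    show "ennreal (\<bar>z\<bar> powr (- \<alpha>)) \<le> ennreal (\<bar>z\<bar> powr (- \<alpha>)) * indicator {-1..1} z + 1"
    proof (cases "\<bar>z\<bar> \<le> 1")
      case False
      then have "\<bar>z\<bar> powr (- \<alpha>) \<le> \<bar>z\<bar> powr 0" using \<alpha> by (intro powr_mono) auto
      then show ?thesis using False by (auto simp: indicator_def)
    qed (auto simp: indicator_def abs_le_iff)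
  qed
  also have "\<dots> = (\<integral>\<^sup>+z. ennreal (\<bar>z\<bar> powr (- \<alpha>)) * indicator {-1..1} z \<partial>std_normal_distribution) + 1"
    by (subst nn_integral_add) (use N.emeasure_space_1 in auto)
  also have "(\<integral>\<^sup>+z. ennreal (\<bar>z\<bar> powr (- \<alpha>)) * indicator {-1..1} z \<partial>std_normal_distribution)
      = (\<integral>\<^sup>+z. ennreal (std_normal_density z) * (ennreal (\<bar>z\<bar> powr (- \<alpha>)) * indicator {-1..1} z) \<partial>lborel)"
    by (rule nn_integral_density) auto
  also have "\<dots> \<le> (\<integral>\<^sup>+z. 1 * (ennreal (\<bar>z\<bar> powr ((1 - \<alpha>) - 1)) * indicator {-1..1} z) \<partial>lborel)"
    using le1 by (intro nn_integral_mono mult_mono) (auto simp: ennreal_le_1)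
  also have "\<dots> \<le> ennreal (2 * 1 powr (1 - \<alpha>) / (1 - \<alpha>))"
    using nn_integral_abs_powr_le[of "1 - \<alpha>" 1] \<alpha> by simp
  finally show ?thesis by (auto simp: less_top[symmetric] top_unique)
qed

text \<open>
  Two expressions for the mean of a Gaussian function, obtained by integrating the
  characteristic function of one law against the other law.
\<close>

lemma gaussian_mean_stable:
  assumes \<mu>: "real_distribution \<mu>" "\<And>z. char \<mu> z = of_real (exp (- (\<bar>z\<bar> powr \<alpha>)))"
  shows "(\<integral>\<^sup>+x. ennreal (exp (- ((x / \<delta>)\<^sup>2) / 2)) \<partial>\<mu>)
    = (\<integral>\<^sup>+z. ennreal (exp (- (\<bar>z / \<delta>\<bar> powr \<alpha>))) \<partial>std_normal_distribution)"
proof -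
  let ?N = std_normal_distribution
  interpret \<mu>: real_distribution \<mu> by fact
  interpret N: real_distribution ?N by (rule real_dist_normal_dist)
  interpret P: pair_prob_space \<mu> ?N ..
  have sets [measurable_cong]: "sets \<mu> = sets borel" "sets ?N = sets borel" by simp_all
  have "integrable (\<mu> \<Otimes>\<^sub>M ?N) (\<lambda>(x, z). iexp (x / \<delta> * z))"
    by (rule P.P.integrable_const_bound[where B = 1]) (auto simp: split_def)
  then have swap: "(CLINT z|?N. CLINT x|\<mu>. iexp (x / \<delta> * z)) = (CLINT x|\<mu>. CLINT z|?N. iexp (x / \<delta> * z))"
    by (rule P.Fubini_integral)
  have N_char: "char ?N t = of_real (exp (- (t\<^sup>2) / 2))" for t
    by (simp add: char_std_normal_distribution)
  have "(CLINT x|\<mu>. CLINT z|?N. iexp (x / \<delta> * z)) = (CLINT x|\<mu>. of_real (exp (- ((x / \<delta>)\<^sup>2) / 2)))"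
    unfolding N_char[symmetric] char_def ..
  moreover have "(CLINT z|?N. CLINT x|\<mu>. iexp (x / \<delta> * z)) = (CLINT z|?N. of_real (exp (- (\<bar>z / \<delta>\<bar> powr \<alpha>))))"
    unfolding \<mu>(2)[symmetric] char_def by (intro Bochner_Integration.integral_cong) (simp_all add: mult.commute)
  ultimately have "(\<integral>x. exp (- ((x / \<delta>)\<^sup>2) / 2) \<partial>\<mu>) = (\<integral>z. exp (- (\<bar>z / \<delta>\<bar> powr \<alpha>)) \<partial>?N)"
    using swap by simp
  moreover have "(\<integral>\<^sup>+x. ennreal (exp (- ((x / \<delta>)\<^sup>2) / 2)) \<partial>\<mu>) = ennreal (\<integral>x. exp (- ((x / \<delta>)\<^sup>2) / 2) \<partial>\<mu>)"
    by (intro nn_integral_eq_integral \<mu>.integrable_const_bound[where B = 1]) auto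
  moreover have "(\<integral>\<^sup>+z. ennreal (exp (- (\<bar>z / \<delta>\<bar> powr \<alpha>))) \<partial>?N) = ennreal (\<integral>z. exp (- (\<bar>z / \<delta>\<bar> powr \<alpha>)) \<partial>?N)"
    by (intro nn_integral_eq_integral N.integrable_const_bound[where B = 1]) auto
  ultimately show ?thesis by simp
qed

text \<open>
  Integrate the identity above against the homogeneous weight \<open>\<delta>\<^sup>-\<^sup>\<alpha>\<^sup>-\<^sup>1 d\<delta>\<close>. Both sides turn into
  multiples of the moment of order \<open>-\<alpha>\<close>, of the stable law and of the Gaussian law. The latter
  is finite because \<open>\<alpha> < 1\<close>. An atom at zero would make the left-hand side infinite.
\<close>

lemma stable_negative_moment:
  assumes \<mu>: "real_distribution \<mu>" "\<And>z. char \<mu> z = of_real (exp (- (\<bar>z\<bar> powr \<alpha>)))"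
    and \<alpha>: "0 < \<alpha>" "\<alpha> < 1"
  shows "AE x in \<mu>. x \<noteq> 0" "(\<integral>\<^sup>+x. ennreal (\<bar>x\<bar> powr (- \<alpha>)) \<partial>\<mu>) < \<infinity>"
proof -
  let ?N = std_normal_distribution
  interpret \<mu>: real_distribution \<mu> by fact
  interpret N: real_distribution ?N by (rule real_dist_normal_dist)
  have [measurable_cong]: "sets \<mu> = sets borel" "sets ?N = sets borel" by simp_all
  interpret P: pair_sigma_finite lborel \<mu> ..
  interpret Q: pair_sigma_finite lborel ?N ..
  define w where "w = dilation_weight \<alpha>"
  have [measurable]: "w \<in> borel_measurable borel" by (simp add: w_def)
  define g where "g y = ennreal (exp (- (y\<^sup>2) / 2))" for y :: real
  define g' where "g' y = ennreal (exp (- (\<bar>y\<bar> powr \<alpha>)))" for y :: real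
  have [measurable]: "g \<in> borel_measurable borel" "g' \<in> borel_measurable borel"
    unfolding g_def g'_def by measurable
  define c where "c = (\<integral>\<^sup>+\<delta>. w \<delta> * g (1 / \<delta>) \<partial>lborel)"
  define c' where "c' = (\<integral>\<^sup>+\<delta>. w \<delta> * g' (1 / \<delta>) \<partial>lborel)"
  define \<kappa> where "\<kappa> x = (\<integral>\<^sup>+\<delta>. w \<delta> * g (x / \<delta>) \<partial>lborel)" for x
  have [measurable]: "\<kappa> \<in> borel_measurable borel" unfolding \<kappa>_def by measurable
  have c'_fin: "c' < \<infinity>"
  proof -
    have "c' \<le> (\<integral>\<^sup>+\<delta>. 2 * (ennreal (\<delta> powr (\<alpha> - 1)) * indicator {0..1} \<delta>)
        + ennreal (\<delta> powr (- \<alpha> - 1)) * indicator {1..} \<delta> \<partial>lborel)"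
      unfolding c'_def
    proof (intro nn_integral_mono)
      fix \<delta> :: real
      show "w \<delta> * g' (1 / \<delta>) \<le> 2 * (ennreal (\<delta> powr (\<alpha> - 1)) * indicator {0..1} \<delta>)
        + ennreal (\<delta> powr (- \<alpha> - 1)) * indicator {1..} \<delta>"
      proof (cases "0 < \<delta> \<and> \<delta> < 1")
        case True
        then have "exp (- (\<bar>1 / \<delta>\<bar> powr \<alpha>)) \<le> 2 / (\<bar>1 / \<delta>\<bar> powr \<alpha>)\<^sup>2"
          by (intro exp_minus_le_inverse_square) auto
        also have "\<dots> = 2 * \<delta> powr (2 * \<alpha>)"
          using True by (simp add: powr_divide powr_power divide_simps mult.commute)
        finally have "\<delta> powr (- \<alpha> - 1) * exp (- (\<bar>1 / \<delta>\<bar> powr \<alpha>)) \<le> \<delta> powr (- \<alpha> - 1) * (2 * \<delta> powr (2 * \<alpha>))"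
          by (intro mult_left_mono) auto
        also have "\<dots> = 2 * \<delta> powr (\<alpha> - 1)"
          by (simp add: powr_add[symmetric])
        finally have "ennreal (\<delta> powr (- \<alpha> - 1)) * g' (1 / \<delta>) \<le> 2 * ennreal (\<delta> powr (\<alpha> - 1))"
          using True by (simp add: g'_def ennreal_mult[symmetric] ennreal_leI flip: ennreal_numeral)
        then show ?thesis using True by (simp add: w_def dilation_weight_def)
      next
        case False
        have "g' (1 / \<delta>) \<le> 1" by (simp add: g'_def)
        then have "ennreal (\<delta> powr (- \<alpha> - 1)) * g' (1 / \<delta>) \<le> ennreal (\<delta> powr (- \<alpha> - 1)) * 1"
          by (intro mult_left_mono) auto
        then show ?thesis using False
          by (auto simp: w_def dilation_weight_def indicator_def intro: order.trans)
      qed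
    qed
    also have "\<dots> = 2 * ennreal (1 powr \<alpha> / \<alpha>) + ennreal (- (1 powr (- \<alpha>)) / - \<alpha>)"
      using nn_integral_powr_from_0[of \<alpha> 1]
        nn_integral_has_integral_lebesgue'[OF _ has_integral_powr_to_inf[of "- \<alpha> - 1" 1]] \<alpha>
      by (subst nn_integral_add) (auto simp: nn_integral_cmult)
    also have "\<dots> < \<infinity>" by (simp add: ennreal_mult_less_top)
    finally show ?thesis .
  qed
  have c_pos: "c \<noteq> 0"
  proof -
    let ?m = "2 powr (- \<alpha> - 1) * exp (- 1 / 2) :: real"
    have "(\<integral>\<^sup>+\<delta>. ennreal ?m * indicator {1..2::real} \<delta> \<partial>lborel) \<le> c"
      unfolding c_def
    proof (intro nn_integral_mono)
      fix \<delta> :: real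
      show "ennreal ?m * indicator {1..2} \<delta> \<le> w \<delta> * g (1 / \<delta>)"
      proof (cases "1 \<le> \<delta> \<and> \<delta> \<le> 2")
        case True
        then have "2 powr (- \<alpha> - 1) \<le> \<delta> powr (- \<alpha> - 1)"
          using \<alpha> by (intro powr_mono2') auto
        moreover have "exp (- 1 / 2) \<le> exp (- ((1 / \<delta>)\<^sup>2) / 2)"
          using True by (simp add: power_divide divide_simps)
        ultimately have "?m \<le> \<delta> powr (- \<alpha> - 1) * exp (- ((1 / \<delta>)\<^sup>2) / 2)"
          by (intro mult_mono) auto
        then show ?thesis using True
          by (simp add: w_def dilation_weight_def g_def ennreal_mult[symmetric] ennreal_leI)
      qed (auto simp: indicator_def)
    qed
    moreover have "(\<integral>\<^sup>+\<delta>. ennreal ?m * indicator {1..2::real} \<delta> \<partial>lborel) = ennreal ?m"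
      by (simp add: nn_integral_cmult_indicator)
    moreover have "0 < ennreal ?m" by (simp add: ennreal_less_zero_iff)
    ultimately show ?thesis by (metis leD)
  qed
  have \<kappa>: "\<kappa> x = ennreal (\<bar>x\<bar> powr (- \<alpha>)) * c" if "x \<noteq> 0" for x
  proof -
    have "\<kappa> x = (\<integral>\<^sup>+\<delta>. w \<delta> * g (\<bar>x\<bar> / \<delta>) \<partial>lborel)"
      by (simp add: \<kappa>_def g_def power_divide)
    then show ?thesis
      using nn_integral_dilation_weight[of g "\<bar>x\<bar>" \<alpha>] that by (simp add: c_def w_def)
  qed
  have \<kappa>0: "\<kappa> 0 = \<infinity>"
  proof (rule ccontr)
    assume "\<kappa> 0 \<noteq> \<infinity>"
    then obtain r where r: "\<kappa> 0 = ennreal r" "0 \<le> r" by (cases "\<kappa> 0") auto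
    have le: "\<kappa> x \<le> \<kappa> 0" for x
      unfolding \<kappa>_def by (intro nn_integral_mono mult_left_mono) (auto simp: g_def intro!: ennreal_leI)
    have "c < \<infinity>" using \<kappa>[of 1] le[of 1] r by (auto simp: less_top[symmetric] top_unique)
    then obtain d where d: "c = ennreal d" "0 \<le> d" by (cases c) auto
    then have "0 < d" using c_pos by (cases "d = 0") auto
    define y where "y = ((r + 1) / d) powr (- 1 / \<alpha>)"
    have "0 < (r + 1) / d" using r \<open>0 < d\<close> by simp
    then have "0 < y" unfolding y_def powr_gt_zero by linarith
    have "y powr (- \<alpha>) = ((r + 1) / d) powr 1"
      unfolding y_def powr_powr using \<alpha> by simp
    with \<open>0 < y\<close> \<open>0 < (r + 1) / d\<close> have y: "0 < y" "y powr (- \<alpha>) = (r + 1) / d"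
      by (auto simp only: powr_one)
    have "ennreal ((r + 1) / d * d) \<le> ennreal r"
      using le[of y] y unfolding \<kappa>[OF order.strict_implies_not_eq[OF y(1), symmetric]] r d
      by (simp add: ennreal_mult[symmetric] \<open>0 < d\<close> d r)
    then show False using r \<open>0 < d\<close> by simp
  qed
  have "(\<integral>\<^sup>+x. \<kappa> x \<partial>\<mu>) = (\<integral>\<^sup>+\<delta>. \<integral>\<^sup>+x. w \<delta> * g (x / \<delta>) \<partial>\<mu> \<partial>lborel)"
    unfolding \<kappa>_def by (rule P.Fubini') simp
  also have "\<dots> = (\<integral>\<^sup>+\<delta>. \<integral>\<^sup>+z. w \<delta> * g' (z / \<delta>) \<partial>?N \<partial>lborel)"
    using gaussian_mean_stable[OF \<mu>] by (simp add: nn_integral_cmult g_def g'_def)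
  also have "\<dots> = (\<integral>\<^sup>+z. \<integral>\<^sup>+\<delta>. w \<delta> * g' (z / \<delta>) \<partial>lborel \<partial>?N)"
    by (rule Q.Fubini'[symmetric]) simp
  also have "\<dots> = (\<integral>\<^sup>+z. ennreal (\<bar>z\<bar> powr (- \<alpha>)) * c' \<partial>?N)"
  proof (rule nn_integral_cong_AE)
    have "AE z in ?N. z \<noteq> 0"
      by (subst AE_density) (auto intro: AE_mp[OF AE_lborel_singleton])
    then show "AE z in ?N. (\<integral>\<^sup>+\<delta>. w \<delta> * g' (z / \<delta>) \<partial>lborel) = ennreal (\<bar>z\<bar> powr (- \<alpha>)) * c'"
    proof eventually_elim
      case (elim z)
      have "(\<integral>\<^sup>+\<delta>. w \<delta> * g' (z / \<delta>) \<partial>lborel) = (\<integral>\<^sup>+\<delta>. w \<delta> * g' (\<bar>z\<bar> / \<delta>) \<partial>lborel)"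
        by (simp add: g'_def)
      then show ?case
        using nn_integral_dilation_weight[of g' "\<bar>z\<bar>" \<alpha>] elim by (simp add: c'_def w_def)
    qed
  qed
  also have "\<dots> = (\<integral>\<^sup>+z. ennreal (\<bar>z\<bar> powr (- \<alpha>)) \<partial>?N) * c'"
    by (rule nn_integral_multc) simp
  also have "\<dots> < \<infinity>"
    using nn_integral_std_normal_powr_finite[OF \<alpha>] c'_fin by (simp add: ennreal_mult_less_top)
  finally have fin: "(\<integral>\<^sup>+x. \<kappa> x \<partial>\<mu>) < \<infinity>" .
  then have "AE x in \<mu>. \<kappa> x \<noteq> \<infinity>"
    by (intro nn_integral_noteq_infinite) auto
  then show ne: "AE x in \<mu>. x \<noteq> 0"
    by eventually_elim (use \<kappa>0 in auto)
  have "(\<integral>\<^sup>+x. \<kappa> x \<partial>\<mu>) = (\<integral>\<^sup>+x. ennreal (\<bar>x\<bar> powr (- \<alpha>)) * c \<partial>\<mu>)"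
    by (intro nn_integral_cong_AE) (use ne in \<open>eventually_elim, simp add: \<kappa>\<close>)
  also have "\<dots> = (\<integral>\<^sup>+x. ennreal (\<bar>x\<bar> powr (- \<alpha>)) \<partial>\<mu>) * c"
    by (rule nn_integral_multc) simp
  finally show "(\<integral>\<^sup>+x. ennreal (\<bar>x\<bar> powr (- \<alpha>)) \<partial>\<mu>) < \<infinity>"
    using fin c_pos by (auto simp: ennreal_mult_less_top)
qed

section \<open>The occupation density of increments\<close>

text \<open>Pushing Lebesgue measure on the positive half-line forward under \<open>r \<mapsto> r\<^sup>1\<^sup>/\<^sup>\<alpha>\<close>.\<close>

lemma nn_integral_power_substitution:
  fixes f :: "real \<Rightarrow> ennreal"
  assumes [measurable]: "f \<in> borel_measurable borel" and \<alpha>: "0 < \<alpha>"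
  shows "(\<integral>\<^sup>+r. f (r powr (1 / \<alpha>)) * indicator {0<..} r \<partial>lborel)
    = (\<integral>\<^sup>+b. f b * ennreal (\<alpha> * b powr (\<alpha> - 1)) * indicator {0<..} b \<partial>lborel)"
proof -
  define a where "a n = 1 / (real n + 2)" for n :: nat
  define b where "b n = real n + 2" for n :: nat
  have ab: "0 < a n" "a n < b n" for n by (simp_all add: a_def b_def divide_simps) (simp add: algebra_simps add_pos_nonneg)
  have mono: "a n \<le> a m" "b m \<le> b n" if "m \<le> n" for m n
    using that by (auto simp: a_def b_def frac_le)
  have conv: "\<exists>n. a n \<le> y \<and> y \<le> b n" if "0 < y" for y
  proof -
    obtain n where n: "y \<le> real n" "1 / y \<le> real n"
      using real_arch_simple[of "max y (1 / y)"] by auto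
    then have "1 / (real n + 2) \<le> y" using that by (simp add: field_simps)
    then show ?thesis using n by (auto simp: a_def b_def intro!: exI[of _ n])
  qed
  have step: "(\<integral>\<^sup>+r. f (r powr (1 / \<alpha>)) * indicator {a n powr \<alpha>..b n powr \<alpha>} r \<partial>lborel)
      = (\<integral>\<^sup>+b'. f b' * ennreal (\<alpha> * b' powr (\<alpha> - 1)) * indicator {a n..b n} b' \<partial>lborel)" for n
  proof -
    have "(\<integral>\<^sup>+r. f (r powr (1 / \<alpha>)) * indicator {a n powr \<alpha>..b n powr \<alpha>} r \<partial>lborel)
      = (\<integral>\<^sup>+b'. f ((b' powr \<alpha>) powr (1 / \<alpha>)) * ennreal (\<alpha> * b' powr (\<alpha> - 1)) * indicator {a n..b n} b' \<partial>lborel)"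
      using ab[of n] \<alpha>
      by (intro nn_integral_substitution_aux[where g = "\<lambda>y. y powr \<alpha>"])
        (auto intro!: derivative_eq_intros continuous_intros)
    also have "\<dots> = (\<integral>\<^sup>+b'. f b' * ennreal (\<alpha> * b' powr (\<alpha> - 1)) * indicator {a n..b n} b' \<partial>lborel)"
      using ab[of n] \<alpha> by (intro nn_integral_cong) (auto simp: indicator_def powr_powr)
    finally show ?thesis .
  qed
  have SUP_ind: "(SUP n. c * indicator (S n) y) = c * (indicator (\<Union>n. S n) y :: ennreal)"
    for c :: ennreal and S :: "nat \<Rightarrow> real set" and y
  proof (cases "y \<in> (\<Union>n. S n)")
    case True
    then obtain n where "y \<in> S n" by auto
    then have "c \<le> (SUP n. c * indicator (S n) y)" by (intro SUP_upper2[of n]) auto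
    moreover have "(SUP n. c * indicator (S n) y) \<le> c" by (intro SUP_least) (simp add: indicator_def)
    ultimately show ?thesis using True by (simp add: antisym)
  qed simp
  have L: "(\<integral>\<^sup>+r. f (r powr (1 / \<alpha>)) * indicator {0<..} r \<partial>lborel)
      = (SUP n. \<integral>\<^sup>+r. f (r powr (1 / \<alpha>)) * indicator {a n powr \<alpha>..b n powr \<alpha>} r \<partial>lborel)"
  proof -
    have "(\<Union>n. {a n powr \<alpha>..b n powr \<alpha>}) = {0<..}"
    proof (intro set_eqI iffI)
      fix r assume "r \<in> (\<Union>n. {a n powr \<alpha>..b n powr \<alpha>})"
      then obtain n where "a n powr \<alpha> \<le> r" by auto
      moreover have "0 < a n powr \<alpha>" using ab(1)[of n] by simp
      ultimately show "r \<in> {0<..}" unfolding greaterThan_iff by linarith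
    next
      fix r :: real assume "r \<in> {0<..}"
      then have r: "0 < r" by simp
      then obtain n where n: "a n \<le> r powr (1 / \<alpha>)" "r powr (1 / \<alpha>) \<le> b n"
        using conv[of "r powr (1 / \<alpha>)"] by auto
      have "a n powr \<alpha> \<le> (r powr (1 / \<alpha>)) powr \<alpha>" "(r powr (1 / \<alpha>)) powr \<alpha> \<le> b n powr \<alpha>"
        using n ab[of n] \<alpha> by (auto intro!: powr_mono2)
      then show "r \<in> (\<Union>n. {a n powr \<alpha>..b n powr \<alpha>})"
        using r \<alpha> by (auto simp: powr_powr)
    qed
    moreover have "incseq (\<lambda>n r. f (r powr (1 / \<alpha>)) * indicator {a n powr \<alpha>..b n powr \<alpha>} r)"
    proof (intro monoI le_funI mult_left_mono)
      fix m n :: nat and r assume "m \<le> n"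
      then have "a n powr \<alpha> \<le> a m powr \<alpha>" "b m powr \<alpha> \<le> b n powr \<alpha>"
        using mono[of m n] ab(1)[of n] ab[of m] \<alpha> by (auto intro!: powr_mono2)
      then show "indicator {a m powr \<alpha>..b m powr \<alpha>} r \<le> (indicator {a n powr \<alpha>..b n powr \<alpha>} r :: ennreal)"
        by (auto simp: indicator_def)
    qed simp
    ultimately show ?thesis
      by (subst nn_integral_monotone_convergence_SUP[symmetric]) (auto simp: SUP_ind image_image)
  qed
  have R: "(\<integral>\<^sup>+y. f y * ennreal (\<alpha> * y powr (\<alpha> - 1)) * indicator {0<..} y \<partial>lborel)
      = (SUP n. \<integral>\<^sup>+y. f y * ennreal (\<alpha> * y powr (\<alpha> - 1)) * indicator {a n..b n} y \<partial>lborel)"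
  proof -
    have "(\<Union>n. {a n..b n}) = {0<..}"
    proof (intro set_eqI iffI)
      fix r assume "r \<in> (\<Union>n. {a n..b n})"
      then obtain n where "a n \<le> r" by auto
      with ab(1)[of n] show "r \<in> {0<..}" unfolding greaterThan_iff by linarith
    qed (use conv in auto)
    moreover have "incseq (\<lambda>n y. f y * ennreal (\<alpha> * y powr (\<alpha> - 1)) * indicator {a n..b n} y)"
    proof (intro monoI le_funI mult_left_mono)
      fix m n :: nat and r assume "m \<le> n"
      then show "indicator {a m..b m} r \<le> (indicator {a n..b n} r :: ennreal)"
        using mono[of m n] by (auto simp: indicator_def)
    qed simp
    ultimately show ?thesis
      by (subst nn_integral_monotone_convergence_SUP[symmetric]) (auto simp: SUP_ind image_image)
  qed
  show ?thesis unfolding L R step ..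
qed

text \<open>
  \<open>increment_kernel T \<alpha> s\<close> is the density of the measure with mass \<open>T - r\<close> per unit of time \<open>r\<close>
  carried along the curve \<open>r \<mapsto> r\<^sup>1\<^sup>/\<^sup>\<alpha> s\<close>. By self-similarity, averaging it over the stable law at
  time one gives the occupation density of the increments over a time interval of length \<open>T\<close>.
\<close>

definition increment_kernel :: "real \<Rightarrow> real \<Rightarrow> real \<Rightarrow> real \<Rightarrow> real" where
  "increment_kernel T \<alpha> s b =
     (if 0 < b / s then max 0 (T - (b / s) powr \<alpha>) * (\<alpha> * (b / s) powr (\<alpha> - 1)) / \<bar>s\<bar> else 0)"

lemma increment_kernel_measurable [measurable]:
  "(\<lambda>x. increment_kernel T \<alpha> (f x) (g x)) \<in> borel_measurable M"
  if [measurable]: "f \<in> borel_measurable M" "g \<in> borel_measurable M"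
  unfolding increment_kernel_def by measurable

lemma increment_kernel_nonneg: "0 < \<alpha> \<Longrightarrow> 0 \<le> increment_kernel T \<alpha> s b"
  by (simp add: increment_kernel_def)

lemma nn_integral_increment_kernel:
  fixes h :: "real \<Rightarrow> ennreal"
  assumes [measurable]: "h \<in> borel_measurable borel" and \<alpha>: "0 < \<alpha>" and s: "s \<noteq> 0"
  shows "(\<integral>\<^sup>+r. ennreal (max 0 (T - r)) * h (r powr (1 / \<alpha>) * s) * indicator {0<..} r \<partial>lborel)
    = (\<integral>\<^sup>+b. ennreal (increment_kernel T \<alpha> s b) * h b \<partial>lborel)"
proof -
  define f where "f y = ennreal (max 0 (T - y powr \<alpha>)) * h (y * s)" for y
  have [measurable]: "f \<in> borel_measurable borel" unfolding f_def by measurable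
  have "(\<integral>\<^sup>+r. ennreal (max 0 (T - r)) * h (r powr (1 / \<alpha>) * s) * indicator {0<..} r \<partial>lborel)
      = (\<integral>\<^sup>+r. f (r powr (1 / \<alpha>)) * indicator {0<..} r \<partial>lborel)"
    using \<alpha> by (intro nn_integral_cong) (auto simp: f_def powr_powr indicator_def)
  also have "\<dots> = (\<integral>\<^sup>+y. f y * ennreal (\<alpha> * y powr (\<alpha> - 1)) * indicator {0<..} y \<partial>lborel)"
    using \<alpha> by (intro nn_integral_power_substitution) auto
  also have "\<dots> = ennreal \<bar>1 / s\<bar> * (\<integral>\<^sup>+b. f (b / s) * ennreal (\<alpha> * (b / s) powr (\<alpha> - 1)) * indicator {0<..} (b / s) \<partial>lborel)"
    using s by (subst nn_integral_real_affine[where c = "1 / s" and t = 0]) auto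
  also have "\<dots> = (\<integral>\<^sup>+b. ennreal \<bar>1 / s\<bar> * (f (b / s) * ennreal (\<alpha> * (b / s) powr (\<alpha> - 1)) * indicator {0<..} (b / s)) \<partial>lborel)"
    by (rule nn_integral_cmult[symmetric]) simp
  also have "\<dots> = (\<integral>\<^sup>+b. ennreal (increment_kernel T \<alpha> s b) * h b \<partial>lborel)"
  proof (rule nn_integral_cong)
    fix b
    show "ennreal \<bar>1 / s\<bar> * (f (b / s) * ennreal (\<alpha> * (b / s) powr (\<alpha> - 1)) * indicator {0<..} (b / s))
      = ennreal (increment_kernel T \<alpha> s b) * h b"
    proof (cases "0 < b / s")
      case True
      define m where "m = max 0 (T - (b / s) powr \<alpha>)"
      define c where "c = \<alpha> * (b / s) powr (\<alpha> - 1)"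
      have mc: "0 \<le> m" "0 \<le> c" using \<alpha> by (simp_all add: m_def c_def)
      have "increment_kernel T \<alpha> s b = \<bar>1 / s\<bar> * (m * c)"
        using True by (simp add: increment_kernel_def m_def c_def)
      then have "ennreal (increment_kernel T \<alpha> s b) = ennreal \<bar>1 / s\<bar> * (ennreal m * ennreal c)"
        using mc by (simp only: ennreal_mult' abs_ge_zero)
      moreover have "f (b / s) = ennreal m * h b"
        using s unfolding f_def m_def by simp
      moreover have "indicator {0<..} (b / s) = (1 :: ennreal)"
        using True by simp
      ultimately show ?thesis
        unfolding c_def[symmetric] by (simp only: mult_1_left mult_1_right mult_ac)
    qed (simp add: increment_kernel_def)
  qed
  finally show ?thesis .
qed

lemma increment_kernel_le:
  assumes "0 < \<alpha>" "0 \<le> T"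
  shows "increment_kernel T \<alpha> s b \<le> T * \<alpha> * \<bar>s\<bar> powr (- \<alpha>) * \<bar>b\<bar> powr (\<alpha> - 1)"
proof (cases "0 < b / s")
  case True
  then have s: "s \<noteq> 0" by auto
  have "b / s = \<bar>b\<bar> / \<bar>s\<bar>" using True abs_of_pos[of "b / s"] unfolding abs_divide by simp
  moreover have "\<bar>s\<bar> powr (\<alpha> - 1) * \<bar>s\<bar> = \<bar>s\<bar> powr \<alpha>"
    using s by (simp add: powr_mult_base mult.commute[of _ "\<bar>s\<bar>"])
  ultimately have *: "\<alpha> * (b / s) powr (\<alpha> - 1) / \<bar>s\<bar> = \<alpha> * \<bar>s\<bar> powr (- \<alpha>) * \<bar>b\<bar> powr (\<alpha> - 1)"
    by (simp add: powr_divide powr_minus_divide)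
  have "increment_kernel T \<alpha> s b = max 0 (T - (b / s) powr \<alpha>) * (\<alpha> * (b / s) powr (\<alpha> - 1) / \<bar>s\<bar>)"
    using True by (simp add: increment_kernel_def)
  also have "\<dots> \<le> T * (\<alpha> * (b / s) powr (\<alpha> - 1) / \<bar>s\<bar>)"
    using assms by (intro mult_right_mono) auto
  finally show ?thesis unfolding * by (simp add: mult_ac)
qed (use assms in \<open>simp add: increment_kernel_def\<close>)

lemma isCont_increment_kernel:
  assumes "b \<noteq> 0" "s \<noteq> 0"
  shows "isCont (increment_kernel T \<alpha> s) b"
proof -
  let ?k = "\<lambda>b. max 0 (T - (b / s) powr \<alpha>) * (\<alpha> * (b / s) powr (\<alpha> - 1)) / \<bar>s\<bar>"
  show ?thesis
  proof (cases "0 < b / s")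
    case True
    have "isCont ?k b"
      using True assms by (intro continuous_intros) auto
    moreover have "\<forall>\<^sub>F y in nhds b. increment_kernel T \<alpha> s y = ?k y"
    proof -
      have "open {y. 0 < y / s}" using assms by (intro open_Collect_less continuous_intros) auto
      then have "\<forall>\<^sub>F y in nhds b. y \<in> {y. 0 < y / s}"
        using True by (intro eventually_nhds_in_open) auto
      then show ?thesis by eventually_elim (simp add: increment_kernel_def)
    qed
    ultimately show ?thesis by (subst isCont_cong) auto
  next
    case False
    then have neg: "b / s < 0" using assms by (simp add: not_less order_less_le)
    have "\<forall>\<^sub>F y in nhds b. increment_kernel T \<alpha> s y = 0"
    proof -
      have "open {y. y / s < 0}" using assms by (intro open_Collect_less continuous_intros) auto
      then have "\<forall>\<^sub>F y in nhds b. y \<in> {y. y / s < 0}"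
        using neg by (intro eventually_nhds_in_open) auto
      then show ?thesis by eventually_elim (simp add: increment_kernel_def)
    qed
    then show ?thesis by (subst isCont_cong) auto
  qed
qed

lemma nn_integral_square_differences:
  fixes q :: "real \<Rightarrow> ennreal"
  assumes [measurable]: "q \<in> borel_measurable borel"
  shows "(\<integral>\<^sup>+u. (\<integral>\<^sup>+v. q \<bar>v - u\<bar> * indicator {0..T} v \<partial>lborel) * indicator {0..T} u \<partial>lborel)
    = 2 * (\<integral>\<^sup>+r. ennreal (max 0 (T - r)) * q r * indicator {0<..} r \<partial>lborel)"
proof -
  have shift: "(\<integral>\<^sup>+v. q \<bar>v - u\<bar> * indicator {0..T} v \<partial>lborel) = (\<integral>\<^sup>+r. q \<bar>r\<bar> * indicator {0..T} (u + r) \<partial>lborel)" for u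
    by (subst nn_integral_real_affine[where c = 1 and t = u]) simp_all
  have "(\<integral>\<^sup>+u. (\<integral>\<^sup>+v. q \<bar>v - u\<bar> * indicator {0..T} v \<partial>lborel) * indicator {0..T} u \<partial>lborel)
      = (\<integral>\<^sup>+u. (\<integral>\<^sup>+r. q \<bar>r\<bar> * indicator {0..T} (u + r) \<partial>lborel) * indicator {0..T} u \<partial>lborel)"
    unfolding shift ..
  also have "\<dots> = (\<integral>\<^sup>+u. \<integral>\<^sup>+r. q \<bar>r\<bar> * (indicator {0..T} (u + r) * indicator {0..T} u) \<partial>lborel \<partial>lborel)"
    by (intro nn_integral_cong, subst nn_integral_multc[symmetric]) (simp_all add: mult.assoc)
  also have "\<dots> = (\<integral>\<^sup>+r. \<integral>\<^sup>+u. q \<bar>r\<bar> * (indicator {0..T} (u + r) * indicator {0..T} u) \<partial>lborel \<partial>lborel)"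
    by (rule lborel_pair.Fubini'[symmetric]) simp
  also have "\<dots> = (\<integral>\<^sup>+r. q \<bar>r\<bar> * ennreal (max 0 (T - \<bar>r\<bar>)) \<partial>lborel)"
  proof (rule nn_integral_cong)
    fix r
    have "(\<integral>\<^sup>+u. q \<bar>r\<bar> * (indicator {0..T} (u + r) * indicator {0..T} u) \<partial>lborel)
        = q \<bar>r\<bar> * (\<integral>\<^sup>+u. indicator {0..T} (u + r) * indicator {0..T} u \<partial>lborel)"
      by (rule nn_integral_cmult) simp
    also have "(\<integral>\<^sup>+u. indicator {0..T} (u + r) * indicator {0..T} u \<partial>lborel)
        = (\<integral>\<^sup>+u. indicator {max 0 (- r)..min T (T - r)} u \<partial>lborel)"
      by (intro nn_integral_cong) (auto simp: indicator_def)
    also have "\<dots> = ennreal (max 0 (T - \<bar>r\<bar>))"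
    proof (cases "0 \<le> r")
      case True
      then have "max 0 (- r) = 0" "min T (T - r) = T - r" "\<bar>r\<bar> = r" by linarith+
      then show ?thesis by (simp add: emeasure_lborel_Icc_eq max_def)
    next
      case False
      then have "max 0 (- r) = - r" "min T (T - r) = T" "\<bar>r\<bar> = - r" by linarith+
      then show ?thesis by (simp add: emeasure_lborel_Icc_eq max_def)
    qed
    finally show "(\<integral>\<^sup>+u. q \<bar>r\<bar> * (indicator {0..T} (u + r) * indicator {0..T} u) \<partial>lborel)
        = q \<bar>r\<bar> * ennreal (max 0 (T - \<bar>r\<bar>))" .
  qed
  also have "\<dots> = 2 * (\<integral>\<^sup>+r. ennreal (max 0 (T - r)) * q r * indicator {0<..} r \<partial>lborel)"
  proof -
    let ?f = "\<lambda>r. ennreal (max 0 (T - r)) * q r * indicator {0<..} r"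
    have "(\<integral>\<^sup>+r. q \<bar>r\<bar> * ennreal (max 0 (T - \<bar>r\<bar>)) \<partial>lborel) = (\<integral>\<^sup>+r. ?f r + ?f (0 + - 1 * r) \<partial>lborel)"
    proof (rule nn_integral_cong_AE, use AE_lborel_singleton[of 0] in eventually_elim)
      fix r :: real assume "r \<noteq> 0"
      then consider "0 < r" | "r < 0" by linarith
      then show "q \<bar>r\<bar> * ennreal (max 0 (T - \<bar>r\<bar>)) = ?f r + ?f (0 + - 1 * r)"
        by cases (simp_all add: mult.commute)
    qed
    also have "\<dots> = (\<integral>\<^sup>+r. ?f r \<partial>lborel) + (\<integral>\<^sup>+r. ?f (0 + - 1 * r) \<partial>lborel)"
      by (rule nn_integral_add) auto
    also have "(\<integral>\<^sup>+r. ?f (0 + - 1 * r) \<partial>lborel) = (\<integral>\<^sup>+r. ?f r \<partial>lborel)"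
    proof -
      have "(\<integral>\<^sup>+r. ?f r \<partial>lborel) = ennreal \<bar>-1\<bar> * (\<integral>\<^sup>+r. ?f (0 + - 1 * r) \<partial>lborel)"
        by (rule nn_integral_real_affine) auto
      then show ?thesis by (simp only: abs_minus_cancel abs_one ennreal_1 mult_1_left)
    qed
    finally show ?thesis unfolding mult_2 .
  qed
  finally show ?thesis .
qed

text \<open>
  The factor two accounts for the two orders in which a pair of times can be taken.
\<close>

definition increment_density :: "real \<Rightarrow> real \<Rightarrow> real measure \<Rightarrow> real \<Rightarrow> real" where
  "increment_density T \<alpha> \<mu> b = 2 * (\<integral>s. increment_kernel T \<alpha> s b \<partial>\<mu>)"

context
  fixes \<mu> :: "real measure" and \<alpha> T :: real
  assumes \<mu>: "real_distribution \<mu>"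
    and ne: "AE s in \<mu>. s \<noteq> 0" and mom: "(\<integral>\<^sup>+s. ennreal (\<bar>s\<bar> powr (- \<alpha>)) \<partial>\<mu>) < \<infinity>"
    and \<alpha>: "1 / 2 < \<alpha>" "\<alpha> < 1" and T: "0 \<le> T"
begin

interpretation \<mu>: real_distribution \<mu> by (rule \<mu>)

lemma integrable_negative_moment: "integrable \<mu> (\<lambda>s. \<bar>s\<bar> powr (- \<alpha>))"
  using mom by (simp add: integrable_iff_bounded)

lemma integrable_increment_kernel: "integrable \<mu> (\<lambda>s. increment_kernel T \<alpha> s b)"
proof (rule Bochner_Integration.integrable_bound)
  show "integrable \<mu> (\<lambda>s. T * \<alpha> * \<bar>b\<bar> powr (\<alpha> - 1) * \<bar>s\<bar> powr (- \<alpha>))"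
    using integrable_negative_moment by simp
  show "AE s in \<mu>. norm (increment_kernel T \<alpha> s b) \<le> norm (T * \<alpha> * \<bar>b\<bar> powr (\<alpha> - 1) * \<bar>s\<bar> powr (- \<alpha>))"
    using increment_kernel_le[of \<alpha> T _ b] increment_kernel_nonneg[of \<alpha> T _ b] \<alpha> T
    by (intro AE_I2) (simp add: mult_ac)
qed simp

lemma increment_density_measurable [measurable]: "increment_density T \<alpha> \<mu> \<in> borel_measurable borel"
  unfolding increment_density_def[abs_def] by measurable

lemma increment_density_nonneg: "0 \<le> increment_density T \<alpha> \<mu> b"
  unfolding increment_density_def using \<alpha>
  by (intro mult_nonneg_nonneg Bochner_Integration.integral_nonneg increment_kernel_nonneg) auto

lemma ennreal_increment_density:
  "ennreal (increment_density T \<alpha> \<mu> b) = 2 * (\<integral>\<^sup>+s. ennreal (increment_kernel T \<alpha> s b) \<partial>\<mu>)"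
  unfolding increment_density_def using \<alpha>
  by (subst nn_integral_eq_integral[OF integrable_increment_kernel])
    (auto simp: ennreal_mult' increment_kernel_nonneg)

lemma increment_density_le:
  "increment_density T \<alpha> \<mu> b \<le> 2 * T * \<alpha> * (\<integral>s. \<bar>s\<bar> powr (- \<alpha>) \<partial>\<mu>) * \<bar>b\<bar> powr (\<alpha> - 1)"
proof -
  have "(\<integral>s. increment_kernel T \<alpha> s b \<partial>\<mu>) \<le> (\<integral>s. T * \<alpha> * \<bar>b\<bar> powr (\<alpha> - 1) * \<bar>s\<bar> powr (- \<alpha>) \<partial>\<mu>)"
    using increment_kernel_le[of \<alpha> T _ b] \<alpha> T integrable_negative_moment
    by (intro integral_mono integrable_increment_kernel) (auto simp: mult_ac)
  also have "\<dots> = T * \<alpha> * \<bar>b\<bar> powr (\<alpha> - 1) * (\<integral>s. \<bar>s\<bar> powr (- \<alpha>) \<partial>\<mu>)"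
    by simp
  finally show ?thesis by (simp add: increment_density_def mult_ac)
qed

text \<open>
  Dominated convergence: in a neighbourhood of a point other than zero the kernel is bounded by a
  multiple of \<open>\<bar>s\<bar>\<^sup>-\<^sup>\<alpha>\<close>, uniformly in the spatial variable.
\<close>

lemma isCont_increment_density:
  assumes b: "b \<noteq> 0"
  shows "isCont (increment_density T \<alpha> \<mu>) b"
proof -
  let ?C = "\<lambda>s. T * \<alpha> * \<bar>s\<bar> powr (- \<alpha>) * (\<bar>b\<bar> / 2) powr (\<alpha> - 1)"
  have "((\<lambda>y. \<integral>s. increment_kernel T \<alpha> s y \<partial>\<mu>) \<longlongrightarrow> (\<integral>s. increment_kernel T \<alpha> s b \<partial>\<mu>)) (at b)"
  proof (rule tendsto_at_iff_sequentially[THEN iffD2], intro allI impI)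
    fix Y :: "nat \<Rightarrow> real" assume Y: "Y \<longlonglongrightarrow> b"
    have "\<forall>\<^sub>F n in sequentially. \<bar>b\<bar> / 2 < \<bar>Y n\<bar>"
      using tendsto_rabs[OF Y] b by (intro order_tendstoD(1)) auto
    then obtain n0 where n0: "\<And>n. n0 \<le> n \<Longrightarrow> \<bar>b\<bar> / 2 < \<bar>Y n\<bar>"
      by (auto simp: eventually_sequentially)
    have "(\<lambda>n. \<integral>s. increment_kernel T \<alpha> s (Y (n + n0)) \<partial>\<mu>) \<longlonglongrightarrow> (\<integral>s. increment_kernel T \<alpha> s b \<partial>\<mu>)"
    proof (rule integral_dominated_convergence)
      show "integrable \<mu> ?C" using integrable_negative_moment by simp
      show "AE s in \<mu>. (\<lambda>n. increment_kernel T \<alpha> s (Y (n + n0))) \<longlonglongrightarrow> increment_kernel T \<alpha> s b"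
        using ne
      proof eventually_elim
        case (elim s)
        show ?case
          by (rule isCont_tendsto_compose[OF isCont_increment_kernel[OF b elim]])
            (rule LIMSEQ_ignore_initial_segment[OF Y])
      qed
      show "AE s in \<mu>. norm (increment_kernel T \<alpha> s (Y (n + n0))) \<le> ?C s" for n
      proof (rule AE_I2)
        fix s
        have "\<bar>Y (n + n0)\<bar> powr (\<alpha> - 1) \<le> (\<bar>b\<bar> / 2) powr (\<alpha> - 1)"
          using n0[of "n + n0"] \<alpha> b by (intro powr_mono2') auto
        then have "T * \<alpha> * \<bar>s\<bar> powr (- \<alpha>) * \<bar>Y (n + n0)\<bar> powr (\<alpha> - 1) \<le> ?C s"
          using \<alpha> T by (intro mult_left_mono) auto
        moreover have "0 \<le> increment_kernel T \<alpha> s (Y (n + n0))" using \<alpha> by (intro increment_kernel_nonneg) simp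
        ultimately show "norm (increment_kernel T \<alpha> s (Y (n + n0))) \<le> ?C s"
          using increment_kernel_le[of \<alpha> T s "Y (n + n0)"] \<alpha> T by simp
      qed
    qed simp_all
    then show "((\<lambda>y. \<integral>s. increment_kernel T \<alpha> s y \<partial>\<mu>) \<circ> Y) \<longlonglongrightarrow> (\<integral>s. increment_kernel T \<alpha> s b \<partial>\<mu>)"
      unfolding comp_def by (rule LIMSEQ_offset)
  qed
  then show ?thesis
    unfolding isCont_def increment_density_def[abs_def] by (intro tendsto_mult_left)
qed

text \<open>
  By self-similarity, the inner integral is the mean of \<open>h\<close> at an increment over a time interval of
  length \<open>\<bar>v - u\<bar>\<close>. Since it only depends on the difference of the times, the double time integral
  becomes a single one, which the kernel transforms into an integral over space.
\<close>

lemma nn_integral_increment_density: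
  fixes h :: "real \<Rightarrow> ennreal"
  assumes [measurable]: "h \<in> borel_measurable borel"
  shows "(\<integral>\<^sup>+u. (\<integral>\<^sup>+v. (\<integral>\<^sup>+s. h (\<bar>v - u\<bar> powr (1 / \<alpha>) * s) \<partial>\<mu>) * indicator {0..T} v \<partial>lborel) * indicator {0..T} u \<partial>lborel)
    = (\<integral>\<^sup>+b. ennreal (increment_density T \<alpha> \<mu> b) * h b \<partial>lborel)"
proof -
  interpret P: pair_sigma_finite lborel \<mu> ..
  define q where "q r = (\<integral>\<^sup>+s. h (r powr (1 / \<alpha>) * s) \<partial>\<mu>)" for r
  have [measurable]: "q \<in> borel_measurable borel" unfolding q_def by measurable
  have "(\<integral>\<^sup>+u. (\<integral>\<^sup>+v. q \<bar>v - u\<bar> * indicator {0..T} v \<partial>lborel) * indicator {0..T} u \<partial>lborel)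
      = 2 * (\<integral>\<^sup>+r. ennreal (max 0 (T - r)) * q r * indicator {0<..} r \<partial>lborel)"
    by (rule nn_integral_square_differences) simp
  also have "(\<integral>\<^sup>+r. ennreal (max 0 (T - r)) * q r * indicator {0<..} r \<partial>lborel)
      = (\<integral>\<^sup>+r. \<integral>\<^sup>+s. ennreal (max 0 (T - r)) * h (r powr (1 / \<alpha>) * s) * indicator {0<..} r \<partial>\<mu> \<partial>lborel)"
    unfolding q_def by (simp add: nn_integral_cmult nn_integral_multc)
  also have "\<dots> = (\<integral>\<^sup>+s. \<integral>\<^sup>+r. ennreal (max 0 (T - r)) * h (r powr (1 / \<alpha>) * s) * indicator {0<..} r \<partial>lborel \<partial>\<mu>)"
    by (rule P.Fubini'[symmetric]) simp
  also have "\<dots> = (\<integral>\<^sup>+s. \<integral>\<^sup>+b. ennreal (increment_kernel T \<alpha> s b) * h b \<partial>lborel \<partial>\<mu>)"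
    using \<alpha> by (intro nn_integral_cong_AE, use ne in eventually_elim) (rule nn_integral_increment_kernel, auto)
  also have "\<dots> = (\<integral>\<^sup>+b. \<integral>\<^sup>+s. ennreal (increment_kernel T \<alpha> s b) * h b \<partial>\<mu> \<partial>lborel)"
    by (rule P.Fubini') simp
  also have "\<dots> = (\<integral>\<^sup>+b. (\<integral>\<^sup>+s. ennreal (increment_kernel T \<alpha> s b) \<partial>\<mu>) * h b \<partial>lborel)"
    by (simp add: nn_integral_multc)
  also have "2 * \<dots> = (\<integral>\<^sup>+b. 2 * ((\<integral>\<^sup>+s. ennreal (increment_kernel T \<alpha> s b) \<partial>\<mu>) * h b) \<partial>lborel)"
    by (rule nn_integral_cmult[symmetric]) simp
  also have "\<dots> = (\<integral>\<^sup>+b. ennreal (increment_density T \<alpha> \<mu> b) * h b \<partial>lborel)"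
    unfolding ennreal_increment_density by (simp add: mult.assoc)
  finally show ?thesis unfolding q_def .
qed

lemma nn_integral_increment_density_finite:
  "(\<integral>\<^sup>+b. ennreal (increment_density T \<alpha> \<mu> b) \<partial>lborel) < \<infinity>"
proof -
  have "(\<integral>\<^sup>+b. ennreal (increment_density T \<alpha> \<mu> b) \<partial>lborel)
      = (\<integral>\<^sup>+u. (\<integral>\<^sup>+v. (\<integral>\<^sup>+s. 1 \<partial>\<mu>) * indicator {0..T} v \<partial>lborel) * indicator {0..T} u \<partial>lborel)"
    using nn_integral_increment_density[of "\<lambda>_. 1"] by simp
  also have "\<dots> = ennreal T * ennreal T"
    using T \<mu>.emeasure_space_1 by (simp add: nn_integral_cmult_indicator)
  finally show ?thesis by (simp add: ennreal_mult_less_top)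
qed

text \<open>
  The bound \<open>C \<bar>b\<bar>\<^sup>\<alpha>\<^sup>-\<^sup>1\<close> is square integrable near the origin because \<open>\<alpha> > 1/2\<close>; away from the
  origin it makes the square dominated by the density itself, whose integral is finite.
\<close>

lemma integrable_increment_density_square: "integrable lborel (\<lambda>b. (increment_density T \<alpha> \<mu> b)\<^sup>2)"
proof -
  define G where "G = increment_density T \<alpha> \<mu>"
  define C where "C = 2 * T * \<alpha> * (\<integral>s. \<bar>s\<bar> powr (- \<alpha>) \<partial>\<mu>)"
  have C: "0 \<le> C" using T \<alpha> by (simp add: C_def Bochner_Integration.integral_nonneg)
  have G: "0 \<le> G b" "G b \<le> C * \<bar>b\<bar> powr (\<alpha> - 1)" for b
    using increment_density_nonneg increment_density_le by (auto simp: G_def C_def)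
  have [measurable]: "G \<in> borel_measurable borel" by (simp add: G_def)
  have "(\<integral>\<^sup>+b. ennreal ((G b)\<^sup>2) \<partial>lborel)
      \<le> (\<integral>\<^sup>+b. ennreal (C\<^sup>2) * (ennreal (\<bar>b\<bar> powr ((2 * \<alpha> - 1) - 1)) * indicator {-1..1} b) + ennreal C * ennreal (G b) \<partial>lborel)"
  proof (rule nn_integral_mono)
    fix b :: real
    show "ennreal ((G b)\<^sup>2) \<le> ennreal (C\<^sup>2) * (ennreal (\<bar>b\<bar> powr ((2 * \<alpha> - 1) - 1)) * indicator {-1..1} b) + ennreal C * ennreal (G b)"
    proof (cases "\<bar>b\<bar> \<le> 1")
      case True
      have "(G b)\<^sup>2 \<le> (C * \<bar>b\<bar> powr (\<alpha> - 1))\<^sup>2" using G by (intro power_mono)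
      also have "\<dots> = C\<^sup>2 * \<bar>b\<bar> powr ((2 * \<alpha> - 1) - 1)"
        by (simp add: power_mult_distrib power2_eq_square[of "_ powr _"] powr_add[symmetric])
      finally have "ennreal ((G b)\<^sup>2) \<le> ennreal (C\<^sup>2) * ennreal (\<bar>b\<bar> powr ((2 * \<alpha> - 1) - 1))"
        by (simp add: ennreal_mult[symmetric] ennreal_leI)
      then show ?thesis using True by (auto simp: abs_le_iff intro: order.trans)
    next
      case False
      then have "\<bar>b\<bar> powr (\<alpha> - 1) \<le> \<bar>b\<bar> powr 0" using \<alpha> by (intro powr_mono) auto
      then have "C * \<bar>b\<bar> powr (\<alpha> - 1) \<le> C * 1" using C False by (intro mult_left_mono) (auto split: if_splits)
      then have "G b \<le> C" using G(2)[of b] by simp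
      then have "(G b)\<^sup>2 \<le> C * G b" using G by (simp add: power2_eq_square mult_right_mono)
      then have "ennreal ((G b)\<^sup>2) \<le> ennreal C * ennreal (G b)"
        using G C by (simp add: ennreal_mult[symmetric] ennreal_leI)
      then show ?thesis using False by (auto simp: indicator_def abs_le_iff)
    qed
  qed
  also have "\<dots> = ennreal (C\<^sup>2) * (\<integral>\<^sup>+b. ennreal (\<bar>b\<bar> powr ((2 * \<alpha> - 1) - 1)) * indicator {-1..1} b \<partial>lborel)
      + ennreal C * (\<integral>\<^sup>+b. ennreal (G b) \<partial>lborel)"
    by (subst nn_integral_add) (simp_all add: nn_integral_cmult)
  also have "\<dots> < \<infinity>"
    using order.strict_trans1[OF nn_integral_abs_powr_le[of "2 * \<alpha> - 1" 1]] \<alpha> nn_integral_increment_density_finite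
    by (simp add: ennreal_mult_less_top G_def)
  finally show ?thesis by (simp add: integrable_iff_bounded G_def)
qed

end

section \<open>Continuity of weighted correlations\<close>

text \<open>
  Translation is continuous in mean square for a function that is continuous almost everywhere:
  the squares of the translates have the same integral, so Scheffe's lemma applies to them. The
  weighted correlation is controlled through \<open>\<bar>a b - b\<^sup>2\<bar> \<le> \<bar>a\<^sup>2 - b\<^sup>2\<bar>\<close> for nonnegative \<open>a\<close>, \<open>b\<close>.
\<close>

context
  fixes G \<Psi> :: "real \<Rightarrow> real" and c :: real
  assumes Gm [measurable]: "G \<in> borel_measurable borel" and G0: "\<And>b. 0 \<le> G b"
    and G2: "integrable lborel (\<lambda>b. (G b)\<^sup>2)"
    and \<Psi>m [measurable]: "\<Psi> \<in> borel_measurable borel" and \<Psi>: "\<And>b. 0 \<le> \<Psi> b" "\<And>b. \<Psi> b \<le> c"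
begin

lemma integrable_translate_square: "integrable lborel (\<lambda>b. (G (b + w))\<^sup>2)"
  using lborel_integrable_real_affine[OF G2, of 1 w] by (simp add: add.commute)

lemma integrable_weighted_correlation: "integrable lborel (\<lambda>b. \<Psi> b * G b * G (b + w))"
proof (rule Bochner_Integration.integrable_bound)
  show "integrable lborel (\<lambda>b. c * ((G b)\<^sup>2 + (G (b + w))\<^sup>2))"
    using G2 integrable_translate_square by simp
  show "AE b in lborel. norm (\<Psi> b * G b * G (b + w)) \<le> norm (c * ((G b)\<^sup>2 + (G (b + w))\<^sup>2))"
  proof (rule AE_I2)
    fix b
    have "0 \<le> (G b - G (b + w))\<^sup>2" "0 \<le> G b * G (b + w)" using G0 by auto
    then have "G b * G (b + w) \<le> (G b)\<^sup>2 + (G (b + w))\<^sup>2" by (simp add: power2_diff)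
    then have "\<Psi> b * (G b * G (b + w)) \<le> c * ((G b)\<^sup>2 + (G (b + w))\<^sup>2)"
      using \<Psi>[of b] G0 by (intro mult_mono) auto
    then show "norm (\<Psi> b * G b * G (b + w)) \<le> norm (c * ((G b)\<^sup>2 + (G (b + w))\<^sup>2))"
      using \<Psi> G0 by (simp add: mult.assoc)
  qed
qed simp

lemma isCont_weighted_correlation:
  assumes cont: "\<And>b. b \<noteq> 0 \<Longrightarrow> isCont G b"
  shows "isCont (\<lambda>w. \<integral>b. \<Psi> b * G b * G (b + w) \<partial>lborel) 0"
  unfolding isCont_def
proof (rule tendsto_at_iff_sequentially[THEN iffD2], intro allI impI)
  fix W :: "nat \<Rightarrow> real" assume W: "W \<longlonglongrightarrow> 0"
  let ?H = "\<lambda>w. \<integral>b. \<Psi> b * G b * G (b + w) \<partial>lborel"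
  let ?D = "\<lambda>n b. (G (b + W n))\<^sup>2 - (G b)\<^sup>2"
  have D: "integrable lborel (?D n)" for n
    using G2 integrable_translate_square by simp
  have "(\<lambda>n. \<integral>\<^sup>+b. norm (?D n b) \<partial>lborel) \<longlonglongrightarrow> 0"
  proof (rule Scheffe_lemma2)
    show "AE b in lborel. (\<lambda>n. (G (b + W n))\<^sup>2) \<longlonglongrightarrow> (G b)\<^sup>2"
      using AE_lborel_singleton[of 0]
    proof eventually_elim
      case (elim b)
      have "(\<lambda>n. b + W n) \<longlonglongrightarrow> b + 0" by (intro tendsto_intros W)
      then show ?case
        using isCont_tendsto_compose[OF cont[OF elim]] by (intro tendsto_power) simp
    qed
    show "(\<integral>\<^sup>+b. norm ((G (b + W n))\<^sup>2) \<partial>lborel) \<le> (\<integral>\<^sup>+b. norm ((G b)\<^sup>2) \<partial>lborel)" for n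
      by (subst (2) nn_integral_real_affine[where c = 1 and t = "W n"]) (simp_all add: add.commute)
  qed (use G2 in auto)
  moreover have "(\<integral>\<^sup>+b. norm (?D n b) \<partial>lborel) = ennreal (\<integral>b. \<bar>?D n b\<bar> \<partial>lborel)" for n
    using D[of n] by (subst nn_integral_eq_integral) auto
  ultimately have "(\<lambda>n. ennreal (\<integral>b. \<bar>?D n b\<bar> \<partial>lborel)) \<longlonglongrightarrow> ennreal 0" by simp
  then have lim: "(\<lambda>n. \<integral>b. \<bar>?D n b\<bar> \<partial>lborel) \<longlonglongrightarrow> 0"
    by (subst (asm) tendsto_ennreal_iff) auto
  have "(\<lambda>n. ?H (W n) - ?H 0) \<longlonglongrightarrow> 0"
  proof (rule Lim_null_comparison)
    have "(\<lambda>n. c * (\<integral>b. \<bar>?D n b\<bar> \<partial>lborel)) \<longlonglongrightarrow> c * 0" by (intro tendsto_intros lim)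
    then show "(\<lambda>n. c * (\<integral>b. \<bar>?D n b\<bar> \<partial>lborel)) \<longlonglongrightarrow> 0" by simp
    show "\<forall>\<^sub>F n in sequentially. norm (?H (W n) - ?H 0) \<le> c * (\<integral>b. \<bar>?D n b\<bar> \<partial>lborel)"
    proof (rule always_eventually, rule allI)
      fix n
      have int: "integrable lborel (\<lambda>b. \<Psi> b * G b * G (b + W n) - \<Psi> b * G b * G (b + 0))"
        by (intro Bochner_Integration.integrable_diff integrable_weighted_correlation)
      have "norm (?H (W n) - ?H 0) = norm (\<integral>b. \<Psi> b * G b * G (b + W n) - \<Psi> b * G b * G (b + 0) \<partial>lborel)"
        by (subst Bochner_Integration.integral_diff) (auto intro: integrable_weighted_correlation integrable_weighted_correlation[of 0, simplified])
      also have "\<dots> \<le> (\<integral>b. norm (\<Psi> b * G b * G (b + W n) - \<Psi> b * G b * G (b + 0)) \<partial>lborel)"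
        by (rule integral_norm_bound)
      also have "\<dots> \<le> (\<integral>b. c * \<bar>?D n b\<bar> \<partial>lborel)"
      proof (rule integral_mono)
        show "integrable lborel (\<lambda>b. norm (\<Psi> b * G b * G (b + W n) - \<Psi> b * G b * G (b + 0)))"
          using int by (rule integrable_norm)
        show "integrable lborel (\<lambda>b. c * \<bar>?D n b\<bar>)"
          using D[of n] by simp
        fix b
        have "\<bar>G (b + W n) - G b\<bar> * G b \<le> \<bar>G (b + W n) - G b\<bar> * \<bar>G (b + W n) + G b\<bar>"
          using G0[of b] G0[of "b + W n"] by (intro mult_left_mono) auto
        also have "\<dots> = \<bar>?D n b\<bar>"
          by (simp add: abs_mult[symmetric] power2_eq_square algebra_simps)
        finally have le: "\<bar>G (b + W n) - G b\<bar> * G b \<le> \<bar>?D n b\<bar>" .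
        have "norm (\<Psi> b * G b * G (b + W n) - \<Psi> b * G b * G (b + 0)) = \<Psi> b * (\<bar>G (b + W n) - G b\<bar> * G b)"
          using \<Psi>(1)[of b] G0[of b] by (simp add: right_diff_distrib[symmetric] abs_mult)
        also have "\<dots> \<le> c * \<bar>?D n b\<bar>"
          using \<Psi>[of b] G0[of b] le by (intro mult_mono) auto
        finally show "norm (\<Psi> b * G b * G (b + W n) - \<Psi> b * G b * G (b + 0)) \<le> c * \<bar>?D n b\<bar>" .
      qed
      also have "\<dots> = c * (\<integral>b. \<bar>?D n b\<bar> \<partial>lborel)" by simp
      finally show "norm (?H (W n) - ?H 0) \<le> c * (\<integral>b. \<bar>?D n b\<bar> \<partial>lborel)" .
    qed
  qed
  then show "(?H \<circ> W) \<longlonglongrightarrow> ?H 0"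
    unfolding comp_def by (subst LIM_zero_iff[symmetric])
qed

end

section \<open>Correlations of smeared intersection local times\<close>

lemma nn_integral_shift:
  fixes f :: "real \<Rightarrow> ennreal"
  assumes "f \<in> borel_measurable borel"
  shows "(\<integral>\<^sup>+x. f x \<partial>lborel) = (\<integral>\<^sup>+x. f (x + t) \<partial>lborel)"
  using nn_integral_real_affine[OF assms, of 1 t] by (simp add: add.commute)

definition time_measure :: "real \<Rightarrow> real measure" where
  "time_measure T = density lborel (indicator {0..T})"

lemma sets_time_measure [measurable_cong, simp]: "sets (time_measure T) = sets borel"
  by (simp add: time_measure_def)

lemma space_time_measure [simp]: "space (time_measure T) = UNIV"
  by (simp add: time_measure_def)

lemma nn_integral_time_measure:
  assumes "f \<in> borel_measurable borel"
  shows "(\<integral>\<^sup>+u. f u \<partial>time_measure T) = (\<integral>\<^sup>+u. f u * indicator {0..T} u \<partial>lborel)"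
  using assms by (simp add: time_measure_def nn_integral_density mult.commute)

lemma finite_time_measure: "finite_measure (time_measure T)"
proof
  show "emeasure (time_measure T) (space (time_measure T)) \<noteq> \<infinity>"
    by (simp add: time_measure_def emeasure_density emeasure_lborel_Icc_eq)
qed

lemma integral_time_measure:
  fixes f :: "real \<Rightarrow> real"
  assumes "f \<in> borel_measurable borel"
  shows "(\<integral>u. f u \<partial>time_measure T) = (LINT u:{0..T}|lborel. f u)"
  using assms unfolding time_measure_def set_lebesgue_integral_def
  by (subst integral_density[symmetric]) (auto simp: ennreal_indicator)

definition autocorrelation :: "(real \<Rightarrow> ennreal) \<Rightarrow> real \<Rightarrow> ennreal" where
  "autocorrelation \<psi> b = (\<integral>\<^sup>+a. \<psi> a * \<psi> (a + b) \<partial>lborel)"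

lemma autocorrelation_measurable [measurable]:
  assumes [measurable]: "\<psi> \<in> borel_measurable borel"
  shows "autocorrelation \<psi> \<in> borel_measurable borel"
  unfolding autocorrelation_def[abs_def] by measurable

text \<open>
  Integrating the starting points over the plane leaves only the increments of the two paths:
  translation in one variable straightens the mollifiers, translation in the other one the
  test function.
\<close>

lemma nn_integral_starting_points:
  fixes F F' \<psi> :: "real \<Rightarrow> ennreal"
  assumes [measurable]: "F \<in> borel_measurable borel" "F' \<in> borel_measurable borel" "\<psi> \<in> borel_measurable borel"
  shows "(\<integral>\<^sup>+y. \<integral>\<^sup>+x. (F (y + q - (x + p)) * \<psi> (x + p)) * (F' (y + q' - (x + p')) * \<psi> (x + p')) \<partial>lborel \<partial>lborel)
    = (\<integral>\<^sup>+w. F w * F' (w + ((q' - q) - (p' - p))) \<partial>lborel) * autocorrelation \<psi> (p' - p)"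
proof -
  define \<phi> where "\<phi> = (\<integral>\<^sup>+w. F w * F' (w + ((q' - q) - (p' - p))) \<partial>lborel)"
  have inner: "(\<integral>\<^sup>+y. (F (y + q - (x + p)) * \<psi> (x + p)) * (F' (y + q' - (x + p')) * \<psi> (x + p')) \<partial>lborel)
      = \<phi> * (\<psi> (x + p) * \<psi> (x + p'))" for x
  proof -
    have "(\<integral>\<^sup>+y. (F (y + q - (x + p)) * \<psi> (x + p)) * (F' (y + q' - (x + p')) * \<psi> (x + p')) \<partial>lborel)
        = (\<integral>\<^sup>+y. (F (y + q - (x + p)) * F' (y + q' - (x + p'))) * (\<psi> (x + p) * \<psi> (x + p')) \<partial>lborel)"
      by (simp only: mult_ac)
    also have "\<dots> = (\<integral>\<^sup>+y. F (y + q - (x + p)) * F' (y + q' - (x + p')) \<partial>lborel) * (\<psi> (x + p) * \<psi> (x + p'))"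
      by (rule nn_integral_multc) simp
    also have "(\<integral>\<^sup>+y. F (y + q - (x + p)) * F' (y + q' - (x + p')) \<partial>lborel) = \<phi>"
      unfolding \<phi>_def by (subst nn_integral_shift[where t = "x + p - q"]) (simp_all add: algebra_simps)
    finally show ?thesis .
  qed
  have "(\<integral>\<^sup>+y. \<integral>\<^sup>+x. (F (y + q - (x + p)) * \<psi> (x + p)) * (F' (y + q' - (x + p')) * \<psi> (x + p')) \<partial>lborel \<partial>lborel)
      = (\<integral>\<^sup>+x. \<integral>\<^sup>+y. (F (y + q - (x + p)) * \<psi> (x + p)) * (F' (y + q' - (x + p')) * \<psi> (x + p')) \<partial>lborel \<partial>lborel)"
    by (rule lborel_pair.Fubini') simp
  also have "\<dots> = \<phi> * (\<integral>\<^sup>+x. \<psi> (x + p) * \<psi> (x + p') \<partial>lborel)"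
    unfolding inner by (rule nn_integral_cmult) simp
  also have "(\<integral>\<^sup>+x. \<psi> (x + p) * \<psi> (x + p') \<partial>lborel) = autocorrelation \<psi> (p' - p)"
    unfolding autocorrelation_def by (subst nn_integral_shift[where t = "- p"]) (simp_all add: algebra_simps)
  finally show ?thesis unfolding \<phi>_def .
qed

text \<open>
  \<open>G\<close> is the density of the occupation measure of the increments over all pairs of times up to \<open>T\<close>.
  Independence is required at two times of each path, since second moments involve no more.
\<close>

locale path_pair = prob_space P for P :: "'w measure" +
  fixes r1 r2 :: "real \<Rightarrow> 'w \<Rightarrow> real" and T :: real and G :: "real \<Rightarrow> real"
  assumes r_measurable [measurable]:
      "(\<lambda>(u, \<omega>). r1 u \<omega>) \<in> borel_measurable (borel \<Otimes>\<^sub>M P)" "(\<lambda>(u, \<omega>). r2 u \<omega>) \<in> borel_measurable (borel \<Otimes>\<^sub>M P)"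
    and T: "0 \<le> T"
    and G_measurable [measurable]: "G \<in> borel_measurable borel" and G_nonneg: "\<And>b. 0 \<le> G b"
    and G_square: "integrable lborel (\<lambda>b. (G b)\<^sup>2)" and G_cont: "\<And>b. b \<noteq> 0 \<Longrightarrow> isCont G b"
    and occupation1: "\<And>h :: real \<Rightarrow> ennreal. h \<in> borel_measurable borel \<Longrightarrow>
      (\<integral>\<^sup>+u. \<integral>\<^sup>+v. \<integral>\<^sup>+\<omega>. h (r1 v \<omega> - r1 u \<omega>) \<partial>P \<partial>time_measure T \<partial>time_measure T) = (\<integral>\<^sup>+b. G b * h b \<partial>lborel)"
    and occupation2: "\<And>h :: real \<Rightarrow> ennreal. h \<in> borel_measurable borel \<Longrightarrow>
      (\<integral>\<^sup>+u. \<integral>\<^sup>+v. \<integral>\<^sup>+\<omega>. h (r2 v \<omega> - r2 u \<omega>) \<partial>P \<partial>time_measure T \<partial>time_measure T) = (\<integral>\<^sup>+b. G b * h b \<partial>lborel)"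
    and independent_paths: "\<And>(F :: (real \<times> real) \<times> (real \<times> real) \<Rightarrow> ennreal) u u' v v'.
      F \<in> borel_measurable ((borel \<Otimes>\<^sub>M borel) \<Otimes>\<^sub>M (borel \<Otimes>\<^sub>M borel)) \<Longrightarrow>
      (\<integral>\<^sup>+\<omega>. F ((r1 u \<omega>, r1 u' \<omega>), (r2 v \<omega>, r2 v' \<omega>)) \<partial>P)
        = (\<integral>\<^sup>+\<omega>. \<integral>\<^sup>+\<omega>'. F ((r1 u \<omega>, r1 u' \<omega>), (r2 v \<omega>', r2 v' \<omega>')) \<partial>P \<partial>P)"
begin

lemma independent_increments:
  assumes [measurable]: "F \<in> borel_measurable (borel \<Otimes>\<^sub>M borel)"
  shows "(\<integral>\<^sup>+\<omega>. F (r1 v \<omega> - r1 u \<omega>, r2 v' \<omega> - r2 u' \<omega>) \<partial>P)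
    = (\<integral>\<^sup>+\<omega>. \<integral>\<^sup>+\<omega>'. F (r1 v \<omega> - r1 u \<omega>, r2 v' \<omega>' - r2 u' \<omega>') \<partial>P \<partial>P)"
  using independent_paths[of "\<lambda>p. F (snd (fst p) - fst (fst p), snd (snd p) - fst (snd p))" u v u' v'] by simp

lemma r_measurable' [measurable (raw)]:
  assumes [measurable]: "f \<in> borel_measurable M" "g \<in> measurable M P"
  shows "(\<lambda>z. r1 (f z) (g z)) \<in> borel_measurable M" "(\<lambda>z. r2 (f z) (g z)) \<in> borel_measurable M"
  using measurable_compose[of "\<lambda>z. (f z, g z)", OF _ r_measurable(1)]
    measurable_compose[of "\<lambda>z. (f z, g z)", OF _ r_measurable(2)] by simp_all

abbreviation "U \<equiv> time_measure T"
abbreviation "N \<equiv> lborel \<Otimes>\<^sub>M lborel \<Otimes>\<^sub>M P"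

sublocale U: finite_measure U by (rule finite_time_measure)

text \<open>
  The intersection local time with the Dirac function replaced by \<open>F\<close>. Extended nonnegative values
  allow all integrals to be interchanged without conditions.
\<close>

definition smear :: "(real \<Rightarrow> ennreal) \<Rightarrow> (real \<Rightarrow> ennreal) \<Rightarrow> real \<times> real \<times> 'w \<Rightarrow> ennreal" where
  "smear F \<psi> = (\<lambda>(x, y, \<omega>). \<integral>\<^sup>+u. \<integral>\<^sup>+v. F (y + r2 v \<omega> - (x + r1 u \<omega>)) * \<psi> (x + r1 u \<omega>) \<partial>U \<partial>U)"

lemma smear_measurable [measurable]:
  assumes [measurable]: "F \<in> borel_measurable borel" "\<psi> \<in> borel_measurable borel"
  shows "smear F \<psi> \<in> borel_measurable N"
  unfolding smear_def by measurable

definition contact :: "(real \<Rightarrow> ennreal) \<Rightarrow> (real \<Rightarrow> ennreal) \<Rightarrow> real \<Rightarrow> real \<Rightarrow> real \<times> real \<times> 'w \<Rightarrow> ennreal" where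
  "contact F \<psi> u v = (\<lambda>(x, y, \<omega>). F (y + r2 v \<omega> - (x + r1 u \<omega>)) * \<psi> (x + r1 u \<omega>))"

lemma contact_measurable [measurable (raw)]:
  assumes [measurable]: "F \<in> borel_measurable borel" "\<psi> \<in> borel_measurable borel"
    "f \<in> borel_measurable M" "g \<in> borel_measurable M" and k: "k \<in> measurable M N"
  shows "(\<lambda>s. contact F \<psi> (f s) (g s) (k s)) \<in> borel_measurable M"
proof -
  have [measurable]: "(\<lambda>s. fst (k s)) \<in> borel_measurable M" "(\<lambda>s. fst (snd (k s))) \<in> borel_measurable M"
    "(\<lambda>s. snd (snd (k s))) \<in> measurable M P"
    using measurable_compose[OF k measurable_fst]
      measurable_compose[OF measurable_compose[OF k measurable_snd] measurable_fst]
      measurable_compose[OF measurable_compose[OF k measurable_snd] measurable_snd] by simp_all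
  show ?thesis unfolding contact_def split_def by measurable
qed

lemma smear_mult_split:
  assumes [measurable]: "F \<in> borel_measurable borel" "F' \<in> borel_measurable borel" "\<psi> \<in> borel_measurable borel"
    and z: "z \<in> space N"
  shows "smear F \<psi> z * smear F' \<psi> z
      = (\<integral>\<^sup>+\<tau>. contact F \<psi> (fst (fst \<tau>)) (fst (snd \<tau>)) z * contact F' \<psi> (snd (fst \<tau>)) (snd (snd \<tau>)) z \<partial>((U \<Otimes>\<^sub>M U) \<Otimes>\<^sub>M (U \<Otimes>\<^sub>M U)))" (is "_ = ?R")
proof -
  interpret UU: pair_sigma_finite U U ..
  interpret U4: pair_sigma_finite "U \<Otimes>\<^sub>M U" "U \<Otimes>\<^sub>M U" ..
  let ?K = "\<lambda>F u v. contact F \<psi> u v z"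
  have [measurable]: "(\<lambda>s. ?K F (f s) (g s)) \<in> borel_measurable M"
    if "F \<in> borel_measurable borel" "f \<in> borel_measurable M" "g \<in> borel_measurable M"
    for F f g and M :: "'s measure"
    using that z by measurable
  have "?R = (\<integral>\<^sup>+a. \<integral>\<^sup>+b. ?K F (fst a) (fst b) * ?K F' (snd a) (snd b) \<partial>(U \<Otimes>\<^sub>M U) \<partial>(U \<Otimes>\<^sub>M U))"
    by (subst UU.P.nn_integral_fst[symmetric]) simp_all
  also have "\<dots> = (\<integral>\<^sup>+a. \<integral>\<^sup>+v. \<integral>\<^sup>+v'. ?K F (fst a) v * ?K F' (snd a) v' \<partial>U \<partial>U \<partial>(U \<Otimes>\<^sub>M U))"
    by (subst U.nn_integral_fst[symmetric]) simp_all
  also have "\<dots> = (\<integral>\<^sup>+u. \<integral>\<^sup>+u'. \<integral>\<^sup>+v. \<integral>\<^sup>+v'. ?K F u v * ?K F' u' v' \<partial>U \<partial>U \<partial>U \<partial>U)"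
    by (subst U.nn_integral_fst[symmetric]) simp_all
  also have "\<dots> = (\<integral>\<^sup>+u. \<integral>\<^sup>+u'. (\<integral>\<^sup>+v. ?K F u v \<partial>U) * (\<integral>\<^sup>+v'. ?K F' u' v' \<partial>U) \<partial>U \<partial>U)"
    by (simp add: nn_integral_cmult nn_integral_multc)
  also have "\<dots> = (\<integral>\<^sup>+u. \<integral>\<^sup>+v. ?K F u v \<partial>U \<partial>U) * (\<integral>\<^sup>+u'. \<integral>\<^sup>+v'. ?K F' u' v' \<partial>U \<partial>U)"
    by (simp add: nn_integral_cmult nn_integral_multc)
  finally show ?thesis by (simp add: smear_def contact_def split_def)
qed

lemma smear_add:
  assumes [measurable]: "F \<in> borel_measurable borel" "\<psi> \<in> borel_measurable borel" "\<psi>' \<in> borel_measurable borel"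
    and z: "z \<in> space N"
  shows "smear F (\<lambda>y. \<psi> y + \<psi>' y) z = smear F \<psi> z + smear F \<psi>' z"
proof -
  let ?K = "\<lambda>\<psi> u v. contact F \<psi> u v z"
  have [measurable]: "(\<lambda>s. ?K \<psi> (f s) (g s)) \<in> borel_measurable M"
    if "\<psi> \<in> borel_measurable borel" "f \<in> borel_measurable M" "g \<in> borel_measurable M"
    for \<psi> f g and M :: "'s measure"
    using that z by measurable
  have smear: "smear F \<psi> z = (\<integral>\<^sup>+u. \<integral>\<^sup>+v. ?K \<psi> u v \<partial>U \<partial>U)" for \<psi>
    by (simp add: smear_def contact_def split_def)
  have "?K (\<lambda>y. \<psi> y + \<psi>' y) u v = ?K \<psi> u v + ?K \<psi>' u v" for u v
    by (simp add: contact_def split_def distrib_left)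
  then have "smear F (\<lambda>y. \<psi> y + \<psi>' y) z = (\<integral>\<^sup>+u. \<integral>\<^sup>+v. ?K \<psi> u v + ?K \<psi>' u v \<partial>U \<partial>U)"
    by (simp add: smear)
  also have "\<dots> = (\<integral>\<^sup>+u. (\<integral>\<^sup>+v. ?K \<psi> u v \<partial>U) + (\<integral>\<^sup>+v. ?K \<psi>' u v \<partial>U) \<partial>U)"
    by (intro nn_integral_cong nn_integral_add) measurable
  also have "\<dots> = (\<integral>\<^sup>+u. \<integral>\<^sup>+v. ?K \<psi> u v \<partial>U \<partial>U) + (\<integral>\<^sup>+u. \<integral>\<^sup>+v. ?K \<psi>' u v \<partial>U \<partial>U)"
    by (rule nn_integral_add) measurable
  finally show ?thesis unfolding smear .
qed

text \<open>
  For fixed starting points the second moment is an integral over the two-dimensional marginal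
  laws of the two paths.
\<close>

lemma nn_integral_smear_square_path:
  assumes [measurable]: "F \<in> borel_measurable borel" "\<psi> \<in> borel_measurable borel"
  shows "(\<integral>\<^sup>+\<omega>. smear F \<psi> (x, y, \<omega>) * smear F \<psi> (x, y, \<omega>) \<partial>P)
    = (\<integral>\<^sup>+\<tau>. \<integral>\<^sup>+\<omega>. \<integral>\<^sup>+\<omega>'.
        (F (y + r2 (fst (snd \<tau>)) \<omega>' - (x + r1 (fst (fst \<tau>)) \<omega>)) * \<psi> (x + r1 (fst (fst \<tau>)) \<omega>))
        * (F (y + r2 (snd (snd \<tau>)) \<omega>' - (x + r1 (snd (fst \<tau>)) \<omega>)) * \<psi> (x + r1 (snd (fst \<tau>)) \<omega>))
        \<partial>P \<partial>P \<partial>((U \<Otimes>\<^sub>M U) \<Otimes>\<^sub>M (U \<Otimes>\<^sub>M U)))"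
proof -
  interpret UU: pair_sigma_finite U U ..
  interpret U4: pair_sigma_finite "U \<Otimes>\<^sub>M U" "U \<Otimes>\<^sub>M U" ..
  interpret UP: pair_sigma_finite "(U \<Otimes>\<^sub>M U) \<Otimes>\<^sub>M (U \<Otimes>\<^sub>M U)" P ..
  have "(\<integral>\<^sup>+\<omega>. smear F \<psi> (x, y, \<omega>) * smear F \<psi> (x, y, \<omega>) \<partial>P)
      = (\<integral>\<^sup>+\<omega>. \<integral>\<^sup>+\<tau>. contact F \<psi> (fst (fst \<tau>)) (fst (snd \<tau>)) (x, y, \<omega>) * contact F \<psi> (snd (fst \<tau>)) (snd (snd \<tau>)) (x, y, \<omega>)
          \<partial>((U \<Otimes>\<^sub>M U) \<Otimes>\<^sub>M (U \<Otimes>\<^sub>M U)) \<partial>P)"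
    by (intro nn_integral_cong smear_mult_split) (auto simp: space_pair_measure)
  also have "\<dots> = (\<integral>\<^sup>+\<tau>. \<integral>\<^sup>+\<omega>. contact F \<psi> (fst (fst \<tau>)) (fst (snd \<tau>)) (x, y, \<omega>) * contact F \<psi> (snd (fst \<tau>)) (snd (snd \<tau>)) (x, y, \<omega>)
          \<partial>P \<partial>((U \<Otimes>\<^sub>M U) \<Otimes>\<^sub>M (U \<Otimes>\<^sub>M U)))"
    by (rule UP.Fubini') simp
  also have "\<dots> = (\<integral>\<^sup>+\<tau>. \<integral>\<^sup>+\<omega>. \<integral>\<^sup>+\<omega>'.
        (F (y + r2 (fst (snd \<tau>)) \<omega>' - (x + r1 (fst (fst \<tau>)) \<omega>)) * \<psi> (x + r1 (fst (fst \<tau>)) \<omega>))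
        * (F (y + r2 (snd (snd \<tau>)) \<omega>' - (x + r1 (snd (fst \<tau>)) \<omega>)) * \<psi> (x + r1 (snd (fst \<tau>)) \<omega>))
        \<partial>P \<partial>P \<partial>((U \<Otimes>\<^sub>M U) \<Otimes>\<^sub>M (U \<Otimes>\<^sub>M U)))"
  proof (rule nn_integral_cong)
    fix \<tau> :: "(real \<times> real) \<times> (real \<times> real)"
    show "(\<integral>\<^sup>+\<omega>. contact F \<psi> (fst (fst \<tau>)) (fst (snd \<tau>)) (x, y, \<omega>) * contact F \<psi> (snd (fst \<tau>)) (snd (snd \<tau>)) (x, y, \<omega>) \<partial>P)
      = (\<integral>\<^sup>+\<omega>. \<integral>\<^sup>+\<omega>'.
        (F (y + r2 (fst (snd \<tau>)) \<omega>' - (x + r1 (fst (fst \<tau>)) \<omega>)) * \<psi> (x + r1 (fst (fst \<tau>)) \<omega>))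
        * (F (y + r2 (snd (snd \<tau>)) \<omega>' - (x + r1 (snd (fst \<tau>)) \<omega>)) * \<psi> (x + r1 (snd (fst \<tau>)) \<omega>)) \<partial>P \<partial>P)"
      using independent_paths[of "\<lambda>p. (F (y + fst (snd p) - (x + fst (fst p))) * \<psi> (x + fst (fst p)))
          * (F (y + snd (snd p) - (x + snd (fst p))) * \<psi> (x + snd (fst p)))" "fst (fst \<tau>)" "snd (fst \<tau>)" "fst (snd \<tau>)" "snd (snd \<tau>)"]
      by (simp add: contact_def)
  qed
  finally show ?thesis .
qed

text \<open>
  All four times, the two starting points and the path are integrated out in turn. What remains
  is a correlation of the density \<open>G\<close>, smeared by both mollifiers.
\<close>

lemma nn_integral_smear_mult:
  assumes [measurable]: "F \<in> borel_measurable borel" "F' \<in> borel_measurable borel" "\<psi> \<in> borel_measurable borel"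
  shows "(\<integral>\<^sup>+z. smear F \<psi> z * smear F' \<psi> z \<partial>N)
    = (\<integral>\<^sup>+w. F w * (\<integral>\<^sup>+w'. F' w' * (\<integral>\<^sup>+b. autocorrelation \<psi> b * G b * G (b + (w' - w)) \<partial>lborel) \<partial>lborel) \<partial>lborel)"
proof -
  interpret UU: pair_sigma_finite U U ..
  interpret LP: pair_sigma_finite lborel P ..
  interpret LLP: pair_sigma_finite lborel "lborel \<Otimes>\<^sub>M P" ..
  interpret U4: pair_sigma_finite "U \<Otimes>\<^sub>M U" "U \<Otimes>\<^sub>M U" ..
  interpret UN: pair_sigma_finite "(U \<Otimes>\<^sub>M U) \<Otimes>\<^sub>M (U \<Otimes>\<^sub>M U)" N ..
  interpret UP: pair_sigma_finite "U \<Otimes>\<^sub>M U" P ..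
  define \<phi> where "\<phi> c = (\<integral>\<^sup>+w. F w * F' (w + c) \<partial>lborel)" for c
  have [measurable]: "\<phi> \<in> borel_measurable borel" unfolding \<phi>_def[abs_def] by measurable
  define \<Phi> where "\<Phi> q = \<phi> (snd q - fst q) * autocorrelation \<psi> (fst q)" for q
  have [measurable]: "\<Phi> \<in> borel_measurable (borel \<Otimes>\<^sub>M borel)" unfolding \<Phi>_def[abs_def] by measurable
  have points: "(\<integral>\<^sup>+z. contact F \<psi> u v z * contact F' \<psi> u' v' z \<partial>N) = (\<integral>\<^sup>+\<omega>. \<integral>\<^sup>+\<omega>'. \<Phi> (r1 u' \<omega> - r1 u \<omega>, r2 v' \<omega>' - r2 v \<omega>') \<partial>P \<partial>P)"
    for u u' v v'
  proof -
    have "(\<integral>\<^sup>+z. contact F \<psi> u v z * contact F' \<psi> u' v' z \<partial>N)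
        = (\<integral>\<^sup>+x. \<integral>\<^sup>+q. contact F \<psi> u v (x, q) * contact F' \<psi> u' v' (x, q) \<partial>(lborel \<Otimes>\<^sub>M P) \<partial>lborel)"
      by (subst LP.P.nn_integral_fst[symmetric]) simp_all
    also have "\<dots> = (\<integral>\<^sup>+q. \<integral>\<^sup>+x. contact F \<psi> u v (x, q) * contact F' \<psi> u' v' (x, q) \<partial>lborel \<partial>(lborel \<Otimes>\<^sub>M P))"
      by (rule LLP.Fubini'[symmetric]) simp
    also have "\<dots> = (\<integral>\<^sup>+y. \<integral>\<^sup>+\<omega>. \<integral>\<^sup>+x. contact F \<psi> u v (x, y, \<omega>) * contact F' \<psi> u' v' (x, y, \<omega>) \<partial>lborel \<partial>P \<partial>lborel)"
      by (subst nn_integral_fst[symmetric]) simp_all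
    also have "\<dots> = (\<integral>\<^sup>+\<omega>. \<integral>\<^sup>+y. \<integral>\<^sup>+x. contact F \<psi> u v (x, y, \<omega>) * contact F' \<psi> u' v' (x, y, \<omega>) \<partial>lborel \<partial>lborel \<partial>P)"
      by (rule LP.Fubini'[symmetric]) simp
    also have "\<dots> = (\<integral>\<^sup>+\<omega>. \<Phi> (r1 u' \<omega> - r1 u \<omega>, r2 v' \<omega> - r2 v \<omega>) \<partial>P)"
      unfolding contact_def split_conv by (subst nn_integral_starting_points) (simp_all add: \<Phi>_def \<phi>_def)
    also have "\<dots> = (\<integral>\<^sup>+\<omega>. \<integral>\<^sup>+\<omega>'. \<Phi> (r1 u' \<omega> - r1 u \<omega>, r2 v' \<omega>' - r2 v \<omega>') \<partial>P \<partial>P)"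
      by (rule independent_increments) simp
    finally show ?thesis .
  qed
  have corr: "(\<integral>\<^sup>+c. G c * \<Phi> (b, c) \<partial>lborel)
      = autocorrelation \<psi> b * (\<integral>\<^sup>+w. F w * (\<integral>\<^sup>+w'. F' w' * G (b + (w' - w)) \<partial>lborel) \<partial>lborel)" for b
  proof -
    have "(\<integral>\<^sup>+c. G c * \<Phi> (b, c) \<partial>lborel) = (\<integral>\<^sup>+c. autocorrelation \<psi> b * (\<integral>\<^sup>+w. G c * (F w * F' (w + (c - b))) \<partial>lborel) \<partial>lborel)"
      unfolding \<Phi>_def \<phi>_def by (intro nn_integral_cong, subst nn_integral_cmult) (simp_all add: mult_ac)
    also have "\<dots> = autocorrelation \<psi> b * (\<integral>\<^sup>+c. \<integral>\<^sup>+w. G c * (F w * F' (w + (c - b))) \<partial>lborel \<partial>lborel)"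
      by (rule nn_integral_cmult) simp
    also have "(\<integral>\<^sup>+c. \<integral>\<^sup>+w. G c * (F w * F' (w + (c - b))) \<partial>lborel \<partial>lborel)
        = (\<integral>\<^sup>+w. \<integral>\<^sup>+c. G c * (F w * F' (w + (c - b))) \<partial>lborel \<partial>lborel)"
      by (rule lborel_pair.Fubini') simp
    also have "\<dots> = (\<integral>\<^sup>+w. F w * (\<integral>\<^sup>+c. F' (w + (c - b)) * G c \<partial>lborel) \<partial>lborel)"
      by (intro nn_integral_cong) (simp add: nn_integral_cmult[symmetric] mult_ac)
    also have "\<dots> = (\<integral>\<^sup>+w. F w * (\<integral>\<^sup>+w'. F' w' * G (b + (w' - w)) \<partial>lborel) \<partial>lborel)"
    proof -
      have "(\<integral>\<^sup>+c. F' (w + (c - b)) * G c \<partial>lborel) = (\<integral>\<^sup>+w'. F' w' * G (b + (w' - w)) \<partial>lborel)" for w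
        by (subst nn_integral_shift[where t = "b - w"]) (simp_all add: algebra_simps)
      then show ?thesis by simp
    qed
    finally show ?thesis .
  qed
  have "(\<integral>\<^sup>+z. smear F \<psi> z * smear F' \<psi> z \<partial>N)
      = (\<integral>\<^sup>+z. \<integral>\<^sup>+\<tau>. contact F \<psi> (fst (fst \<tau>)) (fst (snd \<tau>)) z * contact F' \<psi> (snd (fst \<tau>)) (snd (snd \<tau>)) z
          \<partial>((U \<Otimes>\<^sub>M U) \<Otimes>\<^sub>M (U \<Otimes>\<^sub>M U)) \<partial>N)"
    by (intro nn_integral_cong smear_mult_split) simp_all
  also have "\<dots> = (\<integral>\<^sup>+\<tau>. \<integral>\<^sup>+z. contact F \<psi> (fst (fst \<tau>)) (fst (snd \<tau>)) z * contact F' \<psi> (snd (fst \<tau>)) (snd (snd \<tau>)) z \<partial>N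
          \<partial>((U \<Otimes>\<^sub>M U) \<Otimes>\<^sub>M (U \<Otimes>\<^sub>M U)))"
    by (rule UN.Fubini') simp
  also have "\<dots> = (\<integral>\<^sup>+\<tau>. \<integral>\<^sup>+\<omega>. \<integral>\<^sup>+\<omega>'. \<Phi> (r1 (snd (fst \<tau>)) \<omega> - r1 (fst (fst \<tau>)) \<omega>, r2 (snd (snd \<tau>)) \<omega>' - r2 (fst (snd \<tau>)) \<omega>')
          \<partial>P \<partial>P \<partial>((U \<Otimes>\<^sub>M U) \<Otimes>\<^sub>M (U \<Otimes>\<^sub>M U)))"
    unfolding points ..
  also have "\<dots> = (\<integral>\<^sup>+a. \<integral>\<^sup>+b. \<integral>\<^sup>+\<omega>. \<integral>\<^sup>+\<omega>'. \<Phi> (r1 (snd a) \<omega> - r1 (fst a) \<omega>, r2 (snd b) \<omega>' - r2 (fst b) \<omega>')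
          \<partial>P \<partial>P \<partial>(U \<Otimes>\<^sub>M U) \<partial>(U \<Otimes>\<^sub>M U))"
    by (subst UU.P.nn_integral_fst[symmetric]) simp_all
  also have "\<dots> = (\<integral>\<^sup>+a. \<integral>\<^sup>+\<omega>. \<integral>\<^sup>+b. \<integral>\<^sup>+\<omega>'. \<Phi> (r1 (snd a) \<omega> - r1 (fst a) \<omega>, r2 (snd b) \<omega>' - r2 (fst b) \<omega>')
          \<partial>P \<partial>(U \<Otimes>\<^sub>M U) \<partial>P \<partial>(U \<Otimes>\<^sub>M U))"
    by (intro nn_integral_cong UP.Fubini'[symmetric]) simp
  also have "\<dots> = (\<integral>\<^sup>+a. \<integral>\<^sup>+\<omega>. \<integral>\<^sup>+v. \<integral>\<^sup>+v'. \<integral>\<^sup>+\<omega>'. \<Phi> (r1 (snd a) \<omega> - r1 (fst a) \<omega>, r2 v' \<omega>' - r2 v \<omega>')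
          \<partial>P \<partial>U \<partial>U \<partial>P \<partial>(U \<Otimes>\<^sub>M U))"
    by (intro nn_integral_cong, subst U.nn_integral_fst[symmetric]) simp_all
  also have "\<dots> = (\<integral>\<^sup>+a. \<integral>\<^sup>+\<omega>. \<integral>\<^sup>+c. G c * \<Phi> (r1 (snd a) \<omega> - r1 (fst a) \<omega>, c) \<partial>lborel \<partial>P \<partial>(U \<Otimes>\<^sub>M U))"
    by (intro nn_integral_cong occupation2) simp
  also have "\<dots> = (\<integral>\<^sup>+u. \<integral>\<^sup>+u'. \<integral>\<^sup>+\<omega>. \<integral>\<^sup>+c. G c * \<Phi> (r1 u' \<omega> - r1 u \<omega>, c) \<partial>lborel \<partial>P \<partial>U \<partial>U)"
    by (subst U.nn_integral_fst[symmetric]) simp_all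
  also have "\<dots> = (\<integral>\<^sup>+b. G b * (\<integral>\<^sup>+c. G c * \<Phi> (b, c) \<partial>lborel) \<partial>lborel)"
    by (rule occupation1) simp
  also have "\<dots> = (\<integral>\<^sup>+b. \<integral>\<^sup>+w. F w * (\<integral>\<^sup>+w'. F' w' * (autocorrelation \<psi> b * G b * G (b + (w' - w))) \<partial>lborel) \<partial>lborel \<partial>lborel)"
    unfolding corr by (intro nn_integral_cong) (simp add: nn_integral_cmult[symmetric] mult_ac)
  also have "\<dots> = (\<integral>\<^sup>+w. \<integral>\<^sup>+b. F w * (\<integral>\<^sup>+w'. F' w' * (autocorrelation \<psi> b * G b * G (b + (w' - w))) \<partial>lborel) \<partial>lborel \<partial>lborel)"
    by (rule lborel_pair.Fubini') simp
  also have "\<dots> = (\<integral>\<^sup>+w. F w * (\<integral>\<^sup>+b. \<integral>\<^sup>+w'. F' w' * (autocorrelation \<psi> b * G b * G (b + (w' - w))) \<partial>lborel \<partial>lborel) \<partial>lborel)"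
    by (intro nn_integral_cong nn_integral_cmult) simp
  also have "\<dots> = (\<integral>\<^sup>+w. F w * (\<integral>\<^sup>+w'. \<integral>\<^sup>+b. F' w' * (autocorrelation \<psi> b * G b * G (b + (w' - w))) \<partial>lborel \<partial>lborel) \<partial>lborel)"
    by (intro nn_integral_cong arg_cong2[where f = "(*)"] refl lborel_pair.Fubini') simp
  also have "\<dots> = (\<integral>\<^sup>+w. F w * (\<integral>\<^sup>+w'. F' w' * (\<integral>\<^sup>+b. autocorrelation \<psi> b * G b * G (b + (w' - w)) \<partial>lborel) \<partial>lborel) \<partial>lborel)"
    by (intro nn_integral_cong arg_cong2[where f = "(*)"] refl nn_integral_cmult) simp
  finally show ?thesis .
qed

end

section \<open>Existence of the intersection local time\<close>

lemma mollifierD: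
  assumes "f \<in> mollifiers"
  shows "f \<in> borel_measurable borel" "\<And>x. 0 \<le> f x" "\<exists>B. \<forall>x. f x \<le> B" "\<exists>R. \<forall>x. f x \<noteq> 0 \<longrightarrow> \<bar>x\<bar> \<le> R"
    "(\<integral>\<^sup>+x. ennreal (f x) \<partial>lborel) = 1"
proof -
  note m = assms[unfolded mollifiers_def mem_Collect_eq]
  note m' = m[THEN conjunct2, THEN conjunct2]
  have f: "0 \<le> f x" "(deriv ^^ n) f differentiable_on UNIV" "compact (closure {x. f x \<noteq> 0})" "(\<integral>x. f x \<partial>lborel) = 1" for x n
    by (rule spec[OF conjunct1[OF m]], rule spec[OF conjunct1[OF m']], rule m'[THEN conjunct2, THEN conjunct1],
        rule m'[THEN conjunct2, THEN conjunct2])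
  show "0 \<le> f x" for x by (rule f)
  have cont: "continuous_on UNIV f"
    using f(2)[of 0] by (simp add: differentiable_imp_continuous_on)
  then show "f \<in> borel_measurable borel" by (simp add: borel_measurable_continuous_onI)
  have "bounded (closure {x. f x \<noteq> 0})" using f(3) by (rule compact_imp_bounded)
  then show "\<exists>R. \<forall>x. f x \<noteq> 0 \<longrightarrow> \<bar>x\<bar> \<le> R"
  proof -
    assume "bounded (closure {x. f x \<noteq> 0})"
    then obtain R where R: "\<And>x. x \<in> closure {x. f x \<noteq> 0} \<Longrightarrow> norm x \<le> R"
      unfolding bounded_iff by metis
    have "\<bar>x\<bar> \<le> R" if "f x \<noteq> 0" for x
      using R[of x] subsetD[OF closure_subset[of "{x. f x \<noteq> 0}"], of x] that by simp
    then show ?thesis by metis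
  qed
  have "compact (f ` closure {x. f x \<noteq> 0})"
    by (rule compact_continuous_image[OF continuous_on_subset[OF cont] f(3)]) simp
  then have "bounded (f ` closure {x. f x \<noteq> 0})" by (rule compact_imp_bounded)
  then obtain B where B': "\<forall>y\<in>f ` closure {x. f x \<noteq> 0}. norm y \<le> B"
    unfolding bounded_iff by metis
  have B: "\<bar>f x\<bar> \<le> B" if "x \<in> closure {x. f x \<noteq> 0}" for x
    using bspec[OF B' imageI[OF that]] by simp
  have "f x \<le> max 0 B" for x
  proof (cases "f x = 0")
    case False
    then have "x \<in> closure {x. f x \<noteq> 0}"
      using subsetD[OF closure_subset[of "{x. f x \<noteq> 0}"], of x] by simp
    from B[OF this] show ?thesis by simp
  qed simp
  then show "\<exists>B. \<forall>x. f x \<le> B" by (intro exI[of _ "max 0 B"] allI)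
  have "integrable lborel f"
    using f(4) not_integrable_integral_eq[of lborel f] by (metis zero_neq_one)
  then have "(\<integral>\<^sup>+x. ennreal (f x) \<partial>lborel) = ennreal (\<integral>x. f x \<partial>lborel)"
    using f(1) by (intro nn_integral_eq_integral) auto
  then show "(\<integral>\<^sup>+x. ennreal (f x) \<partial>lborel) = 1"
    unfolding f(4) by simp
qed

lemma rescale_mollifier:
  assumes f: "f \<in> mollifiers" and \<epsilon>: "0 < \<epsilon>"
  shows "rescale f \<epsilon> \<in> borel_measurable borel" "0 \<le> rescale f \<epsilon> x" "\<exists>B. \<forall>x. rescale f \<epsilon> x \<le> B"
    "(\<integral>\<^sup>+x. ennreal (rescale f \<epsilon> x) \<partial>lborel) = 1"
proof -
  note [measurable] = mollifierD(1)[OF f]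
  show "rescale f \<epsilon> \<in> borel_measurable borel" unfolding rescale_def[abs_def] by measurable
  show "0 \<le> rescale f \<epsilon> x" using \<epsilon> mollifierD(2)[OF f] by (simp add: rescale_def)
  obtain B where "\<And>x. f x \<le> B" using mollifierD(3)[OF f] by auto
  then have "rescale f \<epsilon> x \<le> inverse \<epsilon> * B" for x
    using \<epsilon> by (simp add: rescale_def mult_left_mono)
  then show "\<exists>B. \<forall>x. rescale f \<epsilon> x \<le> B" by blast
  have "(\<integral>\<^sup>+x. ennreal (rescale f \<epsilon> x) \<partial>lborel)
      = ennreal \<bar>\<epsilon>\<bar> * (\<integral>\<^sup>+x. ennreal (inverse \<epsilon>) * ennreal (f x) \<partial>lborel)"
    using \<epsilon> mollifierD(2)[OF f] unfolding rescale_def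
    by (subst nn_integral_real_affine[where c = \<epsilon> and t = 0]) (auto simp: ennreal_mult)
  also have "\<dots> = ennreal (\<bar>\<epsilon>\<bar> * inverse \<epsilon>)"
    using \<epsilon> ennreal_mult[of "\<bar>\<epsilon>\<bar>" "inverse \<epsilon>"] by (simp add: nn_integral_cmult mollifierD(5)[OF f])
  finally show "(\<integral>\<^sup>+x. ennreal (rescale f \<epsilon> x) \<partial>lborel) = 1"
    using \<epsilon> by (simp only: abs_of_pos right_inverse order.strict_implies_not_eq[symmetric] ennreal_1) simp
qed

lemma rescale_mollifier_support:
  assumes f: "f \<in> mollifiers"
  shows "\<exists>R>0. \<forall>\<epsilon>>0. \<forall>x. rescale f \<epsilon> x \<noteq> 0 \<longrightarrow> \<bar>x\<bar> \<le> R * \<epsilon>"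
proof -
  obtain R where R: "\<And>x. f x \<noteq> 0 \<Longrightarrow> \<bar>x\<bar> \<le> R" using mollifierD(4)[OF f] by auto
  have "\<bar>x\<bar> \<le> max 1 R * \<epsilon>" if "0 < \<epsilon>" "rescale f \<epsilon> x \<noteq> 0" for \<epsilon> x
  proof -
    have "\<bar>x / \<epsilon>\<bar> \<le> R" using that R[of "x / \<epsilon>"] by (auto simp: rescale_def)
    then have "\<bar>x\<bar> \<le> R * \<epsilon>" using that by (simp add: abs_divide divide_le_eq)
    also have "\<dots> \<le> max 1 R * \<epsilon>" using that by (intro mult_right_mono) auto
    finally show ?thesis .
  qed
  then show ?thesis by (intro exI[of _ "max 1 R"]) auto
qed

text \<open>
  The integrand is bounded on the time square, hence integrable; so both integrals can be computed
  as nonnegative ones, in either order.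
\<close>

lemma ilt_approx_nn_integral:
  assumes f: "f \<in> mollifiers" and \<epsilon>: "0 < \<epsilon>" and A [measurable]: "A \<in> sets borel"
    and \<eta> [measurable]: "\<eta>1 \<in> borel_measurable borel" "\<eta>2 \<in> borel_measurable borel"
  shows "ennreal (ilt_approx f \<epsilon> T (indicator A) \<eta>1 \<eta>2)
      = (\<integral>\<^sup>+u. \<integral>\<^sup>+v. ennreal (rescale f \<epsilon> (\<eta>2 v - \<eta>1 u)) * indicator A (\<eta>1 u) \<partial>time_measure T \<partial>time_measure T)"
    and "0 \<le> ilt_approx f \<epsilon> T (indicator A) \<eta>1 \<eta>2"
proof -
  interpret U: finite_measure "time_measure T" by (rule finite_time_measure)
  interpret UU: pair_sigma_finite "time_measure T" "time_measure T" ..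
  note [measurable] = rescale_mollifier(1)[OF f \<epsilon>]
  obtain B where B: "\<And>x. rescale f \<epsilon> x \<le> B" using rescale_mollifier(3)[OF f \<epsilon>] by auto
  note r0 = rescale_mollifier(2)[OF f \<epsilon>]
  have B0: "0 \<le> B" using B[of 0] r0[of 0] by simp
  define k where "k v u = rescale f \<epsilon> (\<eta>2 v - \<eta>1 u) * indicator A (\<eta>1 u)" for v u
  have k: "0 \<le> k v u" "k v u \<le> B" for u v
    using r0 B B0 by (auto simp: k_def indicator_def)
  have [measurable]: "(\<lambda>z. k (g z) (h z)) \<in> borel_measurable L"
    if [measurable]: "g \<in> borel_measurable L" "h \<in> borel_measurable L" for g h and L :: "'s measure"
    unfolding k_def by measurable
  have int1: "integrable (time_measure T) (k v)" for v
    using k by (intro U.integrable_const_bound[where B = B]) auto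
  have bnd: "(\<integral>u. k v u \<partial>time_measure T) \<le> B * measure (time_measure T) UNIV" for v
  proof -
    have "(\<integral>u. k v u \<partial>time_measure T) \<le> (\<integral>u. B \<partial>time_measure T)"
      using k by (intro integral_mono int1) auto
    then show ?thesis by (simp add: mult.commute)
  qed
  have pos: "0 \<le> (\<integral>u. k v u \<partial>time_measure T)" for v
    using k by (simp add: Bochner_Integration.integral_nonneg)
  have int2: "integrable (time_measure T) (\<lambda>v. \<integral>u. k v u \<partial>time_measure T)"
    using bnd pos by (intro U.integrable_const_bound[where B = "B * measure (time_measure T) UNIV"]) auto
  have eq: "ilt_approx f \<epsilon> T (indicator A) \<eta>1 \<eta>2 = (\<integral>v. \<integral>u. k v u \<partial>time_measure T \<partial>time_measure T)"
  proof -
    have "(LINT u:{0..T}|lborel. rescale f \<epsilon> (\<eta>2 v - \<eta>1 u) * indicator A (\<eta>1 u)) = (\<integral>u. k v u \<partial>time_measure T)" for v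
      unfolding k_def[abs_def] by (subst integral_time_measure) simp_all
    then show ?thesis
      unfolding ilt_approx_def by (subst integral_time_measure) simp_all
  qed
  show "0 \<le> ilt_approx f \<epsilon> T (indicator A) \<eta>1 \<eta>2"
    unfolding eq using pos by (simp add: Bochner_Integration.integral_nonneg)
  have "ennreal (ilt_approx f \<epsilon> T (indicator A) \<eta>1 \<eta>2) = (\<integral>\<^sup>+v. \<integral>\<^sup>+u. ennreal (k v u) \<partial>time_measure T \<partial>time_measure T)"
    unfolding eq using k int1 int2 pos by (simp add: nn_integral_eq_integral)
  also have "\<dots> = (\<integral>\<^sup>+u. \<integral>\<^sup>+v. ennreal (k v u) \<partial>time_measure T \<partial>time_measure T)"
    by (rule UU.Fubini') simp
  finally show "ennreal (ilt_approx f \<epsilon> T (indicator A) \<eta>1 \<eta>2)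
      = (\<integral>\<^sup>+u. \<integral>\<^sup>+v. ennreal (rescale f \<epsilon> (\<eta>2 v - \<eta>1 u)) * indicator A (\<eta>1 u) \<partial>time_measure T \<partial>time_measure T)"
    by (simp add: k_def ennreal_mult r0 ennreal_indicator)
qed

lemma autocorrelation_indicator_le:
  assumes A [measurable]: "A \<in> sets borel" and sub: "A \<subseteq> {a..a + h}" and h: "0 \<le> h"
  shows "autocorrelation (indicator A) b \<le> ennreal h * indicator {-h..h} b"
proof (cases "\<bar>b\<bar> \<le> h")
  case True
  have "autocorrelation (indicator A) b \<le> (\<integral>\<^sup>+x. indicator {a..a + h} x \<partial>lborel)"
    unfolding autocorrelation_def using sub by (intro nn_integral_mono) (auto simp: indicator_def)
  then show ?thesis using True h by (simp add: abs_le_iff)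
next
  case False
  have "autocorrelation (indicator A) b = (\<integral>\<^sup>+x. 0 \<partial>(lborel :: real measure))"
    unfolding autocorrelation_def
  proof (rule nn_integral_cong)
    fix x
    have "\<not> (x \<in> A \<and> x + b \<in> A)"
    proof
      assume "x \<in> A \<and> x + b \<in> A"
      then have "x \<in> {a..a + h}" "x + b \<in> {a..a + h}" using sub by blast+
      then show False using False by (simp add: abs_le_iff)
    qed
    then show "indicator A x * indicator A (x + b) = (0 :: ennreal)" by (simp add: indicator_def)
  qed
  then show ?thesis by simp
qed

context path_pair
begin

definition approx_field :: "(real \<Rightarrow> real) \<Rightarrow> real set \<Rightarrow> real \<Rightarrow> real \<times> real \<times> 'w \<Rightarrow> real" where
  "approx_field f A \<epsilon> = (\<lambda>(x, y, \<omega>). ilt_approx f \<epsilon> T (indicator A) (\<lambda>u. x + r1 u \<omega>) (\<lambda>v. y + r2 v \<omega>))"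

lemma approx_field_smear:
  assumes f: "f \<in> mollifiers" and \<epsilon>: "0 < \<epsilon>" and A: "A \<in> sets borel" and z: "z \<in> space N"
  shows "ennreal (approx_field f A \<epsilon> z) = smear (rescale f \<epsilon>) (indicator A) z" "0 \<le> approx_field f A \<epsilon> z"
proof -
  obtain x y \<omega> where z': "z = (x, y, \<omega>)" "\<omega> \<in> space P" using z by (auto simp: space_pair_measure)
  note [measurable] = measurable_const[OF z'(2)]
  show "ennreal (approx_field f A \<epsilon> z) = smear (rescale f \<epsilon>) (indicator A) z"
    unfolding approx_field_def smear_def z' split_conv
    by (rule ilt_approx_nn_integral[OF f \<epsilon> A]) measurable
  show "0 \<le> approx_field f A \<epsilon> z"
    unfolding approx_field_def z' split_conv
    by (rule ilt_approx_nn_integral[OF f \<epsilon> A]) measurable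
qed

lemma approx_field_measurable:
  assumes f: "f \<in> mollifiers" and \<epsilon>: "0 < \<epsilon>" and A [measurable]: "A \<in> sets borel"
  shows "approx_field f A \<epsilon> \<in> borel_measurable N"
proof -
  note [measurable] = rescale_mollifier(1)[OF f \<epsilon>]
  have "(\<lambda>z. enn2real (smear (rescale f \<epsilon>) (indicator A) z)) \<in> borel_measurable N" by measurable
  moreover have "approx_field f A \<epsilon> z = enn2real (smear (rescale f \<epsilon>) (indicator A) z)" if "z \<in> space N" for z
    using approx_field_smear[OF f \<epsilon> A that] by (metis enn2real_ennreal)
  ultimately show ?thesis by (rule measurable_cong[THEN iffD2, rotated])
qed

context
  fixes A :: "real set" and a h :: real
  assumes A [measurable]: "A \<in> sets borel" and sub: "A \<subseteq> {a..a + h}" and h: "0 \<le> h"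
begin

definition overlap :: "real \<Rightarrow> real" where
  "overlap b = enn2real (autocorrelation (indicator A) b)"

lemma ennreal_overlap: "ennreal (overlap b) = autocorrelation (indicator A) b"
proof -
  have "autocorrelation (indicator A) b \<noteq> \<top>"
    using autocorrelation_indicator_le[OF A sub h, of b]
    by (cases "b \<in> {-h..h}") (auto simp: top_unique)
  then show ?thesis by (simp add: overlap_def ennreal_enn2real_if)
qed

lemma overlap_bounds: "0 \<le> overlap b" "overlap b \<le> h * indicator {-h..h} b" "overlap b \<le> h"
proof -
  show "0 \<le> overlap b" by (simp add: overlap_def)
  have "ennreal (overlap b) \<le> ennreal (h * indicator {-h..h} b)"
    using autocorrelation_indicator_le[OF A sub h, of b] h unfolding ennreal_overlap
    by (simp add: ennreal_mult ennreal_indicator)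
  then show *: "overlap b \<le> h * indicator {-h..h} b"
    using h by (subst (asm) ennreal_le_iff) auto
  then show "overlap b \<le> h" using h by (cases "b \<in> {-h..h}") simp_all
qed

lemma overlap_measurable [measurable]: "overlap \<in> borel_measurable borel"
  unfolding overlap_def[abs_def] by measurable

text \<open>
  The value at zero is the second moment of the limiting local time. The variable is the displacement
  between the arguments of the two mollifiers.
\<close>

definition energy :: "real \<Rightarrow> real" where
  "energy w = (\<integral>b. overlap b * G b * G (b + w) \<partial>lborel)"

lemma ennreal_energy: "(\<integral>\<^sup>+b. autocorrelation (indicator A) b * G b * G (b + w) \<partial>lborel) = ennreal (energy w)"
proof -
  have "integrable lborel (\<lambda>b. overlap b * G b * G (b + w))"
    by (rule integrable_weighted_correlation[OF G_measurable G_nonneg G_square overlap_measurable overlap_bounds(1,3)])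
  then have "(\<integral>\<^sup>+b. ennreal (overlap b * G b * G (b + w)) \<partial>lborel) = ennreal (energy w)"
    unfolding energy_def using overlap_bounds(1) G_nonneg by (intro nn_integral_eq_integral) auto
  then show ?thesis
    by (simp add: ennreal_overlap[symmetric] ennreal_mult overlap_bounds(1) G_nonneg)
qed

text \<open>
  The energy is continuous at zero, and mollifiers of small scale only see arguments near zero.
  So all correlations of approximations are close to one and the same number.
\<close>

lemma correlation_near_energy:
  assumes f: "f \<in> mollifiers" and g: "g \<in> mollifiers" and \<eta>: "0 < \<eta>"
  shows "\<exists>e>0. \<forall>\<epsilon> \<delta>. 0 < \<epsilon> \<and> \<epsilon> < e \<and> 0 < \<delta> \<and> \<delta> < e \<longrightarrow>
    (\<integral>\<^sup>+z. ennreal (approx_field f A \<epsilon> z * approx_field g A \<delta> z) \<partial>N) \<le> ennreal (energy 0 + \<eta>) \<and>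
    ennreal (energy 0 - \<eta>) \<le> (\<integral>\<^sup>+z. ennreal (approx_field f A \<epsilon> z * approx_field g A \<delta> z) \<partial>N)"
proof -
  have "isCont energy 0"
    unfolding energy_def[abs_def]
    by (rule isCont_weighted_correlation[OF G_measurable G_nonneg G_square overlap_measurable overlap_bounds(1,3) G_cont])
  then obtain d where d: "0 < d" "\<And>w. \<bar>w\<bar> < d \<Longrightarrow> \<bar>energy w - energy 0\<bar> < \<eta>"
    using \<eta> unfolding continuous_at_eps_delta by (auto simp: dist_real_def)
  obtain R S where R: "0 < R" "\<And>\<epsilon> x. 0 < \<epsilon> \<Longrightarrow> rescale f \<epsilon> x \<noteq> 0 \<Longrightarrow> \<bar>x\<bar> \<le> R * \<epsilon>"
    and S: "0 < S" "\<And>\<epsilon> x. 0 < \<epsilon> \<Longrightarrow> rescale g \<epsilon> x \<noteq> 0 \<Longrightarrow> \<bar>x\<bar> \<le> S * \<epsilon>"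
    using rescale_mollifier_support[OF f] rescale_mollifier_support[OF g] by metis
  define e where "e = d / (R + S)"
  have e: "0 < e" using d R S by (simp add: e_def)
  show ?thesis
  proof (intro exI[of _ e] conjI[OF e] allI impI)
    fix \<epsilon> \<delta> assume "0 < \<epsilon> \<and> \<epsilon> < e \<and> 0 < \<delta> \<and> \<delta> < e"
    then have \<epsilon>: "0 < \<epsilon>" "\<epsilon> < e" and \<delta>: "0 < \<delta>" "\<delta> < e" by auto
    note [measurable] = rescale_mollifier(1)[OF f \<epsilon>(1)] rescale_mollifier(1)[OF g \<delta>(1)]
    note f1 = rescale_mollifier(4)[OF f \<epsilon>(1)] and g1 = rescale_mollifier(4)[OF g \<delta>(1)]
    have near: "\<bar>energy (w' - w) - energy 0\<bar> < \<eta>" if "rescale f \<epsilon> w \<noteq> 0" "rescale g \<delta> w' \<noteq> 0" for w w'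
    proof (rule d(2))
      have "R * \<epsilon> + S * \<delta> < R * e + S * e" using R(1) S(1) \<epsilon> \<delta> by (intro add_strict_mono mult_strict_left_mono) auto
      also have "\<dots> = (R + S) * e" by (simp only: distrib_right)
      also have "\<dots> = d" using R(1) S(1) by (simp add: e_def)
      finally show "\<bar>w' - w\<bar> < d" using R(2)[OF \<epsilon>(1) that(1)] S(2)[OF \<delta>(1) that(2)] by linarith
    qed
    let ?I = "\<integral>\<^sup>+w. rescale f \<epsilon> w * (\<integral>\<^sup>+w'. rescale g \<delta> w' * ennreal (energy (w' - w)) \<partial>lborel) \<partial>lborel"
    have "(\<integral>\<^sup>+z. ennreal (approx_field f A \<epsilon> z * approx_field g A \<delta> z) \<partial>N)
        = (\<integral>\<^sup>+z. smear (rescale f \<epsilon>) (indicator A) z * smear (rescale g \<delta>) (indicator A) z \<partial>N)"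
      using approx_field_smear[OF f \<epsilon>(1) A] approx_field_smear[OF g \<delta>(1) A]
      by (intro nn_integral_cong) (simp add: ennreal_mult)
    also have "\<dots> = ?I"
      by (subst nn_integral_smear_mult) (simp_all add: ennreal_energy)
    finally have I: "(\<integral>\<^sup>+z. ennreal (approx_field f A \<epsilon> z * approx_field g A \<delta> z) \<partial>N) = ?I" .
    have const: "(\<integral>\<^sup>+w. rescale f \<epsilon> w * (\<integral>\<^sup>+w'. rescale g \<delta> w' * ennreal c \<partial>lborel) \<partial>lborel) = ennreal c" for c
      by (simp add: nn_integral_multc f1 g1)
    have "?I \<le> (\<integral>\<^sup>+w. rescale f \<epsilon> w * (\<integral>\<^sup>+w'. rescale g \<delta> w' * ennreal (energy 0 + \<eta>) \<partial>lborel) \<partial>lborel)"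
    proof (rule nn_integral_mono)
      fix w
      show "rescale f \<epsilon> w * (\<integral>\<^sup>+w'. rescale g \<delta> w' * ennreal (energy (w' - w)) \<partial>lborel)
        \<le> rescale f \<epsilon> w * (\<integral>\<^sup>+w'. rescale g \<delta> w' * ennreal (energy 0 + \<eta>) \<partial>lborel)"
      proof (cases "rescale f \<epsilon> w = 0")
        case False
        have "(\<integral>\<^sup>+w'. rescale g \<delta> w' * ennreal (energy (w' - w)) \<partial>lborel)
            \<le> (\<integral>\<^sup>+w'. rescale g \<delta> w' * ennreal (energy 0 + \<eta>) \<partial>lborel)"
        proof (rule nn_integral_mono)
          fix w'
          show "rescale g \<delta> w' * ennreal (energy (w' - w)) \<le> rescale g \<delta> w' * ennreal (energy 0 + \<eta>)"
          proof (cases "rescale g \<delta> w' = 0")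
            case F: False
            from near[OF False this] have "energy (w' - w) \<le> energy 0 + \<eta>" by linarith
            then show ?thesis by (intro mult_left_mono ennreal_leI) auto
          qed simp
        qed
        then show ?thesis by (intro mult_left_mono) auto
      qed simp
    qed
    moreover have "(\<integral>\<^sup>+w. rescale f \<epsilon> w * (\<integral>\<^sup>+w'. rescale g \<delta> w' * ennreal (energy 0 - \<eta>) \<partial>lborel) \<partial>lborel) \<le> ?I"
    proof (rule nn_integral_mono)
      fix w
      show "rescale f \<epsilon> w * (\<integral>\<^sup>+w'. rescale g \<delta> w' * ennreal (energy 0 - \<eta>) \<partial>lborel)
        \<le> rescale f \<epsilon> w * (\<integral>\<^sup>+w'. rescale g \<delta> w' * ennreal (energy (w' - w)) \<partial>lborel)"
      proof (cases "rescale f \<epsilon> w = 0")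
        case False
        have "(\<integral>\<^sup>+w'. rescale g \<delta> w' * ennreal (energy 0 - \<eta>) \<partial>lborel)
            \<le> (\<integral>\<^sup>+w'. rescale g \<delta> w' * ennreal (energy (w' - w)) \<partial>lborel)"
        proof (rule nn_integral_mono)
          fix w'
          show "rescale g \<delta> w' * ennreal (energy 0 - \<eta>) \<le> rescale g \<delta> w' * ennreal (energy (w' - w))"
          proof (cases "rescale g \<delta> w' = 0")
            case F: False
            from near[OF False this] have "energy 0 - \<eta> \<le> energy (w' - w)" by linarith
            then show ?thesis by (intro mult_left_mono ennreal_leI) auto
          qed simp
        qed
        then show ?thesis by (intro mult_left_mono) auto
      qed simp
    qed
    ultimately show "(\<integral>\<^sup>+z. ennreal (approx_field f A \<epsilon> z * approx_field g A \<delta> z) \<partial>N) \<le> ennreal (energy 0 + \<eta>) \<and>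
      ennreal (energy 0 - \<eta>) \<le> (\<integral>\<^sup>+z. ennreal (approx_field f A \<epsilon> z * approx_field g A \<delta> z) \<partial>N)"
      unfolding I const by simp
  qed
qed

lemma energy_nonneg: "0 \<le> energy w"
  unfolding energy_def using overlap_bounds(1) G_nonneg by (intro Bochner_Integration.integral_nonneg) auto

lemma eventually_small: "0 < e \<Longrightarrow> \<forall>\<^sub>F \<epsilon> in at_right 0. 0 < \<epsilon> \<and> \<epsilon> < (e::real)"
  by (auto simp: eventually_at_right_field)

lemma approx_field_square_integrable:
  assumes f: "f \<in> mollifiers"
  shows "\<exists>e>0. \<forall>\<epsilon>. 0 < \<epsilon> \<and> \<epsilon> < e \<longrightarrow> square_integrable N (approx_field f A \<epsilon>)"
proof -
  obtain e where e: "0 < e" "\<And>\<epsilon>. 0 < \<epsilon> \<Longrightarrow> \<epsilon> < e \<Longrightarrow>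
      (\<integral>\<^sup>+z. ennreal (approx_field f A \<epsilon> z * approx_field f A \<epsilon> z) \<partial>N) \<le> ennreal (energy 0 + 1)"
    using correlation_near_energy[OF f f, of 1] by auto
  have "square_integrable N (approx_field f A \<epsilon>)" if "0 < \<epsilon>" "\<epsilon> < e" for \<epsilon>
    using e(2)[OF that] approx_field_measurable[OF f that(1) A]
    by (intro square_integrable_nn) (auto simp: power2_eq_square intro: order.strict_trans1)
  with e(1) show ?thesis by blast
qed

lemma eventually_approx_field_square_integrable:
  assumes f: "f \<in> mollifiers"
  shows "\<forall>\<^sub>F \<epsilon> in at_right 0. square_integrable N (approx_field f A \<epsilon>)"
proof -
  obtain e where e: "0 < e" "\<And>\<epsilon>. 0 < \<epsilon> \<Longrightarrow> \<epsilon> < e \<Longrightarrow> square_integrable N (approx_field f A \<epsilon>)"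
    using approx_field_square_integrable[OF f] by auto
  show ?thesis
    using eventually_small[OF e(1)] by eventually_elim (use e(2) in auto)
qed

lemma correlation_near_energy_real:
  assumes f: "f \<in> mollifiers" and g: "g \<in> mollifiers" and \<eta>: "0 < \<eta>"
  shows "\<exists>e>0. \<forall>\<epsilon> \<delta>. 0 < \<epsilon> \<and> \<epsilon> < e \<and> 0 < \<delta> \<and> \<delta> < e \<longrightarrow>
    square_integrable N (approx_field f A \<epsilon>) \<and> square_integrable N (approx_field g A \<delta>) \<and>
    \<bar>(\<integral>z. approx_field f A \<epsilon> z * approx_field g A \<delta> z \<partial>N) - energy 0\<bar> \<le> \<eta>"
proof -
  obtain e where e: "0 < e" "\<And>\<epsilon> \<delta>. 0 < \<epsilon> \<Longrightarrow> \<epsilon> < e \<Longrightarrow> 0 < \<delta> \<Longrightarrow> \<delta> < e \<Longrightarrow>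
      (\<integral>\<^sup>+z. ennreal (approx_field f A \<epsilon> z * approx_field g A \<delta> z) \<partial>N) \<le> ennreal (energy 0 + \<eta>) \<and>
      ennreal (energy 0 - \<eta>) \<le> (\<integral>\<^sup>+z. ennreal (approx_field f A \<epsilon> z * approx_field g A \<delta> z) \<partial>N)"
    using correlation_near_energy[OF f g \<eta>] by auto
  obtain e1 where e1: "0 < e1" "\<And>\<epsilon>. 0 < \<epsilon> \<Longrightarrow> \<epsilon> < e1 \<Longrightarrow> square_integrable N (approx_field f A \<epsilon>)"
    using approx_field_square_integrable[OF f] by auto
  obtain e2 where e2: "0 < e2" "\<And>\<epsilon>. 0 < \<epsilon> \<Longrightarrow> \<epsilon> < e2 \<Longrightarrow> square_integrable N (approx_field g A \<epsilon>)"
    using approx_field_square_integrable[OF g] by auto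
  show ?thesis
  proof (intro exI[of _ "min e (min e1 e2)"] conjI allI impI)
    show "0 < min e (min e1 e2)" using e(1) e1(1) e2(1) by simp
    fix \<epsilon> \<delta> assume *: "0 < \<epsilon> \<and> \<epsilon> < min e (min e1 e2) \<and> 0 < \<delta> \<and> \<delta> < min e (min e1 e2)"
    show sq: "square_integrable N (approx_field f A \<epsilon>)" "square_integrable N (approx_field g A \<delta>)"
      using * e1 e2 by auto
    have "integrable N (\<lambda>z. approx_field f A \<epsilon> z * approx_field g A \<delta> z)"
      by (rule square_integrable_mult[OF sq])
    moreover have nonneg: "0 \<le> approx_field f A \<epsilon> z * approx_field g A \<delta> z" if "z \<in> space N" for z
      using approx_field_smear(2)[OF f _ A that, of \<epsilon>] approx_field_smear(2)[OF g _ A that, of \<delta>] * by simp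
    ultimately have eq: "(\<integral>\<^sup>+z. ennreal (approx_field f A \<epsilon> z * approx_field g A \<delta> z) \<partial>N)
        = ennreal (\<integral>z. approx_field f A \<epsilon> z * approx_field g A \<delta> z \<partial>N)"
      by (intro nn_integral_eq_integral AE_I2) auto
    have "0 \<le> (\<integral>z. approx_field f A \<epsilon> z * approx_field g A \<delta> z \<partial>N)"
      using nonneg by (intro Bochner_Integration.integral_nonneg_AE AE_I2)
    then obtain I where I: "(\<integral>z. approx_field f A \<epsilon> z * approx_field g A \<delta> z \<partial>N) = I" "0 \<le> I" by blast
    have "ennreal I \<le> ennreal (energy 0 + \<eta>) \<and> ennreal (energy 0 - \<eta>) \<le> ennreal I"
      using e(2)[of \<epsilon> \<delta>] * unfolding eq I(1) by simp
    then have "I \<le> energy 0 + \<eta>" "energy 0 - \<eta> \<le> I"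
      using ennreal_le_iff[of "energy 0 + \<eta>" I] ennreal_le_iff[OF I(2), of "energy 0 - \<eta>"] energy_nonneg[of 0] \<eta> by simp_all
    then show "\<bar>(\<integral>z. approx_field f A \<epsilon> z * approx_field g A \<delta> z \<partial>N) - energy 0\<bar> \<le> \<eta>"
      unfolding I(1) by linarith
  qed
qed

lemma approx_field_energy:
  assumes f: "f \<in> mollifiers"
  shows "((\<lambda>\<epsilon>. \<integral>z. (approx_field f A \<epsilon> z)\<^sup>2 \<partial>N) \<longlongrightarrow> energy 0) (at_right 0)"
proof (rule tendstoI)
  fix \<eta> :: real assume "0 < \<eta>"
  then obtain e where e: "0 < e" "\<And>\<epsilon>. 0 < \<epsilon> \<Longrightarrow> \<epsilon> < e \<Longrightarrow>
      \<bar>(\<integral>z. approx_field f A \<epsilon> z * approx_field f A \<epsilon> z \<partial>N) - energy 0\<bar> \<le> \<eta> / 2"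
    using correlation_near_energy_real[OF f f, of "\<eta> / 2"] by auto
  show "\<forall>\<^sub>F \<epsilon> in at_right 0. dist (\<integral>z. (approx_field f A \<epsilon> z)\<^sup>2 \<partial>N) (energy 0) < \<eta>"
    using eventually_small[OF e(1)]
  proof eventually_elim
    case (elim \<epsilon>)
    then show ?case using e(2)[of \<epsilon>] \<open>0 < \<eta>\<close> by (simp add: dist_real_def power2_eq_square)
  qed
qed

text \<open>
  Expanding the square leaves three correlations, all close to the energy at zero.
\<close>

lemma approx_field_cauchy:
  assumes f: "f \<in> mollifiers" and g: "g \<in> mollifiers" and \<eta>: "0 < \<eta>"
  shows "\<exists>e>0. \<forall>\<epsilon> \<delta>. 0 < \<epsilon> \<and> \<epsilon> < e \<and> 0 < \<delta> \<and> \<delta> < e \<longrightarrow>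
    square_integrable N (approx_field f A \<epsilon>) \<and> square_integrable N (approx_field g A \<delta>) \<and>
    (\<integral>z. (approx_field f A \<epsilon> z - approx_field g A \<delta> z)\<^sup>2 \<partial>N) \<le> \<eta>"
proof -
  let ?X = "approx_field f A" and ?Y = "approx_field g A"
  have \<eta>4: "0 < \<eta> / 4" using \<eta> by simp
  obtain e1 where e1: "0 < e1" "\<And>\<epsilon> \<delta>. 0 < \<epsilon> \<Longrightarrow> \<epsilon> < e1 \<Longrightarrow> 0 < \<delta> \<Longrightarrow> \<delta> < e1 \<Longrightarrow>
      square_integrable N (?X \<epsilon>) \<and> square_integrable N (?Y \<delta>) \<and> \<bar>(\<integral>z. ?X \<epsilon> z * ?Y \<delta> z \<partial>N) - energy 0\<bar> \<le> \<eta> / 4"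
    using correlation_near_energy_real[OF f g \<eta>4] by auto
  obtain e2 where e2: "0 < e2" "\<And>\<epsilon>. 0 < \<epsilon> \<Longrightarrow> \<epsilon> < e2 \<Longrightarrow> \<bar>(\<integral>z. ?X \<epsilon> z * ?X \<epsilon> z \<partial>N) - energy 0\<bar> \<le> \<eta> / 4"
    using correlation_near_energy_real[OF f f \<eta>4] by auto
  obtain e3 where e3: "0 < e3" "\<And>\<epsilon>. 0 < \<epsilon> \<Longrightarrow> \<epsilon> < e3 \<Longrightarrow> \<bar>(\<integral>z. ?Y \<epsilon> z * ?Y \<epsilon> z \<partial>N) - energy 0\<bar> \<le> \<eta> / 4"
    using correlation_near_energy_real[OF g g \<eta>4] by auto
  show ?thesis
  proof (intro exI[of _ "min e1 (min e2 e3)"] conjI allI impI)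
    show "0 < min e1 (min e2 e3)" using e1(1) e2(1) e3(1) by simp
    fix \<epsilon> \<delta> assume *: "0 < \<epsilon> \<and> \<epsilon> < min e1 (min e2 e3) \<and> 0 < \<delta> \<and> \<delta> < min e1 (min e2 e3)"
    show sq: "square_integrable N (?X \<epsilon>)" "square_integrable N (?Y \<delta>)"
      using * e1(2)[of \<epsilon> \<delta>] by auto
    note i = square_integrable_mult[OF sq(1) sq(1)] square_integrable_mult[OF sq] square_integrable_mult[OF sq(2) sq(2)]
    have "(\<integral>z. (?X \<epsilon> z - ?Y \<delta> z)\<^sup>2 \<partial>N)
        = (\<integral>z. ?X \<epsilon> z * ?X \<epsilon> z - 2 * (?X \<epsilon> z * ?Y \<delta> z) + ?Y \<delta> z * ?Y \<delta> z \<partial>N)"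
      by (intro Bochner_Integration.integral_cong) (auto simp: power2_eq_square algebra_simps)
    also have "\<dots> = (\<integral>z. ?X \<epsilon> z * ?X \<epsilon> z \<partial>N) - 2 * (\<integral>z. ?X \<epsilon> z * ?Y \<delta> z \<partial>N) + (\<integral>z. ?Y \<delta> z * ?Y \<delta> z \<partial>N)"
      using i by simp
    also have "\<dots> \<le> \<eta>"
      using e1(2)[of \<epsilon> \<delta>] e2(2)[of \<epsilon>] e3(2)[of \<delta>] * unfolding abs_le_iff by simp
    finally show "(\<integral>z. (?X \<epsilon> z - ?Y \<delta> z)\<^sup>2 \<partial>N) \<le> \<eta>" .
  qed
qed

text \<open>
  Comparing the approximations from two different mollifiers by the same estimate shows that the
  limit does not depend on the mollifier.
\<close>

lemma approx_field_converges:
  assumes f0: "f0 \<in> mollifiers"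
  shows "\<exists>L. \<forall>f\<in>mollifiers. L2_tendsto N (approx_field f A) L (at_right 0)"
proof -
  have "\<exists>L. L2_tendsto N (approx_field f0 A) L (at_right 0)"
  proof (rule L2_complete)
    show "\<forall>\<^sub>F \<epsilon> in at_right 0. square_integrable N (approx_field f0 A \<epsilon>)"
      by (rule eventually_approx_field_square_integrable[OF f0])
    fix \<eta> :: real assume "0 < \<eta>"
    then obtain e where "0 < e" "\<And>\<epsilon> \<delta>. 0 < \<epsilon> \<Longrightarrow> \<epsilon> < e \<Longrightarrow> 0 < \<delta> \<Longrightarrow> \<delta> < e \<Longrightarrow>
        (\<integral>z. (approx_field f0 A \<epsilon> z - approx_field f0 A \<delta> z)\<^sup>2 \<partial>N) \<le> \<eta>"
      using approx_field_cauchy[OF f0 f0 \<open>0 < \<eta>\<close>] by auto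
    then show "\<exists>Q. eventually Q (at_right 0) \<and> (\<forall>\<epsilon> \<delta>. Q \<epsilon> \<longrightarrow> Q \<delta> \<longrightarrow>
        (\<integral>z. (approx_field f0 A \<epsilon> z - approx_field f0 A \<delta> z)\<^sup>2 \<partial>N) \<le> \<eta>)"
      using eventually_small[of e] by (intro exI[of _ "\<lambda>\<epsilon>. 0 < \<epsilon> \<and> \<epsilon> < e"]) auto
  qed simp
  then obtain L where L: "L2_tendsto N (approx_field f0 A) L (at_right 0)" by blast
  have "L2_tendsto N (approx_field f A) L (at_right 0)" if f: "f \<in> mollifiers" for f
    unfolding L2_tendsto_def
  proof (intro conjI)
    show sqL: "square_integrable N L" using L by (simp add: L2_tendsto_def)
    show ev: "\<forall>\<^sub>F \<epsilon> in at_right 0. square_integrable N (approx_field f A \<epsilon>)"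
      by (rule eventually_approx_field_square_integrable[OF f])
    show "((\<lambda>\<epsilon>. \<integral>z. (approx_field f A \<epsilon> z - L z)\<^sup>2 \<partial>N) \<longlongrightarrow> 0) (at_right 0)"
    proof (rule tendstoI)
      fix \<eta> :: real assume \<eta>: "0 < \<eta>"
      obtain e where e: "0 < e" "\<And>\<epsilon> \<delta>. 0 < \<epsilon> \<Longrightarrow> \<epsilon> < e \<Longrightarrow> 0 < \<delta> \<Longrightarrow> \<delta> < e \<Longrightarrow>
          square_integrable N (approx_field f A \<epsilon>) \<and> square_integrable N (approx_field f0 A \<delta>) \<and>
          (\<integral>z. (approx_field f A \<epsilon> z - approx_field f0 A \<delta> z)\<^sup>2 \<partial>N) \<le> \<eta> / 8"
        using approx_field_cauchy[OF f f0, of "\<eta> / 8"] \<eta> by auto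
      have "\<forall>\<^sub>F \<epsilon> in at_right 0. (\<integral>z. (approx_field f0 A \<epsilon> z - L z)\<^sup>2 \<partial>N) < \<eta> / 8"
        using L \<eta> unfolding L2_tendsto_def by (intro order_tendstoD(2)[where y = 0]) auto
      with eventually_small[OF e(1)]
      show "\<forall>\<^sub>F \<epsilon> in at_right 0. dist (\<integral>z. (approx_field f A \<epsilon> z - L z)\<^sup>2 \<partial>N) 0 < \<eta>"
      proof eventually_elim
        case (elim \<epsilon>)
        have "(\<integral>z. (approx_field f A \<epsilon> z - L z)\<^sup>2 \<partial>N)
            \<le> 2 * (\<integral>z. (approx_field f A \<epsilon> z - approx_field f0 A \<epsilon> z)\<^sup>2 \<partial>N) + 2 * (\<integral>z. (approx_field f0 A \<epsilon> z - L z)\<^sup>2 \<partial>N)"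
          using e(2)[of \<epsilon> \<epsilon>] elim sqL by (intro integral_power2_diff_le) auto
        also have "\<dots> < \<eta>" using e(2)[of \<epsilon> \<epsilon>] elim \<eta> by auto
        finally show ?case by (simp add: Bochner_Integration.integral_nonneg)
      qed
    qed
  qed
  then show ?thesis by blast
qed

text \<open>
  The function \<open>\<bar>b\<bar>\<^sup>2\<^sup>\<alpha>\<^sup>-\<^sup>2\<close> is integrable over \<open>[-h, h]\<close> because \<open>\<alpha> > 1/2\<close>, with an integral of order
  \<open>h\<^sup>2\<^sup>\<alpha>\<^sup>-\<^sup>1\<close>; the overlap of the test set with its translates contributes another factor \<open>h\<close>.
\<close>

lemma energy_le:
  assumes \<alpha>: "1 / 2 < \<alpha>" and C: "\<And>b. G b \<le> C * \<bar>b\<bar> powr (\<alpha> - 1)" "0 \<le> C"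
  shows "energy 0 \<le> 2 * C\<^sup>2 / (2 * \<alpha> - 1) * h powr (2 * \<alpha>)"
proof -
  have "ennreal (energy 0) = (\<integral>\<^sup>+b. autocorrelation (indicator A) b * G b * G (b + 0) \<partial>lborel)"
    by (rule ennreal_energy[symmetric])
  also have "\<dots> \<le> (\<integral>\<^sup>+b. ennreal (h * C\<^sup>2) * (ennreal (\<bar>b\<bar> powr ((2 * \<alpha> - 1) - 1)) * indicator {-h..h} b) \<partial>lborel)"
  proof (rule nn_integral_mono)
    fix b
    define p where "p = \<bar>b\<bar> powr ((2 * \<alpha> - 1) - 1)"
    have p: "0 \<le> p" by (simp add: p_def)
    have "(\<bar>b\<bar> powr (\<alpha> - 1))\<^sup>2 = p"
      by (simp add: p_def power2_eq_square powr_add[symmetric])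
    moreover have "(G b)\<^sup>2 \<le> (C * \<bar>b\<bar> powr (\<alpha> - 1))\<^sup>2" using C G_nonneg by (intro power_mono)
    ultimately have "(G b)\<^sup>2 \<le> C\<^sup>2 * p" by (simp only: power_mult_distrib)
    then have "overlap b * (G b)\<^sup>2 \<le> (h * indicator {-h..h} b) * (C\<^sup>2 * p)"
      using overlap_bounds(1,2)[of b] h p by (intro mult_mono) auto
    also have "\<dots> = (h * C\<^sup>2) * (p * indicator {-h..h} b)"
      by (simp only: mult_ac)
    finally have "ennreal (overlap b * (G b)\<^sup>2) \<le> ennreal ((h * C\<^sup>2) * (p * indicator {-h..h} b))"
      by (rule ennreal_leI)
    also have "\<dots> = ennreal (h * C\<^sup>2) * (ennreal p * indicator {-h..h} b)"
      using h p by (subst ennreal_mult) (auto simp: ennreal_mult'' ennreal_indicator)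
    finally have le: "ennreal (overlap b * (G b)\<^sup>2) \<le> ennreal (h * C\<^sup>2) * (ennreal p * indicator {-h..h} b)" .
    have "autocorrelation (indicator A) b * G b * G (b + 0) = ennreal (overlap b * (G b)\<^sup>2)"
      by (simp only: ennreal_overlap[symmetric] add_0_right power2_eq_square mult.assoc
          ennreal_mult' overlap_bounds(1) G_nonneg mult_nonneg_nonneg)
    then show "autocorrelation (indicator A) b * G b * G (b + 0)
        \<le> ennreal (h * C\<^sup>2) * (ennreal (\<bar>b\<bar> powr ((2 * \<alpha> - 1) - 1)) * indicator {-h..h} b)"
      using le unfolding p_def by simp
  qed
  also have "\<dots> = ennreal (h * C\<^sup>2) * (\<integral>\<^sup>+b. ennreal (\<bar>b\<bar> powr ((2 * \<alpha> - 1) - 1)) * indicator {-h..h} b \<partial>lborel)"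
    by (rule nn_integral_cmult) simp
  also have "\<dots> \<le> ennreal (h * C\<^sup>2) * ennreal (2 * h powr (2 * \<alpha> - 1) / (2 * \<alpha> - 1))"
    using \<alpha> h by (intro mult_left_mono nn_integral_abs_powr_le) auto
  also have "\<dots> = ennreal (2 * C\<^sup>2 / (2 * \<alpha> - 1) * (h * h powr (2 * \<alpha> - 1)))"
    using h \<alpha> by (subst ennreal_mult[symmetric]) (auto simp: mult_ac)
  also have "h * h powr (2 * \<alpha> - 1) = h powr (2 * \<alpha>)"
    using h \<alpha> by (simp add: powr_mult_base)
  finally show ?thesis
    using h \<alpha> by (subst (asm) ennreal_le_iff) auto
qed

end

end

section \<open>Existence of a mollifier\<close>

text \<open>
  The functions \<open>p(1/x) e\<^sup>-\<^sup>1\<^sup>/\<^sup>x\<close> on the positive half-line, extended by zero, form a family that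
  is closed under differentiation; hence all of them are smooth.
\<close>

definition flat :: "real poly \<Rightarrow> real \<Rightarrow> real" where
  "flat p x = (if 0 < x then poly p (inverse x) * exp (- inverse x) else 0)"

lemma poly_times_exp_minus_tendsto_0:
  "((\<lambda>t. poly p t * exp (- t)) \<longlongrightarrow> 0) (at_top :: real filter)"
proof -
  have "((\<lambda>t. \<Sum>i\<le>degree p. coeff p i * (t ^ i / exp t)) \<longlongrightarrow> (\<Sum>i\<le>degree p. coeff p i * 0)) at_top"
    by (intro tendsto_sum tendsto_mult tendsto_const tendsto_power_div_exp_0)
  then show ?thesis
    by (simp add: poly_altdef sum_distrib_right exp_minus divide_inverse mult.assoc)
qed

lemma flat_has_derivative:
  "(flat p has_real_derivative flat ([:0, 0, 1:] * (p - pderiv p)) x) (at x)"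
proof -
  consider "0 < x" | "x < 0" | "x = 0" by linarith
  then show ?thesis
  proof cases
    case 1
    have "((\<lambda>x. poly p (inverse x) * exp (- inverse x)) has_real_derivative
        flat ([:0, 0, 1:] * (p - pderiv p)) x) (at x)"
    proof -
      have i: "(inverse has_real_derivative - ((inverse x)\<^sup>2)) (at x)"
        using DERIV_inverse[of x UNIV] 1 by (simp add: numeral_2_eq_2)
      have "((\<lambda>x. poly p (inverse x) * exp (- inverse x)) has_real_derivative
          poly (pderiv p) (inverse x) * - ((inverse x)\<^sup>2) * exp (- inverse x)
          + exp (- inverse x) * - (- ((inverse x)\<^sup>2)) * poly p (inverse x)) (at x)"
        by (rule DERIV_mult[OF DERIV_chain2[OF poly_DERIV i] DERIV_chain2[OF DERIV_exp DERIV_minus[OF i]]])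
      also have "poly (pderiv p) (inverse x) * - ((inverse x)\<^sup>2) * exp (- inverse x)
          + exp (- inverse x) * - (- ((inverse x)\<^sup>2)) * poly p (inverse x)
          = flat ([:0, 0, 1:] * (p - pderiv p)) x"
        using 1 by (simp add: flat_def power2_eq_square algebra_simps)
      finally show ?thesis .
    qed
    moreover have "\<forall>\<^sub>F y in nhds x. flat p y = poly p (inverse y) * exp (- inverse y)"
      using eventually_nhds_in_open[of "{0<..}" x] 1 by (auto elim!: eventually_mono simp: flat_def)
    ultimately show ?thesis by (subst DERIV_cong_ev) auto
  next
    case 2
    have "\<forall>\<^sub>F y in nhds x. flat p y = 0"
      using eventually_nhds_in_open[of "{..<0}" x] 2 by (auto elim!: eventually_mono simp: flat_def)
    then show ?thesis using 2 by (subst DERIV_cong_ev[where g = "\<lambda>_. 0"]) (auto simp: flat_def)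
  next
    case 3
    have "((\<lambda>h. flat p h / h) \<longlongrightarrow> 0) (at_right 0)"
    proof -
      have "((\<lambda>h. poly (pCons 0 p) (inverse h) * exp (- inverse h)) \<longlongrightarrow> 0) (at_right 0)"
        by (rule filterlim_compose[OF poly_times_exp_minus_tendsto_0 filterlim_inverse_at_top_right])
      moreover have "\<forall>\<^sub>F h in at_right 0. poly (pCons 0 p) (inverse h) * exp (- inverse h) = flat p h / h"
        using eventually_at_right_less[of "0::real"] by eventually_elim (simp add: flat_def divide_inverse mult_ac)
      ultimately show ?thesis by (rule Lim_transform_eventually)
    qed
    moreover have "((\<lambda>h. flat p h / h) \<longlongrightarrow> 0) (at_left 0)"
    proof -
      have "\<forall>\<^sub>F h in at_left 0. 0 = flat p h / h"
        using eventually_at_left_real[of "-1" "0::real"] by (auto elim!: eventually_mono simp: flat_def)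
      then show ?thesis by (rule Lim_transform_eventually[OF tendsto_const])
    qed
    ultimately have "((\<lambda>h. flat p h / h) \<longlongrightarrow> 0) (at 0)" by (rule filterlim_split_at[rotated])
    then show ?thesis using 3 by (simp add: DERIV_def flat_def)
  qed
qed

text \<open>
  Gluing two such functions at the ends of the interval \<open>[-1, 1]\<close> gives compact support, and the
  product rule stays within finite sums.
\<close>

inductive_set flat_products :: "(real \<Rightarrow> real) set" where
  base: "(\<lambda>x. flat p (1 + x) * flat q (1 - x)) \<in> flat_products"
| add: "f \<in> flat_products \<Longrightarrow> g \<in> flat_products \<Longrightarrow> (\<lambda>x. f x + g x) \<in> flat_products"

lemma flat_products_derivative:
  "f \<in> flat_products \<Longrightarrow> \<exists>g\<in>flat_products. \<forall>x. (f has_real_derivative g x) (at x)"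
proof (induction rule: flat_products.induct)
  case (base p q)
  let ?d = "\<lambda>p. [:0, 0, 1:] * (p - pderiv p)"
  have neg: "- flat r y = flat (- r) y" for r y by (simp add: flat_def)
  have "((\<lambda>x. flat p (1 + x) * flat q (1 - x)) has_real_derivative
      (flat (?d p) (1 + x) * flat q (1 - x) + flat p (1 + x) * flat (- ?d q) (1 - x))) (at x)" for x
  proof -
    have "((\<lambda>x. flat p (1 + x) * flat q (1 - x)) has_real_derivative
        flat (?d p) (1 + x) * 1 * flat q (1 - x) + flat (?d q) (1 - x) * (- 1) * flat p (1 + x)) (at x)"
      by (rule DERIV_mult[OF DERIV_chain2[OF flat_has_derivative] DERIV_chain2[OF flat_has_derivative]])
        (auto intro!: derivative_eq_intros)
    also have "flat (?d p) (1 + x) * 1 * flat q (1 - x) + flat (?d q) (1 - x) * (- 1) * flat p (1 + x)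
        = flat (?d p) (1 + x) * flat q (1 - x) + flat p (1 + x) * flat (- ?d q) (1 - x)"
      unfolding neg[symmetric] by (simp only: mult_1_right mult_minus_right mult_minus_left mult.commute)
    finally show ?thesis .
  qed
  then show ?case
    by (rule bexI[rotated, OF flat_products.add[OF flat_products.base flat_products.base], OF allI])
next
  case (add f g)
  then obtain f' g' where "f' \<in> flat_products" "g' \<in> flat_products"
    "\<And>x. (f has_real_derivative f' x) (at x)" "\<And>x. (g has_real_derivative g' x) (at x)" by auto
  then show ?case
    by (intro bexI[where x = "\<lambda>x. f' x + g' x"] flat_products.intros allI DERIV_add)
qed

lemma flat_products_higher_derivative: "f \<in> flat_products \<Longrightarrow> (deriv ^^ n) f \<in> flat_products"
proof (induction n)
  case (Suc n)
  then obtain g where g: "g \<in> flat_products" "\<And>x. ((deriv ^^ n) f has_real_derivative g x) (at x)"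
    using flat_products_derivative[OF Suc.IH[OF Suc.prems]] by auto
  then have "deriv ((deriv ^^ n) f) = g" by (intro ext DERIV_imp_deriv)
  then show ?case using g by simp
qed simp

lemma mollifiers_nonempty: "\<exists>f. f \<in> mollifiers"
proof -
  define b where "b c x = flat [:c:] (1 + x) * flat 1 (1 - x)" for c x
  have bc: "b c x = c * b 1 x" for c x by (simp add: b_def flat_def)
  have in_S: "b c \<in> flat_products" for c
    unfolding b_def[abs_def] by (rule flat_products.base)
  have diff: "(deriv ^^ n) (b c) differentiable_on UNIV" for n c
    using flat_products_derivative[OF flat_products_higher_derivative[OF in_S]]
    unfolding differentiable_on_def real_differentiable_def by (metis UNIV_I)
  have b0: "0 \<le> b 1 x" "b 1 x \<le> indicator {-1..1} x" "b 1 (- x) = b 1 x" for x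
    by (auto simp: b_def flat_def indicator_def mult_le_one)
  have "continuous_on UNIV (b 1)"
    using diff[of 0 1] by (simp add: differentiable_imp_continuous_on)
  then have bm [measurable]: "b 1 \<in> borel_measurable borel" by (rule borel_measurable_continuous_onI)
  have int: "integrable lborel (b 1)"
    by (rule Bochner_Integration.integrable_bound[where f = "indicator {-1..1} :: real \<Rightarrow> real"])
      (use b0 in \<open>auto intro!: AE_I2\<close>)
  define I where "I = (\<integral>x. b 1 x \<partial>lborel)"
  have "0 < I"
  proof -
    have lower: "exp (- 4) * indicator {- (1/2)..1/2} x \<le> b 1 x" for x
    proof (cases "x \<in> {- (1/2)..1/2}")
      case True
      have "inverse (1 + x) + inverse (1 - x) \<le> 2 + 2"
        using True by (intro add_mono) (auto simp: field_simps)
      then have "exp (- 4) \<le> exp (- inverse (1 + x) + - inverse (1 - x))" by simp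
      also have "\<dots> = b 1 x"
        using True by (simp only: b_def flat_def exp_add) simp
      finally show ?thesis using True by simp
    qed (use b0 in auto)
    have "(0::real) < exp (- 4)" by simp
    also have "\<dots> = (\<integral>x. exp (- 4) * indicator {- (1/2)..1/2::real} x \<partial>lborel)" by simp
    also have "\<dots> \<le> I"
      unfolding I_def using lower int by (intro integral_mono) auto
    finally show ?thesis .
  qed
  have supp: "{x. b (1 / I) x \<noteq> 0} \<subseteq> {-1..1}"
    by (auto simp: b_def flat_def split: if_splits)
  then have "closure {x. b (1 / I) x \<noteq> 0} \<subseteq> {-1..1}" by (intro closure_minimal) auto
  then have "bounded (closure {x. b (1 / I) x \<noteq> 0})" by (rule bounded_subset[rotated]) simp
  then have "compact (closure {x. b (1 / I) x \<noteq> 0})" by (simp add: compact_eq_bounded_closed)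
  moreover have "(\<integral>x. b (1 / I) x \<partial>lborel) = 1"
    unfolding bc[of "1 / I"] using \<open>0 < I\<close> by (simp add: I_def[symmetric])
  moreover have "\<forall>x. 0 \<le> b (1 / I) x" "\<forall>x. b (1 / I) (- x) = b (1 / I) x"
    unfolding bc[of "1 / I"] using b0 \<open>0 < I\<close> by auto
  ultimately have "b (1 / I) \<in> mollifiers"
    unfolding mollifiers_def using diff by simp
  then show ?thesis by (rule exI[where x = "b (1 / I)"])
qed

section \<open>The second factorial moment of a Poisson field\<close>

lemma poisson_weight_sums:
  fixes l :: real
  shows "(\<lambda>n. l ^ n / fact n * exp (- l)) sums 1"
    and "(\<lambda>n. real n * (l ^ n / fact n * exp (- l))) sums l"
    and "(\<lambda>n. (real n)\<^sup>2 * (l ^ n / fact n * exp (- l))) sums (l\<^sup>2 + l)"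
proof -
  have e: "(\<lambda>n. l ^ n / fact n) sums exp l"
    using exp_converges[of l] by (simp add: divide_inverse scaleR_conv_of_real mult.commute)
  from sums_mult2[OF this, of "exp (- l)"] show s0: "(\<lambda>n. l ^ n / fact n * exp (- l)) sums 1"
    by (simp add: exp_minus)
  have eq1: "real (Suc n) * (l ^ Suc n / fact (Suc n) * exp (- l)) = l * (l ^ n / fact n * exp (- l))" for n
    by (simp add: field_simps del: of_nat_Suc)
  have "(\<lambda>n. real (Suc n) * (l ^ Suc n / fact (Suc n) * exp (- l))) sums l"
    using sums_mult[OF s0, of l] unfolding eq1 by simp
  from sums_Suc[OF this] show s1: "(\<lambda>n. real n * (l ^ n / fact n * exp (- l))) sums l"
    by simp
  have eq2: "(real (Suc n))\<^sup>2 * (l ^ Suc n / fact (Suc n) * exp (- l))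
      = l * (real n * (l ^ n / fact n * exp (- l))) + l * (l ^ n / fact n * exp (- l))" for n
  proof -
    have "(real (Suc n))\<^sup>2 * (l ^ Suc n / fact (Suc n) * exp (- l))
        = real (Suc n) * (real (Suc n) * (l ^ Suc n / fact (Suc n) * exp (- l)))"
      by (simp only: power2_eq_square mult.assoc)
    also have "\<dots> = (real n + 1) * (l * (l ^ n / fact n * exp (- l)))"
      unfolding eq1 by simp
    also have "\<dots> = l * (real n * (l ^ n / fact n * exp (- l))) + l * (l ^ n / fact n * exp (- l))"
      by (simp only: distrib_right distrib_left mult_1_left mult.left_commute)
    finally show ?thesis .
  qed
  have "(\<lambda>n. (real (Suc n))\<^sup>2 * (l ^ Suc n / fact (Suc n) * exp (- l))) sums (l * l + l * 1)"
    unfolding eq2 by (intro sums_add sums_mult s0 s1)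
  from sums_Suc[OF this] show "(\<lambda>n. (real n)\<^sup>2 * (l ^ n / fact n * exp (- l))) sums (l\<^sup>2 + l)"
    by (simp add: power2_eq_square)
qed

context prob_space
begin

context
  fixes x :: "nat \<Rightarrow> 'a \<Rightarrow> real"
  assumes x: "poisson_field M x"
begin

lemma poisson_field_measurable [measurable]: "x j \<in> borel_measurable M"
  using x by (simp add: poisson_field_def)

lemma point_count_nn_integral:
  "point_count x B \<omega> = (\<integral>\<^sup>+j. indicator B (x j \<omega>) \<partial>count_space UNIV)"
proof -
  have "(\<integral>\<^sup>+j. indicator B (x j \<omega>) \<partial>count_space UNIV)
      = (\<integral>\<^sup>+j. indicator {j. x j \<omega> \<in> B} j \<partial>count_space UNIV)"
    by (intro nn_integral_cong) (simp add: indicator_def)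
  also have "\<dots> = point_count x B \<omega>"
    by (simp only: nn_integral_indicator sets_count_space Pow_UNIV UNIV_I point_count_def)
  finally show ?thesis ..
qed

lemma point_count_measurable [measurable]:
  assumes [measurable]: "B \<in> sets borel"
  shows "point_count x B \<in> borel_measurable M"
proof -
  have "(\<lambda>\<omega>. \<Sum>j. indicator B (x j \<omega>) :: ennreal) \<in> borel_measurable M"
    by measurable
  also have "(\<lambda>\<omega>. \<Sum>j. indicator B (x j \<omega>) :: ennreal) = point_count x B"
    unfolding point_count_nn_integral[abs_def] nn_integral_count_space_nat ..
  finally show ?thesis .
qed

text \<open>
  Since the Poisson weights add up to one, the count is almost surely finite and expectations of
  functions of it are series.
\<close>

lemma nn_integral_point_count:
  assumes B: "B \<in> sets borel" "emeasure lborel B < \<infinity>"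
  shows "(\<integral>\<^sup>+\<omega>. g (point_count x B \<omega>) \<partial>M)
    = (\<Sum>n. g (of_nat n) * ennreal (measure lborel B ^ n / fact n * exp (- measure lborel B)))"
proof -
  define E where "E n = {\<omega> \<in> space M. point_count x B \<omega> = of_nat n}" for n :: nat
  note [measurable] = point_count_measurable[OF B(1)]
  have E [measurable]: "E n \<in> sets M" for n unfolding E_def by measurable
  have P: "emeasure M (E n) = ennreal (measure lborel B ^ n / fact n * exp (- measure lborel B))" for n
    using x B by (simp add: E_def emeasure_eq_measure poisson_field_def)
  have disj: "disjoint_family E"
    unfolding disjoint_family_on_def
  proof (intro ballI impI)
    fix m n :: nat assume "m \<noteq> n"
    then have "(of_nat m :: ennreal) \<noteq> of_nat n" by simp
    then show "E m \<inter> E n = {}" unfolding E_def by (intro equals0I) (elim IntE CollectE conjE, metis)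
  qed
  have "emeasure M (\<Union>n. E n) = (\<Sum>n. emeasure M (E n))"
    by (rule suminf_emeasure[symmetric]) (use disj E in auto)
  also have "\<dots> = ennreal 1"
    unfolding P by (intro suminf_ennreal_eq poisson_weight_sums) auto
  finally have "prob (\<Union>n. E n) = 1" by (simp add: emeasure_eq_measure)
  then have ae: "AE \<omega> in M. \<omega> \<in> (\<Union>n. E n)" by (rule AE_prob_1)
  have "(\<integral>\<^sup>+\<omega>. g (point_count x B \<omega>) \<partial>M) = (\<integral>\<^sup>+\<omega>. (\<Sum>n. g (of_nat n) * indicator (E n) \<omega>) \<partial>M)"
  proof (rule nn_integral_cong_AE, use ae in eventually_elim)
    fix \<omega> assume "\<omega> \<in> (\<Union>n. E n)"
    then obtain n where n: "\<omega> \<in> E n" by auto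
    then have pc: "point_count x B \<omega> = of_nat n" by (simp add: E_def)
    have ne: "\<omega> \<notin> E m" if "m \<noteq> n" for m
      using n that disj by (auto simp: disjoint_family_on_def)
    have "(\<Sum>m. g (of_nat m) * indicator (E m) \<omega>) = (\<Sum>m\<in>{n}. g (of_nat m) * indicator (E m) \<omega>)"
      by (rule suminf_finite) (simp_all add: ne)
    also have "\<dots> = g (of_nat n)" using n by simp
    finally show "g (point_count x B \<omega>) = (\<Sum>m. g (of_nat m) * indicator (E m) \<omega>)"
      unfolding pc ..
  qed
  also have "\<dots> = (\<Sum>n. \<integral>\<^sup>+\<omega>. g (of_nat n) * indicator (E n) \<omega> \<partial>M)"
    by (intro nn_integral_suminf) measurable
  also have "\<dots> = (\<Sum>n. g (of_nat n) * emeasure M (E n))"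
    by (simp add: nn_integral_cmult_indicator)
  finally show ?thesis unfolding P .
qed

lemma point_count_moments:
  assumes B: "B \<in> sets borel" "emeasure lborel B < \<infinity>"
  shows "(\<integral>\<^sup>+\<omega>. point_count x B \<omega> \<partial>M) = emeasure lborel B"
    and "(\<integral>\<^sup>+\<omega>. (point_count x B \<omega>)\<^sup>2 \<partial>M) = (emeasure lborel B)\<^sup>2 + emeasure lborel B"
proof -
  let ?l = "measure lborel B"
  have l: "emeasure lborel B = ennreal ?l"
    using B by (intro emeasure_eq_ennreal_measure) auto
  have "(\<integral>\<^sup>+\<omega>. point_count x B \<omega> \<partial>M) = (\<Sum>n. ennreal (real n * (?l ^ n / fact n * exp (- ?l))))"
    unfolding nn_integral_point_count[OF B, of "\<lambda>y. y"] ennreal_of_nat_eq_real_of_nat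
    by (intro suminf_cong ennreal_mult[symmetric]) auto
  also have "\<dots> = ennreal ?l"
    by (intro suminf_ennreal_eq poisson_weight_sums) auto
  finally show "(\<integral>\<^sup>+\<omega>. point_count x B \<omega> \<partial>M) = emeasure lborel B" by (simp add: l)
  have "(\<integral>\<^sup>+\<omega>. (point_count x B \<omega>)\<^sup>2 \<partial>M) = (\<Sum>n. ennreal ((real n)\<^sup>2 * (?l ^ n / fact n * exp (- ?l))))"
    unfolding nn_integral_point_count[OF B, of "\<lambda>y. y\<^sup>2"] ennreal_of_nat_eq_real_of_nat
      ennreal_power[OF of_nat_0_le_iff]
    by (intro suminf_cong ennreal_mult[symmetric]) auto
  also have "\<dots> = ennreal (?l\<^sup>2 + ?l)"
    by (intro suminf_ennreal_eq poisson_weight_sums) auto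
  finally show "(\<integral>\<^sup>+\<omega>. (point_count x B \<omega>)\<^sup>2 \<partial>M) = (emeasure lborel B)\<^sup>2 + emeasure lborel B"
    by (simp add: l ennreal_power)
qed

lemma point_count_product_mean:
  assumes A: "A \<in> sets borel" "emeasure lborel A < \<infinity>" and B: "B \<in> sets borel" "emeasure lborel B < \<infinity>"
    and "A \<inter> B = {}"
  shows "(\<integral>\<^sup>+\<omega>. point_count x A \<omega> * point_count x B \<omega> \<partial>M) = emeasure lborel A * emeasure lborel B"
proof -
  \<comment> \<open>Independence is available for sequences of disjoint sets.\<close>
  define S where "S i = (if i = 0 then A else if i = 1 then B else {})" for i :: nat
  have "range S \<subseteq> sets borel" "disjoint_family S"
    using assms by (auto simp: S_def disjoint_family_on_def)
  then have "indep_vars (\<lambda>_. borel) (\<lambda>i. point_count x (S i)) UNIV"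
    using x by (simp add: poisson_field_def)
  then have "indep_vars (\<lambda>_. borel) (\<lambda>i. point_count x (S i)) {0, 1}"
    by (rule indep_vars_subset) simp
  then have "(\<integral>\<^sup>+\<omega>. (\<Prod>i\<in>{0, 1}. point_count x (S i) \<omega>) \<partial>M)
      = (\<Prod>i\<in>{0, 1}. \<integral>\<^sup>+\<omega>. point_count x (S i) \<omega> \<partial>M)"
    by (intro indep_vars_nn_integral) auto
  then have "(\<integral>\<^sup>+\<omega>. point_count x (S 0) \<omega> * point_count x (S 1) \<omega> \<partial>M)
      = (\<integral>\<^sup>+\<omega>. point_count x (S 0) \<omega> \<partial>M) * (\<integral>\<^sup>+\<omega>. point_count x (S 1) \<omega> \<partial>M)"
    by simp
  moreover have "S 0 = A" "S 1 = B" by (simp_all add: S_def)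
  ultimately show ?thesis
    by (simp only: point_count_moments(1)[OF A] point_count_moments(1)[OF B])
qed

lemma point_count_split:
  "point_count x A \<omega> = point_count x (A - B) \<omega> + point_count x (A \<inter> B) \<omega>"
proof -
  have eq: "{j. x j \<omega> \<in> A} = {j. x j \<omega> \<in> A - B} \<union> {j. x j \<omega> \<in> A \<inter> B}" by auto
  show ?thesis
    unfolding point_count_def eq by (rule plus_emeasure[symmetric]) auto
qed

text \<open>
  A pair of labels either has distinct entries or lies on the diagonal.
\<close>

lemma point_count_mult:
  "point_count x A \<omega> * point_count x B \<omega>
    = (\<integral>\<^sup>+p. indicator (A \<times> B) (x (fst p) \<omega>, x (snd p) \<omega>) \<partial>count_space distinct_pairs)
      + point_count x (A \<inter> B) \<omega>"
proof -
  define f :: "nat \<times> nat \<Rightarrow> ennreal" where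
    "f p = indicator (A \<times> B) (x (fst p) \<omega>, x (snd p) \<omega>)" for p
  have "point_count x A \<omega> * point_count x B \<omega>
      = (\<integral>\<^sup>+j. \<integral>\<^sup>+k. indicator A (x j \<omega>) * indicator B (x k \<omega>) \<partial>count_space UNIV \<partial>count_space UNIV)"
    by (simp add: point_count_nn_integral nn_integral_cmult nn_integral_multc)
  also have "\<dots> = (\<integral>\<^sup>+j. \<integral>\<^sup>+k. f (j, k) \<partial>count_space UNIV \<partial>count_space UNIV)"
    by (intro nn_integral_cong) (simp add: f_def indicator_times)
  also have "\<dots> = (\<integral>\<^sup>+p. f p \<partial>count_space UNIV)"
    by (rule nn_integral_fst_count_space)
  also have "\<dots> = (\<integral>\<^sup>+p. f p * indicator distinct_pairs p + f p * indicator (- distinct_pairs) p \<partial>count_space UNIV)"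
    by (intro nn_integral_cong) (simp add: indicator_def)
  also have "\<dots> = (\<integral>\<^sup>+p. f p * indicator distinct_pairs p \<partial>count_space UNIV)
      + (\<integral>\<^sup>+p. f p * indicator (- distinct_pairs) p \<partial>count_space UNIV)"
    by (intro nn_integral_add) auto
  also have "(\<integral>\<^sup>+p. f p * indicator distinct_pairs p \<partial>count_space UNIV) = (\<integral>\<^sup>+p. f p \<partial>count_space distinct_pairs)"
    by (rule nn_integral_count_space_indicator[symmetric]) simp
  also have "(\<integral>\<^sup>+p. f p * indicator (- distinct_pairs) p \<partial>count_space UNIV)
      = (\<integral>\<^sup>+j. \<integral>\<^sup>+k. f (j, k) * indicator (- distinct_pairs) (j, k) \<partial>count_space UNIV \<partial>count_space UNIV)"
    by (rule nn_integral_fst_count_space[symmetric])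
  also have "\<dots> = (\<integral>\<^sup>+j. \<integral>\<^sup>+k. f (j, k) * indicator {j} k \<partial>count_space UNIV \<partial>count_space UNIV)"
    by (intro nn_integral_cong) (auto simp: distinct_pairs_def indicator_def)
  also have "\<dots> = (\<integral>\<^sup>+j. f (j, j) \<partial>count_space UNIV)"
    by (intro nn_integral_cong, subst nn_integral_indicator_singleton) auto
  also have "\<dots> = point_count x (A \<inter> B) \<omega>"
    unfolding point_count_nn_integral
    by (intro nn_integral_cong) (simp add: f_def indicator_def)
  finally show ?thesis by (simp add: f_def)
qed

text \<open>
  On a rectangle, split the two sides into their differences and their intersection. The three
  counts are independent, and the second moment \<open>\<lambda>\<^sup>2 + \<lambda>\<close> of the count on the intersection exceeds
  \<open>\<lambda>\<^sup>2\<close> by exactly the contribution of the coinciding indices.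
\<close>

lemma pair_count_rectangle:
  assumes A: "A \<in> sets borel" "emeasure lborel A < \<infinity>" and B: "B \<in> sets borel" "emeasure lborel B < \<infinity>"
  shows "(\<integral>\<^sup>+\<omega>. \<integral>\<^sup>+p. indicator (A \<times> B) (x (fst p) \<omega>, x (snd p) \<omega>) \<partial>count_space distinct_pairs \<partial>M)
    = emeasure lborel A * emeasure lborel B"
proof -
  let ?N = "point_count x"
  let ?D = "\<lambda>\<omega>. \<integral>\<^sup>+p. indicator (A \<times> B) (x (fst p) \<omega>, x (snd p) \<omega>) \<partial>count_space distinct_pairs"
  note [measurable] = A(1) B(1)
  have finI: "emeasure lborel (A \<inter> B) < \<infinity>"
    by (rule order.strict_trans1[OF emeasure_mono A(2)]) auto
  have finA: "emeasure lborel (A - B) < \<infinity>"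
    by (rule order.strict_trans1[OF emeasure_mono A(2)]) auto
  have finB: "emeasure lborel (B - A) < \<infinity>"
    by (rule order.strict_trans1[OF emeasure_mono B(2)]) auto
  have Dm [measurable]: "?D \<in> borel_measurable M"
  proof -
    have "countable distinct_pairs" by simp
    then have "(\<lambda>(p, \<omega>). indicator (A \<times> B) (x (fst p) \<omega>, x (snd p) \<omega>) :: ennreal)
        \<in> borel_measurable (count_space distinct_pairs \<Otimes>\<^sub>M M)"
      by (intro measurable_pair_measure_countable1) auto
    then have "(\<lambda>(\<omega>, p). indicator (A \<times> B) (x (fst p) \<omega>, x (snd p) \<omega>) :: ennreal)
        \<in> borel_measurable (M \<Otimes>\<^sub>M count_space distinct_pairs)"
      by (subst measurable_pair_swap_iff) (simp add: split_def)
    then show ?thesis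
      using sigma_finite_measure.borel_measurable_nn_integral[OF
          sigma_finite_measure_count_space_countable[OF \<open>countable distinct_pairs\<close>], of "\<lambda>\<omega> p. indicator (A \<times> B) (x (fst p) \<omega>, x (snd p) \<omega>)"]
      by simp
  qed
  have lA: "emeasure lborel A = emeasure lborel (A - B) + emeasure lborel (A \<inter> B)"
    by (subst plus_emeasure) (auto intro: arg_cong[where f = "emeasure lborel"])
  have lB: "emeasure lborel B = emeasure lborel (B - A) + emeasure lborel (A \<inter> B)"
    by (subst plus_emeasure) (auto intro: arg_cong[where f = "emeasure lborel"])
  have NB: "?N B \<omega> = ?N (B - A) \<omega> + ?N (A \<inter> B) \<omega>" for \<omega>
    using point_count_split[of B \<omega> A] by (simp add: Int_commute)
  have "(\<integral>\<^sup>+\<omega>. ?D \<omega> \<partial>M) + emeasure lborel (A \<inter> B) = (\<integral>\<^sup>+\<omega>. ?D \<omega> + ?N (A \<inter> B) \<omega> \<partial>M)"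
    by (subst nn_integral_add) (simp_all add: point_count_moments(1)[OF _ finI])
  also have "\<dots> = (\<integral>\<^sup>+\<omega>. ?N A \<omega> * ?N B \<omega> \<partial>M)"
    by (simp add: point_count_mult)
  also have "\<dots> = (\<integral>\<^sup>+\<omega>. (?N (A - B) \<omega> * ?N (B - A) \<omega> + ?N (A - B) \<omega> * ?N (A \<inter> B) \<omega>)
      + (?N (A \<inter> B) \<omega> * ?N (B - A) \<omega> + (?N (A \<inter> B) \<omega>)\<^sup>2) \<partial>M)"
    unfolding NB point_count_split[of A _ B]
    by (intro nn_integral_cong) (simp add: distrib_left distrib_right power2_eq_square ac_simps)
  also have "\<dots> = ((\<integral>\<^sup>+\<omega>. ?N (A - B) \<omega> * ?N (B - A) \<omega> \<partial>M) + (\<integral>\<^sup>+\<omega>. ?N (A - B) \<omega> * ?N (A \<inter> B) \<omega> \<partial>M))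
      + ((\<integral>\<^sup>+\<omega>. ?N (A \<inter> B) \<omega> * ?N (B - A) \<omega> \<partial>M) + (\<integral>\<^sup>+\<omega>. (?N (A \<inter> B) \<omega>)\<^sup>2 \<partial>M))"
    by (simp add: nn_integral_add)
  also have "\<dots> = emeasure lborel A * emeasure lborel B + emeasure lborel (A \<inter> B)"
  proof -
    have alg: "(a * b + a * c) + (c * b + (c\<^sup>2 + c)) = (a + c) * (b + c) + c" for a b c :: ennreal
      by (simp only: distrib_left distrib_right power2_eq_square ac_simps)
    have m: "(\<integral>\<^sup>+\<omega>. ?N (A - B) \<omega> * ?N (B - A) \<omega> \<partial>M) = emeasure lborel (A - B) * emeasure lborel (B - A)"
      "(\<integral>\<^sup>+\<omega>. ?N (A - B) \<omega> * ?N (A \<inter> B) \<omega> \<partial>M) = emeasure lborel (A - B) * emeasure lborel (A \<inter> B)"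
      "(\<integral>\<^sup>+\<omega>. ?N (A \<inter> B) \<omega> * ?N (B - A) \<omega> \<partial>M) = emeasure lborel (A \<inter> B) * emeasure lborel (B - A)"
      by (rule point_count_product_mean; (use finA finB finI in auto))+
    have m2: "(\<integral>\<^sup>+\<omega>. (?N (A \<inter> B) \<omega>)\<^sup>2 \<partial>M) = (emeasure lborel (A \<inter> B))\<^sup>2 + emeasure lborel (A \<inter> B)"
      by (rule point_count_moments(2)) (use finI in auto)
    show ?thesis unfolding m m2 alg lA lB ..
  qed
  finally show ?thesis using finI by (auto simp: ennreal_add_left_cancel add.commute[of _ "emeasure lborel (A \<inter> B)"])
qed

text \<open>
  The measure on the left, the sum of the joint laws of all pairs of distinct points, agrees with
  planar Lebesgue measure on rectangles of finite area, because summing over all pairs turns it into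
  an expectation of counts, which do not depend on the enumeration. The law of a single pair is
  therefore dominated by planar Lebesgue measure.
\<close>

theorem poisson_pairs:
  assumes h [measurable]: "h \<in> borel_measurable (lborel \<Otimes>\<^sub>M lborel)"
  shows "(\<integral>\<^sup>+p. \<integral>\<^sup>+\<omega>. h (x (fst p) \<omega>, x (snd p) \<omega>) \<partial>M \<partial>count_space distinct_pairs)
    = (\<integral>\<^sup>+z. h z \<partial>(lborel \<Otimes>\<^sub>M lborel))"
proof -
  have cnt: "countable distinct_pairs" by simp
  interpret ct: sigma_finite_measure "count_space distinct_pairs"
    by (rule sigma_finite_measure_count_space_countable[OF cnt])
  interpret P: pair_sigma_finite "count_space distinct_pairs" M ..
  let ?\<nu> = "distr (count_space distinct_pairs \<Otimes>\<^sub>M M) (lborel \<Otimes>\<^sub>M lborel) (\<lambda>(p, \<omega>). (x (fst p) \<omega>, x (snd p) \<omega>))"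
  have xm [measurable]: "(\<lambda>(p, \<omega>). (x (fst p) \<omega>, x (snd p) \<omega>))
      \<in> measurable (count_space distinct_pairs \<Otimes>\<^sub>M M) (lborel \<Otimes>\<^sub>M lborel)"
    by (intro measurable_pair_measure_countable1[OF cnt]) auto
  have \<nu>: "(\<integral>\<^sup>+z. g z \<partial>?\<nu>) = (\<integral>\<^sup>+p. \<integral>\<^sup>+\<omega>. g (x (fst p) \<omega>, x (snd p) \<omega>) \<partial>M \<partial>count_space distinct_pairs)"
    if [measurable]: "g \<in> borel_measurable (lborel \<Otimes>\<^sub>M lborel)" for g
  proof -
    have "(\<integral>\<^sup>+z. g z \<partial>?\<nu>) = (\<integral>\<^sup>+q. (case q of (p, \<omega>) \<Rightarrow> g (x (fst p) \<omega>, x (snd p) \<omega>)) \<partial>(count_space distinct_pairs \<Otimes>\<^sub>M M))"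
      by (subst nn_integral_distr) (auto simp: split_def)
    also have "\<dots> = (\<integral>\<^sup>+p. \<integral>\<^sup>+\<omega>. g (x (fst p) \<omega>, x (snd p) \<omega>) \<partial>M \<partial>count_space distinct_pairs)"
      by (subst nn_integral_fst[symmetric]) (use measurable_compose[OF xm that] in \<open>auto simp: split_def\<close>)
    finally show ?thesis .
  qed
  have fin: "emeasure ?\<nu> (A \<times> B) = emeasure lborel A * emeasure lborel B"
    if A: "A \<in> sets borel" "emeasure lborel A < \<infinity>" and B: "B \<in> sets borel" "emeasure lborel B < \<infinity>" for A B
  proof -
    have "emeasure ?\<nu> (A \<times> B) = (\<integral>\<^sup>+z. indicator (A \<times> B) z \<partial>?\<nu>)"
      using A B by (intro nn_integral_indicator[symmetric]) auto
    also have "\<dots> = (\<integral>\<^sup>+p. \<integral>\<^sup>+\<omega>. indicator (A \<times> B) (x (fst p) \<omega>, x (snd p) \<omega>) \<partial>M \<partial>count_space distinct_pairs)"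
      using A B by (intro \<nu>) auto
    also have "\<dots> = (\<integral>\<^sup>+\<omega>. \<integral>\<^sup>+p. indicator (A \<times> B) (x (fst p) \<omega>, x (snd p) \<omega>) \<partial>count_space distinct_pairs \<partial>M)"
    proof (rule P.Fubini'[symmetric])
      have "(\<lambda>(p, \<omega>). indicator (A \<times> B) (x (fst p) \<omega>, x (snd p) \<omega>) :: ennreal)
          \<in> borel_measurable (count_space distinct_pairs \<Otimes>\<^sub>M M)"
        using A B by (intro measurable_pair_measure_countable1[OF cnt]) auto
      then show "(\<lambda>(p, \<omega>). indicator (A \<times> B) (x (fst p) \<omega>, x (snd p) \<omega>) :: ennreal)
          \<in> borel_measurable (count_space distinct_pairs \<Otimes>\<^sub>M M)" .
    qed
    also have "\<dots> = emeasure lborel A * emeasure lborel B"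
      using A B by (intro pair_count_rectangle)
    finally show ?thesis .
  qed
  define I where "I n = {- real n..real n}" for n
  have I: "I n \<in> sets borel" "emeasure lborel (I n) < \<infinity>" "(\<Union>n. I n) = UNIV" for n
    by (auto simp: I_def) (metis abs_le_D1 abs_le_D2 minus_le_iff real_arch_simple)
  have finI: "emeasure lborel (A \<inter> I n) < \<infinity>" if "A \<in> sets borel" for A n
    by (rule order.strict_trans1[OF emeasure_mono I(2)]) (use I(1) in auto)
  have I_mono: "y \<in> I n" if "y \<in> I m" "m \<le> n" for m n y
    using that by (auto simp: I_def)
  have I_sup: "(SUP n. emeasure lborel (A \<inter> I n)) = emeasure lborel A" if "A \<in> sets borel" for A
  proof -
    have "(SUP n. emeasure lborel (A \<inter> I n)) = emeasure lborel (\<Union>n. A \<inter> I n)"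
      using I(1) I_mono that by (intro SUP_emeasure_incseq) (auto simp: incseq_def)
    then show ?thesis using I(3) by (simp flip: Int_UN_distrib)
  qed
  have "lborel \<Otimes>\<^sub>M lborel = ?\<nu>"
  proof (rule pair_measure_eqI)
    fix A B :: "real set" assume "A \<in> sets lborel" "B \<in> sets lborel"
    then have [simp]: "A \<in> sets borel" "B \<in> sets borel" by auto
    have half: "emeasure ?\<nu> (A' \<times> B) = emeasure lborel A' * emeasure lborel B"
      if A': "A' \<in> sets borel" "emeasure lborel A' < \<infinity>" for A'
    proof -
      have "emeasure ?\<nu> (A' \<times> B) = emeasure ?\<nu> (\<Union>n. A' \<times> (B \<inter> I n))"
        using I(3) by (intro arg_cong[where f = "emeasure ?\<nu>"]) blast
      also have "\<dots> = (SUP n. emeasure ?\<nu> (A' \<times> (B \<inter> I n)))"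
        using I(1) I_mono A' by (intro SUP_emeasure_incseq[symmetric]) (auto simp: incseq_def intro!: pair_measureI)
      also have "\<dots> = (SUP n. emeasure lborel A' * emeasure lborel (B \<inter> I n))"
        using A' I finI by (intro SUP_cong refl fin) auto
      also have "\<dots> = emeasure lborel A' * emeasure lborel B"
        by (simp add: SUP_mult_left_ennreal[symmetric] I_sup)
      finally show ?thesis .
    qed
    have "emeasure ?\<nu> (A \<times> B) = emeasure ?\<nu> (\<Union>n. (A \<inter> I n) \<times> B)"
      using I(3) by (intro arg_cong[where f = "emeasure ?\<nu>"]) blast
    also have "\<dots> = (SUP n. emeasure ?\<nu> ((A \<inter> I n) \<times> B))"
      using I(1) I_mono by (intro SUP_emeasure_incseq[symmetric]) (auto simp: incseq_def intro!: pair_measureI)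
    also have "\<dots> = (SUP n. emeasure lborel (A \<inter> I n) * emeasure lborel B)"
      using I finI by (intro SUP_cong refl half) auto
    also have "\<dots> = emeasure lborel A * emeasure lborel B"
      by (simp add: SUP_mult_right_ennreal[symmetric] I_sup)
    finally show "emeasure lborel A * emeasure lborel B = emeasure ?\<nu> (A \<times> B)" by simp
  qed (auto intro: sigma_finite_lborel)
  then show ?thesis using \<nu>[OF h] by simp
qed

end

end

section \<open>Independence of the sources of randomness\<close>

lemma Int_stable_sigma_sets:
  assumes "G \<subseteq> Pow \<Omega>"
  shows "Int_stable (sigma_sets \<Omega> G)"
proof (rule Int_stableI)
  fix a b assume "a \<in> sigma_sets \<Omega> G" "b \<in> sigma_sets \<Omega> G"
  then have "a \<in> sets (sigma \<Omega> G)" "b \<in> sets (sigma \<Omega> G)" using assms by (simp_all add: sets_measure_of)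
  then have "a \<inter> b \<in> sets (sigma \<Omega> G)" by (rule sets.Int)
  then show "a \<inter> b \<in> sigma_sets \<Omega> G" using assms by (simp add: sets_measure_of)
qed

text \<open>
  Independence turns the joint law of the two variables into a product measure, so that one of them
  may be replaced by an independent copy.
\<close>

lemma (in prob_space) nn_integral_independent:
  assumes X [measurable]: "X \<in> measurable M S" and Y [measurable]: "Y \<in> measurable M S'"
    and ind: "\<And>A B. A \<in> sets S \<Longrightarrow> B \<in> sets S' \<Longrightarrow>
      prob ((X -` A \<inter> space M) \<inter> (Y -` B \<inter> space M)) = prob (X -` A \<inter> space M) * prob (Y -` B \<inter> space M)"
    and F [measurable]: "F \<in> borel_measurable (S \<Otimes>\<^sub>M S')"
  shows "(\<integral>\<^sup>+\<omega>. F (X \<omega>, Y \<omega>) \<partial>M) = (\<integral>\<^sup>+\<omega>. \<integral>\<^sup>+\<omega>'. F (X \<omega>, Y \<omega>') \<partial>M \<partial>M)"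
proof -
  interpret X: prob_space "distr M S X" by (rule prob_space_distr[OF X])
  interpret Y: prob_space "distr M S' Y" by (rule prob_space_distr[OF Y])
  have XY: "(\<lambda>\<omega>. (X \<omega>, Y \<omega>)) \<in> measurable M (S \<Otimes>\<^sub>M S')" by (rule measurable_Pair[OF X Y])
  have eq: "distr M S X \<Otimes>\<^sub>M distr M S' Y = distr M (S \<Otimes>\<^sub>M S') (\<lambda>\<omega>. (X \<omega>, Y \<omega>))"
  proof (rule pair_measure_eqI)
    fix A B assume "A \<in> sets (distr M S X)" "B \<in> sets (distr M S' Y)"
    then have AB: "A \<in> sets S" "B \<in> sets S'" by simp_all
    have "(\<lambda>\<omega>. (X \<omega>, Y \<omega>)) -` (A \<times> B) \<inter> space M = (X -` A \<inter> space M) \<inter> (Y -` B \<inter> space M)" by auto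
    moreover have "A \<times> B \<in> sets (S \<Otimes>\<^sub>M S')" using AB by (rule pair_measureI)
    ultimately have "emeasure (distr M (S \<Otimes>\<^sub>M S') (\<lambda>\<omega>. (X \<omega>, Y \<omega>))) (A \<times> B)
        = ennreal (prob ((X -` A \<inter> space M) \<inter> (Y -` B \<inter> space M)))"
      by (simp add: emeasure_distr[OF XY] emeasure_eq_measure)
    then show "emeasure (distr M S X) A * emeasure (distr M S' Y) B
        = emeasure (distr M (S \<Otimes>\<^sub>M S') (\<lambda>\<omega>. (X \<omega>, Y \<omega>))) (A \<times> B)"
      using AB by (simp add: ind emeasure_distr[OF X] emeasure_distr[OF Y] emeasure_eq_measure ennreal_mult)
  qed (simp_all add: X.sigma_finite_measure_axioms Y.sigma_finite_measure_axioms cong: sets_pair_measure_cong)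
  have "(\<integral>\<^sup>+\<omega>. F (X \<omega>, Y \<omega>) \<partial>M) = (\<integral>\<^sup>+z. F z \<partial>distr M (S \<Otimes>\<^sub>M S') (\<lambda>\<omega>. (X \<omega>, Y \<omega>)))"
    by (simp add: nn_integral_distr[OF XY])
  also have "\<dots> = (\<integral>\<^sup>+a. \<integral>\<^sup>+b. F (a, b) \<partial>distr M S' Y \<partial>distr M S X)"
    unfolding eq[symmetric] by (subst Y.nn_integral_fst[symmetric]) auto
  also have "\<dots> = (\<integral>\<^sup>+\<omega>. \<integral>\<^sup>+b. F (X \<omega>, b) \<partial>distr M S' Y \<partial>M)"
    by (subst nn_integral_distr) auto
  also have "\<dots> = (\<integral>\<^sup>+\<omega>. \<integral>\<^sup>+\<omega>'. F (X \<omega>, Y \<omega>') \<partial>M \<partial>M)"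
  proof (rule nn_integral_cong)
    fix \<omega> assume "\<omega> \<in> space M"
    then have "X \<omega> \<in> space S" using measurable_space[OF X] by auto
    then show "(\<integral>\<^sup>+b. F (X \<omega>, b) \<partial>distr M S' Y) = (\<integral>\<^sup>+\<omega>'. F (X \<omega>, Y \<omega>') \<partial>M)"
      by (subst nn_integral_distr) auto
  qed
  finally show ?thesis .
qed

definition source_algebra :: "'w measure \<Rightarrow> (nat \<Rightarrow> 'w \<Rightarrow> real) \<Rightarrow> (nat \<Rightarrow> real \<Rightarrow> 'w \<Rightarrow> real) \<Rightarrow> (nat \<Rightarrow> 'w \<Rightarrow> real) \<Rightarrow> source set \<Rightarrow> 'w measure" where
  "source_algebra M x \<rho> \<sigma> I = sigma (space M) (\<Union>s\<in>I. source_sets M x \<rho> \<sigma> s)"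

locale charged_system = prob_space M for M :: "'w measure" +
  fixes \<alpha> T :: real and x :: "nat \<Rightarrow> 'w \<Rightarrow> real" and \<rho> :: "nat \<Rightarrow> real \<Rightarrow> 'w \<Rightarrow> real" and \<sigma> :: "nat \<Rightarrow> 'w \<Rightarrow> real"
  assumes \<alpha>: "1 / 2 < \<alpha>" "\<alpha> < 1" and T: "0 < T" and system: "charged_stable_system M \<alpha> x \<rho> \<sigma>"
begin

lemma field: "poisson_field M x"
  and stable: "standard_stable_levy M \<alpha> (\<rho> j)"
  and charge: "\<sigma> j \<in> borel_measurable M" "prob {\<omega> \<in> space M. \<sigma> j \<omega> = 1} = 1 / 2" "prob {\<omega> \<in> space M. \<sigma> j \<omega> = - 1} = 1 / 2"
  and sources: "indep_sets (source_sets M x \<rho> \<sigma>) UNIV"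
  using system by (auto simp: charged_stable_system_def)

abbreviation "\<A> \<equiv> source_algebra M x \<rho> \<sigma>"

lemma source_sets_events: "source_sets M x \<rho> \<sigma> s \<subseteq> events"
  using sources by (auto simp: indep_sets_def)

lemma source_sets_Pow: "(\<Union>s\<in>I. source_sets M x \<rho> \<sigma> s) \<subseteq> Pow (space M)"
  using source_sets_events sets.sets_into_space by blast

lemma space_source_algebra [simp]: "space (\<A> I) = space M"
  using source_sets_Pow by (simp add: source_algebra_def space_measure_of)

lemma sets_source_algebra: "sets (\<A> I) = sigma_sets (space M) (\<Union>s\<in>I. source_sets M x \<rho> \<sigma> s)"
  using source_sets_Pow by (simp add: source_algebra_def sets_measure_of)

lemma source_algebra_events: "sets (\<A> I) \<subseteq> events"
  unfolding sets_source_algebra using source_sets_events by (intro sets.sigma_sets_subset) blast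

lemma measurable_source_algebra: "X \<in> measurable (\<A> I) S \<Longrightarrow> X \<in> measurable M S"
  using source_algebra_events by (auto simp: measurable_def)

lemma Int_stable_source_sets: "Int_stable (source_sets M x \<rho> \<sigma> s)"
  by (cases s) (auto simp: generated_sets_def intro!: Int_stable_sigma_sets)

lemma indep_source_algebras:
  assumes IJ: "I \<inter> J = {}"
  shows "indep_set (sets (\<A> I)) (sets (\<A> J))"
proof -
  have "indep_sets (\<lambda>b. sigma_sets (space M) (\<Union>i\<in>case_bool I J b. source_sets M x \<rho> \<sigma> i)) UNIV"
  proof (rule indep_sets_collect_sigma)
    show "indep_sets (source_sets M x \<rho> \<sigma>) (\<Union>j\<in>UNIV. case_bool I J j)"
      by (rule indep_sets_mono_index[OF _ sources]) simp
    show "disjoint_family_on (case_bool I J) UNIV"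
      using IJ by (auto simp: disjoint_family_on_def split: bool.split)
  qed (rule Int_stable_source_sets)
  then show ?thesis
    unfolding indep_set_def sets_source_algebra
    by (rule indep_sets_mono_sets) (simp split: bool.split)
qed

lemma nn_integral_independent_sources:
  assumes IJ: "I \<inter> J = {}" and X: "X \<in> measurable (\<A> I) S" and Y: "Y \<in> measurable (\<A> J) S'"
    and F: "F \<in> borel_measurable (S \<Otimes>\<^sub>M S')"
  shows "(\<integral>\<^sup>+\<omega>. F (X \<omega>, Y \<omega>) \<partial>M) = (\<integral>\<^sup>+\<omega>. \<integral>\<^sup>+\<omega>'. F (X \<omega>, Y \<omega>') \<partial>M \<partial>M)"
proof (rule nn_integral_independent[OF _ _ _ F])
  show "X \<in> measurable M S" "Y \<in> measurable M S'"
    using X Y by (auto intro: measurable_source_algebra)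
  fix A B assume "A \<in> sets S" "B \<in> sets S'"
  then have "X -` A \<inter> space M \<in> sets (\<A> I)" "Y -` B \<inter> space M \<in> sets (\<A> J)"
    using measurable_sets[OF X] measurable_sets[OF Y] by auto
  then show "prob ((X -` A \<inter> space M) \<inter> (Y -` B \<inter> space M)) = prob (X -` A \<inter> space M) * prob (Y -` B \<inter> space M)"
    by (rule indep_setD[OF indep_source_algebras[OF IJ]])
qed

lemma indep_var_sources:
  assumes IJ: "I \<inter> J = {}" and X: "X \<in> measurable (\<A> I) S" and Y: "Y \<in> measurable (\<A> J) S'"
  shows "indep_var S X S' Y"
proof -
  have "indep_sets (\<lambda>b. {case_bool X Y b -` A \<inter> space M | A. A \<in> sets (case_bool S S' b)}) UNIV"
  proof (rule indep_sets_mono_sets[OF indep_source_algebras[OF IJ, unfolded indep_set_def]])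
    fix b :: bool
    show "{case_bool X Y b -` A \<inter> space M | A. A \<in> sets (case_bool S S' b)}
        \<subseteq> (case b of True \<Rightarrow> sets (\<A> I) | False \<Rightarrow> sets (\<A> J))"
      using measurable_sets[OF X] measurable_sets[OF Y] by (cases b) auto
  qed
  moreover have "\<forall>b\<in>UNIV. case_bool X Y b \<in> measurable M (case_bool S S' b)"
    using measurable_source_algebra[OF X] measurable_source_algebra[OF Y] by (simp split: bool.split)
  ultimately show ?thesis
    unfolding indep_var_def indep_vars_def2 by blast
qed

lemma vimage_generated_sets:
  assumes "i \<in> K" "A \<in> sets borel"
  shows "X i -` A \<inter> space M \<in> generated_sets M K X"
  unfolding generated_sets_def using assms by (intro sigma_sets.Basic) auto

lemma measurable_source:
  assumes "s \<in> I" and "\<And>A. A \<in> sets borel \<Longrightarrow> X -` A \<inter> space M \<in> source_sets M x \<rho> \<sigma> s"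
  shows "X \<in> borel_measurable (\<A> I)"
  by (rule measurableI) (use assms in \<open>auto simp: sets_source_algebra intro!: sigma_sets.Basic\<close>)

lemma position_measurable: "Positions \<in> I \<Longrightarrow> x j \<in> borel_measurable (\<A> I)"
  by (rule measurable_source[of Positions]) (auto intro: vimage_generated_sets)

lemma motion_measurable: "Motion j \<in> I \<Longrightarrow> 0 \<le> t \<Longrightarrow> \<rho> j t \<in> borel_measurable (\<A> I)"
  by (rule measurable_source[of "Motion j"]) (auto intro: vimage_generated_sets)

lemma charge_measurable: "Charge j \<in> I \<Longrightarrow> \<sigma> j \<in> borel_measurable (\<A> I)"
  by (rule measurable_source[of "Charge j"]) (auto intro: vimage_generated_sets)

abbreviation "\<P> j k \<equiv> path_pair_space M (\<rho> j) (\<rho> k)"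

lemma path_pair_space_eq: "path_pair_space M (\<rho> j) (\<rho> k) = restr_to_subalg M (\<A> {Motion j, Motion k})"
  by (simp add: path_pair_space_def source_algebra_def)

lemma subalgebra_sources: "subalgebra M (\<A> I)"
  using source_algebra_events by (simp add: subalgebra_def)

lemma space_path_pair [simp]: "space (\<P> j k) = space M"
  by (simp add: path_pair_space_eq space_restr_to_subalg)

lemma sets_path_pair: "sets (\<P> j k) = sets (\<A> {Motion j, Motion k})"
  unfolding path_pair_space_eq by (rule sets_restr_to_subalg[OF subalgebra_sources])

lemma prob_space_path_pair: "prob_space (\<P> j k)"
  unfolding path_pair_space_eq by (rule prob_space_restr_to_subalg[OF subalgebra_sources prob_space_axioms])

lemma nn_integral_path_pair:
  assumes "f \<in> borel_measurable (\<P> j k)"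
  shows "(\<integral>\<^sup>+\<omega>. f \<omega> \<partial>\<P> j k) = (\<integral>\<^sup>+\<omega>. f \<omega> \<partial>M)"
proof (rule nn_integral_subalgebra[OF assms])
  show "sets (\<P> j k) \<subseteq> events" using source_algebra_events by (simp add: sets_path_pair)
  show "emeasure (\<P> j k) A = emeasure M A" if "A \<in> sets (\<P> j k)" for A
    using that unfolding path_pair_space_eq sets_path_pair[unfolded path_pair_space_eq]
    by (rule emeasure_restr_to_subalg[OF subalgebra_sources])
qed simp

lemma measurable_ident_path_pair:
  assumes "Motion j \<in> I" "Motion k \<in> I"
  shows "(\<lambda>\<omega>. \<omega>) \<in> measurable (\<A> I) (\<P> j k)"
proof (rule measurableI)
  fix A assume "A \<in> sets (\<P> j k)"
  then have "A \<in> sets (\<A> {Motion j, Motion k})" by (simp add: sets_path_pair)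
  moreover have "sets (\<A> {Motion j, Motion k}) \<subseteq> sets (\<A> I)"
    unfolding sets_source_algebra using assms by (intro sigma_sets_mono') auto
  moreover have "A \<subseteq> space M" using calculation source_algebra_events sets.sets_into_space by blast
  ultimately show "(\<lambda>\<omega>. \<omega>) -` A \<inter> space (\<A> I) \<in> sets (\<A> I)" by (auto simp: Int_absorb2)
qed simp

section \<open>Laws of the stable motions\<close>

lemma motion_random_variable: "0 \<le> t \<Longrightarrow> \<rho> j t \<in> borel_measurable M"
  using stable by (simp add: standard_stable_levy_def)

lemma motion_zero: "\<omega> \<in> space M \<Longrightarrow> \<rho> j 0 \<omega> = 0"
  using stable by (simp add: standard_stable_levy_def)

lemma motion_cadlag: "\<omega> \<in> space M \<Longrightarrow> cadlag (\<lambda>t. \<rho> j t \<omega>)"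
  using stable by (simp add: standard_stable_levy_def)

lemma increment_real_distribution:
  assumes "0 \<le> s" "0 \<le> t"
  shows "real_distribution (distr M borel (\<lambda>\<omega>. \<rho> j t \<omega> - \<rho> j s \<omega>))"
  using assms motion_random_variable[of s j] motion_random_variable[of t j]
  by (intro real_distribution_distr borel_measurable_diff)

lemma increment_char:
  assumes st: "0 \<le> s" "0 \<le> t"
  shows "char (distr M borel (\<lambda>\<omega>. \<rho> j t \<omega> - \<rho> j s \<omega>)) z = of_real (exp (- \<bar>t - s\<bar> * \<bar>z\<bar> powr \<alpha>))"
proof -
  have ord: "char (distr M borel (\<lambda>\<omega>. \<rho> j t \<omega> - \<rho> j s \<omega>)) z = of_real (exp (- (t - s) * \<bar>z\<bar> powr \<alpha>))"
    if "0 \<le> s" "s \<le> t" for s t z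
    using stable[of j] that by (simp add: standard_stable_levy_def)
  show ?thesis
  proof (cases "s \<le> t")
    case True
    then show ?thesis using ord[of s t z] st by simp
  next
    case False
    have [measurable]: "\<rho> j s \<in> borel_measurable M" "\<rho> j t \<in> borel_measurable M"
      using motion_random_variable st by auto
    have "char (distr M borel (\<lambda>\<omega>. \<rho> j t \<omega> - \<rho> j s \<omega>)) z = char (distr M borel (\<lambda>\<omega>. \<rho> j s \<omega> - \<rho> j t \<omega>)) (- z)"
      unfolding char_def by (subst (1 2) integral_distr) (auto simp: algebra_simps)
    also have "\<dots> = of_real (exp (- (s - t) * \<bar>- z\<bar> powr \<alpha>))"
      using ord[of t s "- z"] st False by simp
    finally show ?thesis using False by simp
  qed
qed

definition law1 :: "real measure" where
  "law1 = distr M borel (\<lambda>\<omega>. \<rho> 0 1 \<omega> - \<rho> 0 0 \<omega>)"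

lemma law1_distribution: "real_distribution law1"
  unfolding law1_def by (rule increment_real_distribution) auto

lemma law1_char: "char law1 z = of_real (exp (- (\<bar>z\<bar> powr \<alpha>)))"
  unfolding law1_def by (subst increment_char) auto

text \<open>
  Self-similarity, read off from the characteristic functions.
\<close>

lemma increment_law:
  assumes st: "0 \<le> s" "0 \<le> t"
  shows "distr M borel (\<lambda>\<omega>. \<rho> j t \<omega> - \<rho> j s \<omega>) = distr law1 borel (\<lambda>y. \<bar>t - s\<bar> powr (1 / \<alpha>) * y)"
proof (rule Levy_uniqueness)
  interpret L: real_distribution law1 by (rule law1_distribution)
  show "real_distribution (distr M borel (\<lambda>\<omega>. \<rho> j t \<omega> - \<rho> j s \<omega>))"
    using st by (rule increment_real_distribution)
  show "real_distribution (distr law1 borel (\<lambda>y. \<bar>t - s\<bar> powr (1 / \<alpha>) * y))"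
    by (rule L.real_distribution_distr) simp
  show "char (distr M borel (\<lambda>\<omega>. \<rho> j t \<omega> - \<rho> j s \<omega>)) = char (distr law1 borel (\<lambda>y. \<bar>t - s\<bar> powr (1 / \<alpha>) * y))"
  proof
    fix z
    define c where "c = \<bar>t - s\<bar> powr (1 / \<alpha>)"
    have "char (distr law1 borel (\<lambda>y. c * y)) z = char law1 (c * z)"
      unfolding char_def by (subst integral_distr) (auto simp: mult_ac)
    also have "\<dots> = of_real (exp (- (\<bar>c * z\<bar> powr \<alpha>)))" by (rule law1_char)
    also have "\<bar>c * z\<bar> powr \<alpha> = \<bar>t - s\<bar> * \<bar>z\<bar> powr \<alpha>"
      using \<alpha> by (simp add: c_def abs_mult powr_mult powr_powr)
    finally show "char (distr M borel (\<lambda>\<omega>. \<rho> j t \<omega> - \<rho> j s \<omega>)) z = char (distr law1 borel (\<lambda>y. \<bar>t - s\<bar> powr (1 / \<alpha>) * y)) z"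
      using increment_char[OF st] by (simp add: c_def)
  qed
qed

lemma nn_integral_increment:
  fixes h :: "real \<Rightarrow> ennreal"
  assumes st: "0 \<le> s" "0 \<le> t" and h [measurable]: "h \<in> borel_measurable borel"
  shows "(\<integral>\<^sup>+\<omega>. h (\<rho> j t \<omega> - \<rho> j s \<omega>) \<partial>M) = (\<integral>\<^sup>+y. h (\<bar>t - s\<bar> powr (1 / \<alpha>) * y) \<partial>law1)"
proof -
  define c where "c = \<bar>t - s\<bar> powr (1 / \<alpha>)"
  have X: "(\<lambda>\<omega>. \<rho> j t \<omega> - \<rho> j s \<omega>) \<in> borel_measurable M"
    using motion_random_variable[OF st(1)] motion_random_variable[OF st(2)] by (rule borel_measurable_diff[rotated])
  have Y: "(\<lambda>y. c * y) \<in> borel_measurable law1"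
    by (simp add: law1_def)
  have "(\<integral>\<^sup>+\<omega>. h (\<rho> j t \<omega> - \<rho> j s \<omega>) \<partial>M) = (\<integral>\<^sup>+y. h y \<partial>distr M borel (\<lambda>\<omega>. \<rho> j t \<omega> - \<rho> j s \<omega>))"
    by (simp add: nn_integral_distr[OF X] h)
  also have "\<dots> = (\<integral>\<^sup>+y. h (c * y) \<partial>law1)"
    unfolding increment_law[OF st] c_def[symmetric] by (simp add: nn_integral_distr[OF Y] h)
  finally show ?thesis unfolding c_def .
qed

text \<open>
  Both values are functions of the independent increments over the two successive time intervals,
  and the laws of these do not depend on the particle.
\<close>

lemma two_time_law:
  assumes st: "0 \<le> s" "0 \<le> t"
  shows "distr M (borel \<Otimes>\<^sub>M borel) (\<lambda>\<omega>. (\<rho> j s \<omega>, \<rho> j t \<omega>)) = distr M (borel \<Otimes>\<^sub>M borel) (\<lambda>\<omega>. (\<rho> k s \<omega>, \<rho> k t \<omega>))"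
proof -
  note rv = motion_random_variable
  have ordered: "distr M (borel \<Otimes>\<^sub>M borel) (\<lambda>\<omega>. (\<rho> j s \<omega>, \<rho> j t \<omega>))
      = distr (distr law1 borel (\<lambda>y. \<bar>s\<bar> powr (1 / \<alpha>) * y) \<Otimes>\<^sub>M distr law1 borel (\<lambda>y. \<bar>t - s\<bar> powr (1 / \<alpha>) * y))
          (borel \<Otimes>\<^sub>M borel) (\<lambda>(a, b). (a, a + b))"
    if st: "0 \<le> s" "s \<le> t" for s t j
  proof -
    define \<tau> where "\<tau> i = (if i = 0 then 0 else if i = Suc 0 then s else t)" for i :: nat
    have "mono \<tau>" using st by (intro incseq_SucI) (auto simp: \<tau>_def)
    moreover have "0 \<le> \<tau> 0" by (simp add: \<tau>_def)
    ultimately have ind: "indep_vars (\<lambda>_. borel) (\<lambda>i \<omega>. \<rho> j (\<tau> (Suc i)) \<omega> - \<rho> j (\<tau> i) \<omega>) UNIV"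
      using stable[of j] unfolding standard_stable_levy_def by blast
    have "indep_var borel (\<lambda>\<omega>. \<rho> j s \<omega> - \<rho> j 0 \<omega>) borel (\<lambda>\<omega>. \<rho> j t \<omega> - \<rho> j s \<omega>)"
    proof -
      let ?Y = "\<lambda>i \<omega>. \<rho> j (\<tau> (Suc i)) \<omega> - \<rho> j (\<tau> i) \<omega>"
      have "indep_var (PiM {0} (\<lambda>_. borel)) (\<lambda>\<omega>. restrict (\<lambda>i. ?Y i \<omega>) {0})
          (PiM {Suc 0} (\<lambda>_. borel)) (\<lambda>\<omega>. restrict (\<lambda>i. ?Y i \<omega>) {Suc 0})"
        by (rule indep_var_restrict[OF ind]) auto
      then have "indep_var borel ((\<lambda>f. f 0) \<circ> (\<lambda>\<omega>. restrict (\<lambda>i. ?Y i \<omega>) {0}))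
          borel ((\<lambda>f. f (Suc 0)) \<circ> (\<lambda>\<omega>. restrict (\<lambda>i. ?Y i \<omega>) {Suc 0}))"
        by (rule indep_var_compose) (auto intro: measurable_component_singleton)
      then show ?thesis by (simp add: comp_def \<tau>_def)
    qed
    then have prod: "distr M borel (\<lambda>\<omega>. \<rho> j s \<omega> - \<rho> j 0 \<omega>) \<Otimes>\<^sub>M distr M borel (\<lambda>\<omega>. \<rho> j t \<omega> - \<rho> j s \<omega>)
        = distr M (borel \<Otimes>\<^sub>M borel) (\<lambda>\<omega>. (\<rho> j s \<omega> - \<rho> j 0 \<omega>, \<rho> j t \<omega> - \<rho> j s \<omega>))"
      unfolding indep_var_distribution_eq by blast
    have [measurable]: "\<rho> j s \<in> borel_measurable M" "\<rho> j t \<in> borel_measurable M" "\<rho> j 0 \<in> borel_measurable M"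
      using rv st by auto
    have "distr M (borel \<Otimes>\<^sub>M borel) (\<lambda>\<omega>. (\<rho> j s \<omega>, \<rho> j t \<omega>))
        = distr (distr M (borel \<Otimes>\<^sub>M borel) (\<lambda>\<omega>. (\<rho> j s \<omega> - \<rho> j 0 \<omega>, \<rho> j t \<omega> - \<rho> j s \<omega>))) (borel \<Otimes>\<^sub>M borel) (\<lambda>(a, b). (a, a + b))"
    proof (subst distr_distr)
      show "(\<lambda>(a, b). (a, a + b)) \<in> measurable (borel \<Otimes>\<^sub>M borel) (borel \<Otimes>\<^sub>M (borel :: real measure))"
        by measurable
      show "(\<lambda>\<omega>. (\<rho> j s \<omega> - \<rho> j 0 \<omega>, \<rho> j t \<omega> - \<rho> j s \<omega>)) \<in> measurable M (borel \<Otimes>\<^sub>M borel)"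
        by measurable
      show "distr M (borel \<Otimes>\<^sub>M borel) (\<lambda>\<omega>. (\<rho> j s \<omega>, \<rho> j t \<omega>))
          = distr M (borel \<Otimes>\<^sub>M borel) ((\<lambda>(a, b). (a, a + b)) \<circ> (\<lambda>\<omega>. (\<rho> j s \<omega> - \<rho> j 0 \<omega>, \<rho> j t \<omega> - \<rho> j s \<omega>)))"
        by (intro distr_cong) (simp_all add: motion_zero)
    qed
    also have "\<dots> = distr (distr law1 borel (\<lambda>y. \<bar>s\<bar> powr (1 / \<alpha>) * y) \<Otimes>\<^sub>M distr law1 borel (\<lambda>y. \<bar>t - s\<bar> powr (1 / \<alpha>) * y))
          (borel \<Otimes>\<^sub>M borel) (\<lambda>(a, b). (a, a + b))"
    proof -
      have "distr M borel (\<lambda>\<omega>. \<rho> j s \<omega> - \<rho> j 0 \<omega>) = distr law1 borel (\<lambda>y. \<bar>s\<bar> powr (1 / \<alpha>) * y)"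
        using increment_law[of 0 s j] st by simp
      moreover have "distr M borel (\<lambda>\<omega>. \<rho> j t \<omega> - \<rho> j s \<omega>) = distr law1 borel (\<lambda>y. \<bar>t - s\<bar> powr (1 / \<alpha>) * y)"
        using st by (intro increment_law) auto
      ultimately show ?thesis unfolding prod[symmetric] by (simp only:)
    qed
    finally show ?thesis .
  qed
  show ?thesis
  proof (cases "s \<le> t")
    case True
    then show ?thesis using ordered st by simp
  next
    case False
    have swap: "distr M (borel \<Otimes>\<^sub>M borel) (\<lambda>\<omega>. (\<rho> j s \<omega>, \<rho> j t \<omega>))
        = distr (distr M (borel \<Otimes>\<^sub>M borel) (\<lambda>\<omega>. (\<rho> j t \<omega>, \<rho> j s \<omega>))) (borel \<Otimes>\<^sub>M borel) (\<lambda>(a, b). (b, a))" for j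
    proof -
      have XY: "(\<lambda>\<omega>. (\<rho> j t \<omega>, \<rho> j s \<omega>)) \<in> measurable M (borel \<Otimes>\<^sub>M borel)"
        by (intro measurable_Pair rv st)
      have sw: "(\<lambda>(a, b). (b, a)) \<in> measurable (borel \<Otimes>\<^sub>M borel) (borel \<Otimes>\<^sub>M (borel :: real measure))"
        by measurable
      show ?thesis by (simp add: distr_distr[OF sw XY] comp_def)
    qed
    show ?thesis unfolding swap using ordered[of t s j] ordered[of t s k] False st by simp
  qed
qed

lemma nn_integral_two_times:
  fixes h :: "real \<times> real \<Rightarrow> ennreal"
  assumes st: "0 \<le> s" "0 \<le> t" and h: "h \<in> borel_measurable (borel \<Otimes>\<^sub>M borel)"
  shows "(\<integral>\<^sup>+\<omega>. h (\<rho> j s \<omega>, \<rho> j t \<omega>) \<partial>M) = (\<integral>\<^sup>+\<omega>. h (\<rho> k s \<omega>, \<rho> k t \<omega>) \<partial>M)"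
proof -
  have "(\<integral>\<^sup>+\<omega>. h (\<rho> i s \<omega>, \<rho> i t \<omega>) \<partial>M) = (\<integral>\<^sup>+z. h z \<partial>distr M (borel \<Otimes>\<^sub>M borel) (\<lambda>\<omega>. (\<rho> i s \<omega>, \<rho> i t \<omega>)))" for i
  proof -
    have XY: "(\<lambda>\<omega>. (\<rho> i s \<omega>, \<rho> i t \<omega>)) \<in> measurable M (borel \<Otimes>\<^sub>M borel)"
      by (intro measurable_Pair motion_random_variable st)
    show ?thesis by (simp add: nn_integral_distr[OF XY] h)
  qed
  note eq = this
  show ?thesis by (simp only: eq two_time_law[OF st, of j k])
qed

end

section \<open>The intersection local times of the particle system\<close>

text \<open>
  By right continuity the value at a time is the limit of the values at the next grid point strictly
  to its right, as the mesh of the grid decreases; on each grid only countably many times occur.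
\<close>

lemma cadlag_jointly_measurable:
  fixes X :: "real \<Rightarrow> 'w \<Rightarrow> real"
  assumes meas: "\<And>t. 0 \<le> t \<Longrightarrow> X t \<in> borel_measurable P"
    and cad: "\<And>\<omega>. \<omega> \<in> space P \<Longrightarrow> cadlag (\<lambda>t. X t \<omega>)"
  shows "(\<lambda>(u, \<omega>). X (max 0 u) \<omega>) \<in> borel_measurable (borel \<Otimes>\<^sub>M P)"
proof -
  define k where "k n u = nat \<lfloor>real (Suc n) * max 0 u\<rfloor>" for n and u :: real
  define g where "g n u = (real (k n u) + 1) / real (Suc n)" for n u
  have step: "(\<lambda>z. X (g n (fst z)) (snd z)) \<in> borel_measurable (borel \<Otimes>\<^sub>M P)" for n
    unfolding g_def
  proof (rule measurable_compose_countable[where f = "\<lambda>i z. X ((real i + 1) / real (Suc n)) (snd z)"])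
    show "(\<lambda>z. X ((real i + 1) / real (Suc n)) (snd z)) \<in> borel_measurable (borel \<Otimes>\<^sub>M P)" for i
      by (rule measurable_compose[OF measurable_snd meas]) simp
    show "(\<lambda>z. k n (fst z)) \<in> measurable (borel \<Otimes>\<^sub>M P) (count_space UNIV)"
      unfolding k_def by measurable
  qed
  have bounds: "max 0 u < g n u" "g n u \<le> max 0 u + 1 / real (Suc n)" for n u
  proof -
    have nn: "0 \<le> real (Suc n) * max 0 u" by simp
    have "real (k n u) \<le> real (Suc n) * max 0 u" "real (Suc n) * max 0 u < real (k n u) + 1"
      unfolding k_def by (rule nat_floor_bounds[OF nn])+
    then have k: "real (k n u) \<le> max 0 u * real (Suc n)" "max 0 u * real (Suc n) < real (k n u) + 1"
      by (simp_all only: mult.commute)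
    show "max 0 u < g n u"
      unfolding g_def using k(2) by (simp only: pos_less_divide_eq of_nat_0_less_iff zero_less_Suc)
    have "real (k n u) / real (Suc n) \<le> max 0 u"
      using k(1) by (simp only: pos_divide_le_eq of_nat_0_less_iff zero_less_Suc)
    then show "g n u \<le> max 0 u + 1 / real (Suc n)"
      unfolding g_def add_divide_distrib by (rule add_right_mono)
  qed
  have "(\<lambda>z. X (max 0 (fst z)) (snd z)) \<in> borel_measurable (borel \<Otimes>\<^sub>M P)"
  proof (rule borel_measurable_LIMSEQ_real[OF _ step])
    fix z :: "real \<times> 'w" assume "z \<in> space (borel \<Otimes>\<^sub>M P)"
    then have \<omega>: "snd z \<in> space P" by (simp add: space_pair_measure mem_Times_iff)
    let ?u = "max 0 (fst z)"
    have lim: "((\<lambda>t. X t (snd z)) \<longlongrightarrow> X ?u (snd z)) (at_right ?u)"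
      using cad[OF \<omega>] unfolding cadlag_def by simp
    have upper: "(\<lambda>n. ?u + 1 / real (Suc n)) \<longlonglongrightarrow> ?u"
      using LIMSEQ_inverse_real_of_nat_add[of ?u] by (simp only: inverse_eq_divide)
    have "(\<lambda>n. g n (fst z)) \<longlonglongrightarrow> ?u"
    proof (rule tendsto_sandwich[OF _ _ tendsto_const upper])
      show "\<forall>\<^sub>F n in sequentially. ?u \<le> g n (fst z)"
        using bounds(1) by (intro always_eventually allI less_imp_le)
      show "\<forall>\<^sub>F n in sequentially. g n (fst z) \<le> ?u + 1 / real (Suc n)"
        using bounds(2) by (intro always_eventually allI)
    qed
    moreover have "\<forall>\<^sub>F n in sequentially. ?u < g n (fst z)"
      using bounds(1) by (intro always_eventually allI)
    ultimately have "filterlim (\<lambda>n. g n (fst z)) (at_right ?u) sequentially"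
      by (rule tendsto_imp_filterlim_at_right)
    from filterlim_compose[OF lim this]
    show "(\<lambda>n. X (g n (fst z)) (snd z)) \<longlonglongrightarrow> X ?u (snd z)" .
  qed
  then show ?thesis by (simp add: split_def)
qed

lemma L2_tendsto_cong:
  assumes "L2_tendsto N X L F" and eq: "\<forall>\<^sub>F i in F. \<forall>z\<in>space N. X i z = Y i z"
  shows "L2_tendsto N Y L F"
proof -
  have sq: "square_integrable N (Y i)" if "square_integrable N (X i)" "\<forall>z\<in>space N. X i z = Y i z" for i
  proof -
    have "Y i \<in> borel_measurable N"
      using that(1)[THEN square_integrableD(1)] by (rule measurable_cong[THEN iffD1, rotated]) (use that(2) in auto)
    moreover have "integrable N (\<lambda>z. (Y i z)\<^sup>2)"
      using that(1)[THEN square_integrableD(2)]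
      by (rule Bochner_Integration.integrable_cong[OF refl, THEN iffD1, rotated]) (use that(2) in auto)
    ultimately show ?thesis by (simp add: square_integrable_def)
  qed
  have "\<forall>\<^sub>F i in F. square_integrable N (X i)" using assms(1) by (simp add: L2_tendsto_def)
  with eq have "\<forall>\<^sub>F i in F. square_integrable N (Y i)"
    by eventually_elim (rule sq)
  moreover have "((\<lambda>i. \<integral>z. (Y i z - L z)\<^sup>2 \<partial>N) \<longlongrightarrow> 0) F"
  proof (rule Lim_transform_eventually)
    show "((\<lambda>i. \<integral>z. (X i z - L z)\<^sup>2 \<partial>N) \<longlongrightarrow> 0) F" using assms(1) by (simp add: L2_tendsto_def)
    show "\<forall>\<^sub>F i in F. (\<integral>z. (X i z - L z)\<^sup>2 \<partial>N) = (\<integral>z. (Y i z - L z)\<^sup>2 \<partial>N)"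
      using eq by eventually_elim (intro Bochner_Integration.integral_cong, auto)
  qed
  ultimately show ?thesis using assms(1) by (simp add: L2_tendsto_def)
qed

lemma sum_le_nn_integral_count_space:
  fixes f :: "'a \<Rightarrow> ennreal"
  assumes J: "finite J" "J \<subseteq> S"
  shows "(\<Sum>p\<in>J. f p) \<le> (\<integral>\<^sup>+p. f p \<partial>count_space S)"
proof -
  have "(\<Sum>p\<in>J. f p) = (\<integral>\<^sup>+p. f p \<partial>count_space J)"
    using J(1) by (simp add: nn_integral_count_space_finite)
  also have "\<dots> = (\<integral>\<^sup>+p. f p * indicator J p \<partial>count_space UNIV)"
    by (rule nn_integral_count_space_indicator) simp
  also have "\<dots> \<le> (\<integral>\<^sup>+p. f p * indicator S p \<partial>count_space UNIV)"
    using J(2) by (intro nn_integral_mono mult_left_mono) (auto simp: indicator_def)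
  also have "\<dots> = (\<integral>\<^sup>+p. f p \<partial>count_space S)"
    by (rule nn_integral_count_space_indicator[symmetric]) simp
  finally show ?thesis .
qed

context charged_system
begin

text \<open>
  Holding the motion at its initial value at negative times makes it jointly measurable on the whole
  line and does not affect the integrals over \<open>[0, T]\<close>.
\<close>

definition path :: "nat \<Rightarrow> real \<Rightarrow> 'w \<Rightarrow> real" where
  "path j u \<omega> = \<rho> j (max 0 u) \<omega>"

definition occ_density :: "real \<Rightarrow> real" where
  "occ_density = increment_density T \<alpha> law1"

definition occ_const :: real where
  "occ_const = 2 * T * \<alpha> * (\<integral>s. \<bar>s\<bar> powr (- \<alpha>) \<partial>law1)"

lemma law1_negative_moment: "AE s in law1. s \<noteq> 0" "(\<integral>\<^sup>+s. ennreal (\<bar>s\<bar> powr (- \<alpha>)) \<partial>law1) < \<infinity>"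
  using stable_negative_moment[OF law1_distribution law1_char] \<alpha> by auto

lemma T_nonneg: "0 \<le> T"
  using T by simp

lemmas density_facts = law1_distribution law1_negative_moment \<alpha> T_nonneg

lemma occ_density_le: "occ_density b \<le> occ_const * \<bar>b\<bar> powr (\<alpha> - 1)" and occ_const_nonneg: "0 \<le> occ_const"
proof -
  show "occ_density b \<le> occ_const * \<bar>b\<bar> powr (\<alpha> - 1)"
    unfolding occ_density_def occ_const_def by (rule increment_density_le[OF density_facts])
  show "0 \<le> occ_const"
    using T \<alpha> by (simp add: occ_const_def Bochner_Integration.integral_nonneg)
qed

lemma motion_measurable_path_pair:
  assumes "0 \<le> t"
  shows "\<rho> j t \<in> borel_measurable (\<P> j k)" "\<rho> k t \<in> borel_measurable (\<P> j k)"
proof -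
  have "measurable (\<P> j k) (borel :: real measure) = measurable (\<A> {Motion j, Motion k}) borel"
    by (rule measurable_cong_sets[OF sets_path_pair refl])
  then show "\<rho> j t \<in> borel_measurable (\<P> j k)" "\<rho> k t \<in> borel_measurable (\<P> j k)"
    using motion_measurable assms by auto
qed

lemma path_measurable:
  "(\<lambda>(u, \<omega>). path j u \<omega>) \<in> borel_measurable (borel \<Otimes>\<^sub>M \<P> j k)"
  "(\<lambda>(u, \<omega>). path k u \<omega>) \<in> borel_measurable (borel \<Otimes>\<^sub>M \<P> j k)"
  unfolding path_def
  by (rule cadlag_jointly_measurable; use motion_measurable_path_pair motion_cadlag in simp)+

lemma path_measurable_each: "path i u \<in> borel_measurable (\<A> {Motion i})"
  unfolding path_def[abs_def] by (rule motion_measurable) auto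

lemma occupation:
  fixes h :: "real \<Rightarrow> ennreal"
  assumes ijk: "i = j \<or> i = k" and h [measurable]: "h \<in> borel_measurable borel"
  shows "(\<integral>\<^sup>+u. \<integral>\<^sup>+v. \<integral>\<^sup>+\<omega>. h (path i v \<omega> - path i u \<omega>) \<partial>\<P> j k \<partial>time_measure T \<partial>time_measure T)
    = (\<integral>\<^sup>+b. occ_density b * h b \<partial>lborel)"
proof -
  interpret P: prob_space "\<P> j k" by (rule prob_space_path_pair)
  have pm: "(\<lambda>(u, \<omega>). path i u \<omega>) \<in> borel_measurable (borel \<Otimes>\<^sub>M \<P> j k)"
    using ijk path_measurable by auto
  have [measurable]: "(\<lambda>z. path i (f z) (g z)) \<in> borel_measurable L"
    if [measurable]: "f \<in> borel_measurable L" "g \<in> measurable L (\<P> j k)" for f g and L :: "'s measure"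
    using measurable_compose[of "\<lambda>z. (f z, g z)", OF _ pm] by simp
  define q where "q u v = (\<integral>\<^sup>+\<omega>. h (path i v \<omega> - path i u \<omega>) \<partial>\<P> j k)" for u v
  have [measurable]: "(\<lambda>z. q (f z) (g z)) \<in> borel_measurable L"
    if [measurable]: "f \<in> borel_measurable L" "g \<in> borel_measurable L" for f g and L :: "'s measure"
    unfolding q_def by measurable
  have q: "q u v = (\<integral>\<^sup>+s. h (\<bar>v - u\<bar> powr (1 / \<alpha>) * s) \<partial>law1)" if "0 \<le> u" "0 \<le> v" for u v
  proof -
    have "q u v = (\<integral>\<^sup>+\<omega>. h (path i v \<omega> - path i u \<omega>) \<partial>M)"
      unfolding q_def by (rule nn_integral_path_pair) measurable
    also have "\<dots> = (\<integral>\<^sup>+s. h (\<bar>v - u\<bar> powr (1 / \<alpha>) * s) \<partial>law1)"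
      using nn_integral_increment[OF that h, of i] that by (simp add: path_def)
    finally show ?thesis .
  qed
  have "(\<integral>\<^sup>+u. \<integral>\<^sup>+v. q u v \<partial>time_measure T \<partial>time_measure T)
      = (\<integral>\<^sup>+u. (\<integral>\<^sup>+v. q u v * indicator {0..T} v \<partial>lborel) * indicator {0..T} u \<partial>lborel)"
    by (simp add: nn_integral_time_measure)
  also have "\<dots> = (\<integral>\<^sup>+u. (\<integral>\<^sup>+v. (\<integral>\<^sup>+s. h (\<bar>v - u\<bar> powr (1 / \<alpha>) * s) \<partial>law1) * indicator {0..T} v \<partial>lborel) * indicator {0..T} u \<partial>lborel)"
  proof (rule nn_integral_cong)
    fix u
    show "(\<integral>\<^sup>+v. q u v * indicator {0..T} v \<partial>lborel) * indicator {0..T} u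
      = (\<integral>\<^sup>+v. (\<integral>\<^sup>+s. h (\<bar>v - u\<bar> powr (1 / \<alpha>) * s) \<partial>law1) * indicator {0..T} v \<partial>lborel) * indicator {0..T} u"
    proof (cases "u \<in> {0..T}")
      case True
      have "(\<integral>\<^sup>+v. q u v * indicator {0..T} v \<partial>lborel)
          = (\<integral>\<^sup>+v. (\<integral>\<^sup>+s. h (\<bar>v - u\<bar> powr (1 / \<alpha>) * s) \<partial>law1) * indicator {0..T} v \<partial>lborel)"
        using True q by (intro nn_integral_cong) (simp add: indicator_def)
      then show ?thesis by simp
    qed simp
  qed
  also have "\<dots> = (\<integral>\<^sup>+b. occ_density b * h b \<partial>lborel)"
    unfolding occ_density_def by (rule nn_integral_increment_density[OF density_facts h])
  finally show ?thesis unfolding q_def .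
qed

lemma path_pair_system:
  assumes jk: "j \<noteq> k"
  shows "path_pair (\<P> j k) (path j) (path k) T occ_density"
proof (rule path_pair.intro[OF prob_space_path_pair], rule path_pair_axioms.intro)
  interpret P: prob_space "\<P> j k" by (rule prob_space_path_pair)
  show "(\<lambda>(u, \<omega>). path j u \<omega>) \<in> borel_measurable (borel \<Otimes>\<^sub>M \<P> j k)"
    "(\<lambda>(u, \<omega>). path k u \<omega>) \<in> borel_measurable (borel \<Otimes>\<^sub>M \<P> j k)"
    by (rule path_measurable)+
  show "0 \<le> T" by (rule T_nonneg)
  show "occ_density \<in> borel_measurable borel"
    unfolding occ_density_def by (rule increment_density_measurable[OF density_facts])
  show "0 \<le> occ_density b" for b
    unfolding occ_density_def by (rule increment_density_nonneg[OF density_facts])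
  show "integrable lborel (\<lambda>b. (occ_density b)\<^sup>2)"
    unfolding occ_density_def by (rule integrable_increment_density_square[OF density_facts])
  show "isCont occ_density b" if "b \<noteq> 0" for b
    unfolding occ_density_def by (rule isCont_increment_density[OF density_facts that])
  show "(\<integral>\<^sup>+u. \<integral>\<^sup>+v. \<integral>\<^sup>+\<omega>. h (path j v \<omega> - path j u \<omega>) \<partial>\<P> j k \<partial>time_measure T \<partial>time_measure T)
      = (\<integral>\<^sup>+b. occ_density b * h b \<partial>lborel)" if "h \<in> borel_measurable borel" for h :: "real \<Rightarrow> ennreal"
    using that by (intro occupation) auto
  show "(\<integral>\<^sup>+u. \<integral>\<^sup>+v. \<integral>\<^sup>+\<omega>. h (path k v \<omega> - path k u \<omega>) \<partial>\<P> j k \<partial>time_measure T \<partial>time_measure T)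
      = (\<integral>\<^sup>+b. occ_density b * h b \<partial>lborel)" if "h \<in> borel_measurable borel" for h :: "real \<Rightarrow> ennreal"
    using that by (intro occupation) auto
  fix F :: "(real \<times> real) \<times> (real \<times> real) \<Rightarrow> ennreal" and u u' v v' :: real
  assume F [measurable]: "F \<in> borel_measurable ((borel \<Otimes>\<^sub>M borel) \<Otimes>\<^sub>M (borel \<Otimes>\<^sub>M borel))"
  have [measurable]: "path j a \<in> borel_measurable (\<P> j k)" "path k a \<in> borel_measurable (\<P> j k)" for a
    using motion_measurable_path_pair[of "max 0 a"] by (simp_all add: path_def[abs_def])
  have ind: "(\<integral>\<^sup>+\<omega>. F ((path j u \<omega>, path j u' \<omega>), (path k v \<omega>, path k v' \<omega>)) \<partial>M)
      = (\<integral>\<^sup>+\<omega>. \<integral>\<^sup>+\<omega>'. F ((path j u \<omega>, path j u' \<omega>), (path k v \<omega>', path k v' \<omega>')) \<partial>M \<partial>M)"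
    by (rule nn_integral_independent_sources[of "{Motion j}" "{Motion k}", OF _ _ _ F])
      (use jk in \<open>auto intro!: measurable_Pair path_measurable_each\<close>)
  have "(\<integral>\<^sup>+\<omega>. F ((path j u \<omega>, path j u' \<omega>), (path k v \<omega>, path k v' \<omega>)) \<partial>\<P> j k)
      = (\<integral>\<^sup>+\<omega>. F ((path j u \<omega>, path j u' \<omega>), (path k v \<omega>, path k v' \<omega>)) \<partial>M)"
    by (rule nn_integral_path_pair) measurable
  also have "\<dots> = (\<integral>\<^sup>+\<omega>. \<integral>\<^sup>+\<omega>'. F ((path j u \<omega>, path j u' \<omega>), (path k v \<omega>', path k v' \<omega>')) \<partial>M \<partial>M)"
    by (rule ind)
  also have "\<dots> = (\<integral>\<^sup>+\<omega>. \<integral>\<^sup>+\<omega>'. F ((path j u \<omega>, path j u' \<omega>), (path k v \<omega>', path k v' \<omega>')) \<partial>\<P> j k \<partial>M)"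
    by (intro nn_integral_cong nn_integral_path_pair[symmetric]) measurable
  also have "\<dots> = (\<integral>\<^sup>+\<omega>. \<integral>\<^sup>+\<omega>'. F ((path j u \<omega>, path j u' \<omega>), (path k v \<omega>', path k v' \<omega>')) \<partial>\<P> j k \<partial>\<P> j k)"
    by (rule nn_integral_path_pair[symmetric]) measurable
  finally show "(\<integral>\<^sup>+\<omega>. F ((path j u \<omega>, path j u' \<omega>), (path k v \<omega>, path k v' \<omega>)) \<partial>\<P> j k)
      = (\<integral>\<^sup>+\<omega>. \<integral>\<^sup>+\<omega>'. F ((path j u \<omega>, path j u' \<omega>), (path k v \<omega>', path k v' \<omega>')) \<partial>\<P> j k \<partial>\<P> j k)" .
qed

definition approx :: "nat \<Rightarrow> nat \<Rightarrow> (real \<Rightarrow> real) \<Rightarrow> real set \<Rightarrow> real \<Rightarrow> real \<times> real \<times> 'w \<Rightarrow> real" where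
  "approx j k = path_pair.approx_field (path j) (path k) T"

abbreviation "\<N> j k \<equiv> lborel \<Otimes>\<^sub>M lborel \<Otimes>\<^sub>M \<P> j k"

lemma approx_eq:
  "approx j k f A \<epsilon> = (\<lambda>(a, b, \<omega>). ilt_approx f \<epsilon> T (indicator A) (\<lambda>u. a + \<rho> j u \<omega>) (\<lambda>v. b + \<rho> k v \<omega>))"
  if jk: "j \<noteq> k"
proof -
  interpret pp: path_pair "\<P> j k" "path j" "path k" T occ_density by (rule path_pair_system[OF jk])
  have inner: "(LINT u:{0..T}|lborel. rescale f \<epsilon> (y - (a + path j u \<omega>)) * indicator A (a + path j u \<omega>))
      = (LINT u:{0..T}|lborel. rescale f \<epsilon> (y - (a + \<rho> j u \<omega>)) * indicator A (a + \<rho> j u \<omega>) :: real)" for a y \<omega>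
    by (rule set_lebesgue_integral_cong) (auto simp: path_def)
  have "ilt_approx f \<epsilon> T (indicator A) (\<lambda>u. a + path j u \<omega>) (\<lambda>v. b + path k v \<omega>)
      = ilt_approx f \<epsilon> T (indicator A) (\<lambda>u. a + \<rho> j u \<omega>) (\<lambda>v. b + \<rho> k v \<omega>)" for a b \<omega>
    unfolding ilt_approx_def inner by (rule set_lebesgue_integral_cong) (auto simp: path_def)
  then show ?thesis by (simp add: approx_def pp.approx_field_def)
qed

lemma is_ilt_iff:
  "is_ilt M T (indicator A) (\<rho> j) (\<rho> k) \<Lambda> \<longleftrightarrow> (\<forall>f\<in>mollifiers. L2_tendsto (\<N> j k) (approx j k f A) \<Lambda> (at_right 0))"
  if "j \<noteq> k"
  unfolding is_ilt_def approx_eq[OF that, abs_def] ..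

lemma ilt_limit:
  assumes jk: "j \<noteq> k" and A: "A \<in> sets borel" "A \<subseteq> {a..a + h}" "0 \<le> h" and f: "f \<in> mollifiers"
  shows "L2_tendsto (\<N> j k) (approx j k f A) (ilt M T (indicator A) (\<rho> j) (\<rho> k)) (at_right 0)"
proof -
  interpret pp: path_pair "\<P> j k" "path j" "path k" T occ_density by (rule path_pair_system[OF jk])
  have "\<exists>\<Lambda>. is_ilt M T (indicator A) (\<rho> j) (\<rho> k) \<Lambda>"
    unfolding is_ilt_iff[OF jk] approx_def by (rule pp.approx_field_converges[OF A f])
  then have "is_ilt M T (indicator A) (\<rho> j) (\<rho> k) (ilt M T (indicator A) (\<rho> j) (\<rho> k))"
    unfolding ilt_def by (rule someI_ex)
  then show ?thesis unfolding is_ilt_iff[OF jk] using f by (rule bspec)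
qed

text \<open>The approximations are additive in the test function, and so are their limits.\<close>

lemma ilt_increment_limit:
  assumes jk: "j \<noteq> k" and st: "0 \<le> s" "s \<le> t" and f: "f \<in> mollifiers"
  shows "L2_tendsto (\<N> j k) (approx j k f {s<..t})
    (\<lambda>z. ilt M T (indicator {0..t}) (\<rho> j) (\<rho> k) z - ilt M T (indicator {0..s}) (\<rho> j) (\<rho> k) z) (at_right 0)"
proof (rule L2_tendsto_cong[OF L2_tendsto_diff])
  interpret pp: path_pair "\<P> j k" "path j" "path k" T occ_density by (rule path_pair_system[OF jk])
  show "L2_tendsto (\<N> j k) (approx j k f {0..t}) (ilt M T (indicator {0..t}) (\<rho> j) (\<rho> k)) (at_right 0)"
    using st by (intro ilt_limit[OF jk _ _ _ f, of _ 0 t]) auto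
  show "L2_tendsto (\<N> j k) (approx j k f {0..s}) (ilt M T (indicator {0..s}) (\<rho> j) (\<rho> k)) (at_right 0)"
    using st by (intro ilt_limit[OF jk _ _ _ f, of _ 0 s]) auto
  show "\<forall>\<^sub>F \<epsilon> in at_right 0. \<forall>z\<in>space (\<N> j k). approx j k f {0..t} \<epsilon> z - approx j k f {0..s} \<epsilon> z = approx j k f {s<..t} \<epsilon> z"
    using eventually_at_right_less[of 0]
  proof eventually_elim
    case (elim \<epsilon>)
    show ?case
    proof
      fix z :: "real \<times> real \<times> 'w" assume z: "z \<in> space (\<N> j k)"
      have sm: "ennreal (approx j k f A \<epsilon> z) = pp.smear (rescale f \<epsilon>) (indicator A) z" "0 \<le> approx j k f A \<epsilon> z"
        if "A \<in> sets borel" for A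
        unfolding approx_def by (rule pp.approx_field_smear[OF f elim that z])+
      note [measurable] = rescale_mollifier(1)[OF f elim]
      have "ennreal (approx j k f {0..t} \<epsilon> z) = pp.smear (rescale f \<epsilon>) (indicator {0..t}) z"
        by (rule sm) simp
      also have "\<dots> = pp.smear (rescale f \<epsilon>) (indicator {0..s}) z + pp.smear (rescale f \<epsilon>) (indicator {s<..t}) z"
      proof -
        have "indicator {0..t} = (\<lambda>y. indicator {0..s} y + (indicator {s<..t} y :: ennreal))"
          using st by (intro ext) (auto simp: indicator_def)
        then show ?thesis using pp.smear_add[OF _ _ _ z] by simp
      qed
      also have "\<dots> = ennreal (approx j k f {0..s} \<epsilon> z) + ennreal (approx j k f {s<..t} \<epsilon> z)"
        by (subst (1 2) sm) simp_all
      also have "\<dots> = ennreal (approx j k f {0..s} \<epsilon> z + approx j k f {s<..t} \<epsilon> z)"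
        by (rule ennreal_plus[symmetric]) (rule sm, simp)+
      finally have "approx j k f {0..t} \<epsilon> z = approx j k f {0..s} \<epsilon> z + approx j k f {s<..t} \<epsilon> z"
        using sm(2)[of "{0..t}"] sm(2)[of "{0..s}"] sm(2)[of "{s<..t}"] by (subst (asm) ennreal_inj) simp_all
      then show "approx j k f {0..t} \<epsilon> z - approx j k f {0..s} \<epsilon> z = approx j k f {s<..t} \<epsilon> z" by simp
    qed
  qed
qed

end

section \<open>Inserting the Poisson points\<close>

context charged_system
begin

definition at_points :: "nat \<times> nat \<Rightarrow> (real \<times> real \<times> 'w \<Rightarrow> 'b) \<Rightarrow> 'w \<Rightarrow> 'b" where
  "at_points p D \<omega> = D (x (fst p) \<omega>, x (snd p) \<omega>, \<omega>)"

abbreviation "\<N>\<^sub>p p \<equiv> \<N> (fst p) (snd p)"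

lemma points_measurable:
  assumes "Positions \<in> I" "Motion (fst p) \<in> I" "Motion (snd p) \<in> I"
  shows "(\<lambda>\<omega>. (x (fst p) \<omega>, x (snd p) \<omega>, \<omega>)) \<in> measurable (\<A> I) (\<N>\<^sub>p p)"
  using position_measurable[OF assms(1)] measurable_ident_path_pair[OF assms(2,3)]
  by (intro measurable_Pair) simp_all

lemma at_points_measurable:
  assumes "Positions \<in> I" "Motion (fst p) \<in> I" "Motion (snd p) \<in> I" and D: "D \<in> measurable (\<N>\<^sub>p p) S"
  shows "at_points p D \<in> measurable (\<A> I) S"
  unfolding at_points_def[abs_def] by (rule measurable_compose[OF points_measurable[OF assms(1-3)] D])

lemma at_points_measurable_M: "D \<in> measurable (\<N>\<^sub>p p) S \<Longrightarrow> at_points p D \<in> measurable M S"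
  by (rule measurable_source_algebra[OF at_points_measurable[of UNIV]]) simp_all

lemma sigma_finite_path_pair: "sigma_finite_measure (\<P> j k)"
  by (rule prob_space_imp_sigma_finite[OF prob_space_path_pair])

text \<open>
  The points are independent of the two paths, and \<open>h\<close> is measurable with respect to the paths in
  its last argument; so the paths may be replaced by an independent copy.
\<close>

lemma nn_integral_at_points:
  fixes h :: "real \<times> real \<times> 'w \<Rightarrow> ennreal"
  assumes h [measurable]: "h \<in> borel_measurable (\<N>\<^sub>p p)"
  shows "(\<integral>\<^sup>+\<omega>. at_points p h \<omega> \<partial>M)
    = (\<integral>\<^sup>+\<omega>. (\<integral>\<^sup>+\<omega>'. h (x (fst p) \<omega>, x (snd p) \<omega>, \<omega>') \<partial>\<P> (fst p) (snd p)) \<partial>M)"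
proof -
  let ?P = "\<P> (fst p) (snd p)"
  have re: "(\<lambda>z. (fst (fst z), snd (fst z), snd z)) \<in> measurable ((borel \<Otimes>\<^sub>M borel) \<Otimes>\<^sub>M ?P) (\<N>\<^sub>p p)"
    by measurable
  have F: "(\<lambda>z. h (fst (fst z), snd (fst z), snd z)) \<in> borel_measurable ((borel \<Otimes>\<^sub>M borel) \<Otimes>\<^sub>M ?P)"
    by (rule measurable_compose[OF re h])
  have X: "(\<lambda>\<omega>. (x (fst p) \<omega>, x (snd p) \<omega>)) \<in> measurable (\<A> {Positions}) (borel \<Otimes>\<^sub>M borel)"
    by (intro measurable_Pair position_measurable) simp_all
  have Y: "(\<lambda>\<omega>. \<omega>) \<in> measurable (\<A> {Motion (fst p), Motion (snd p)}) ?P"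
    by (rule measurable_ident_path_pair) simp_all
  have "(\<integral>\<^sup>+\<omega>. at_points p h \<omega> \<partial>M) = (\<integral>\<^sup>+\<omega>. \<integral>\<^sup>+\<omega>'. h (x (fst p) \<omega>, x (snd p) \<omega>, \<omega>') \<partial>M \<partial>M)"
    using nn_integral_independent_sources[OF _ X Y F]
    by (simp add: at_points_def)
  also have "\<dots> = (\<integral>\<^sup>+\<omega>. \<integral>\<^sup>+\<omega>'. h (x (fst p) \<omega>, x (snd p) \<omega>, \<omega>') \<partial>?P \<partial>M)"
  proof (intro nn_integral_cong nn_integral_path_pair[symmetric])
    fix \<omega>
    have "(\<lambda>\<omega>'. (x (fst p) \<omega>, x (snd p) \<omega>, \<omega>')) \<in> measurable ?P (\<N>\<^sub>p p)" by measurable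
    then show "(\<lambda>\<omega>'. h (x (fst p) \<omega>, x (snd p) \<omega>, \<omega>')) \<in> borel_measurable ?P"
      by (rule measurable_compose[OF _ h])
  qed
  finally show ?thesis .
qed

lemma path_section_measurable:
  fixes h :: "real \<times> real \<times> 'w \<Rightarrow> ennreal"
  assumes h: "h \<in> borel_measurable (\<N> j k)"
  shows "(\<lambda>z. \<integral>\<^sup>+\<omega>. h (fst z, snd z, \<omega>) \<partial>\<P> j k) \<in> borel_measurable (lborel \<Otimes>\<^sub>M lborel)"
proof -
  interpret P: sigma_finite_measure "\<P> j k" by (rule sigma_finite_path_pair)
  have re: "(\<lambda>z. (fst (fst z), snd (fst z), snd z)) \<in> measurable ((lborel \<Otimes>\<^sub>M lborel) \<Otimes>\<^sub>M \<P> j k) (\<N> j k)"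
    by measurable
  have "(\<lambda>(z, \<omega>). h (fst z, snd z, \<omega>)) \<in> borel_measurable ((lborel \<Otimes>\<^sub>M lborel) \<Otimes>\<^sub>M \<P> j k)"
    using measurable_compose[OF re h] by (simp add: split_def)
  then show ?thesis by (rule P.borel_measurable_nn_integral)
qed

lemma nn_integral_path_section:
  fixes h :: "real \<times> real \<times> 'w \<Rightarrow> ennreal"
  assumes h: "h \<in> borel_measurable (\<N> j k)"
  shows "(\<integral>\<^sup>+z. \<integral>\<^sup>+\<omega>. h (fst z, snd z, \<omega>) \<partial>\<P> j k \<partial>(lborel \<Otimes>\<^sub>M lborel)) = (\<integral>\<^sup>+z. h z \<partial>\<N> j k)"
proof -
  interpret P: sigma_finite_measure "\<P> j k" by (rule sigma_finite_path_pair)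
  interpret LP: pair_sigma_finite lborel "\<P> j k" ..
  have "(\<integral>\<^sup>+z. \<integral>\<^sup>+\<omega>. h (fst z, snd z, \<omega>) \<partial>\<P> j k \<partial>(lborel \<Otimes>\<^sub>M lborel))
      = (\<integral>\<^sup>+a. \<integral>\<^sup>+b. \<integral>\<^sup>+\<omega>. h (a, b, \<omega>) \<partial>\<P> j k \<partial>lborel \<partial>lborel)"
    using lborel.nn_integral_fst[OF path_section_measurable[OF h]] by simp
  also have "\<dots> = (\<integral>\<^sup>+a. \<integral>\<^sup>+q. h (a, q) \<partial>(lborel \<Otimes>\<^sub>M \<P> j k) \<partial>lborel)"
  proof (rule nn_integral_cong)
    fix a :: real
    have "(\<lambda>q. (a, q)) \<in> measurable (lborel \<Otimes>\<^sub>M \<P> j k) (\<N> j k)" by measurable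
    from P.nn_integral_fst[OF measurable_compose[OF this h]]
    show "(\<integral>\<^sup>+b. \<integral>\<^sup>+\<omega>. h (a, b, \<omega>) \<partial>\<P> j k \<partial>lborel) = (\<integral>\<^sup>+q. h (a, q) \<partial>(lborel \<Otimes>\<^sub>M \<P> j k))"
      by simp
  qed
  also have "\<dots> = (\<integral>\<^sup>+z. h z \<partial>\<N> j k)"
    by (rule LP.P.nn_integral_fst[OF h])
  finally show ?thesis .
qed

text \<open>
  If the average over the paths does not depend on the pair, then only the sum of the laws of the
  pairs of points matters, and this is dominated by planar Lebesgue measure.
\<close>

lemma sum_at_points_le:
  fixes h :: "nat \<times> nat \<Rightarrow> real \<times> real \<times> 'w \<Rightarrow> ennreal"
  assumes J: "finite J" "J \<subseteq> distinct_pairs" and h: "\<And>p. p \<in> J \<Longrightarrow> h p \<in> borel_measurable (\<N>\<^sub>p p)"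
    and g: "g \<in> borel_measurable (lborel \<Otimes>\<^sub>M lborel)"
    and sec: "\<And>p z. p \<in> J \<Longrightarrow> (\<integral>\<^sup>+\<omega>. h p (fst z, snd z, \<omega>) \<partial>\<P> (fst p) (snd p)) = g z"
  shows "(\<Sum>p\<in>J. \<integral>\<^sup>+\<omega>. at_points p (h p) \<omega> \<partial>M) \<le> (\<integral>\<^sup>+z. g z \<partial>(lborel \<Otimes>\<^sub>M lborel))"
proof -
  have "(\<Sum>p\<in>J. \<integral>\<^sup>+\<omega>. at_points p (h p) \<omega> \<partial>M) = (\<Sum>p\<in>J. \<integral>\<^sup>+\<omega>. g (x (fst p) \<omega>, x (snd p) \<omega>) \<partial>M)"
  proof (rule sum.cong[OF refl])
    fix p assume p: "p \<in> J"
    show "(\<integral>\<^sup>+\<omega>. at_points p (h p) \<omega> \<partial>M) = (\<integral>\<^sup>+\<omega>. g (x (fst p) \<omega>, x (snd p) \<omega>) \<partial>M)"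
      unfolding nn_integral_at_points[OF h[OF p]]
      using sec[OF p, of "(x (fst p) \<omega>, x (snd p) \<omega>)" for \<omega>] by simp
  qed
  also have "\<dots> \<le> (\<integral>\<^sup>+p. \<integral>\<^sup>+\<omega>. g (x (fst p) \<omega>, x (snd p) \<omega>) \<partial>M \<partial>count_space distinct_pairs)"
    by (rule sum_le_nn_integral_count_space[OF J])
  also have "\<dots> = (\<integral>\<^sup>+z. g z \<partial>(lborel \<Otimes>\<^sub>M lborel))"
    by (rule poisson_pairs[OF field g])
  finally show ?thesis .
qed

lemma at_points_le:
  fixes h :: "real \<times> real \<times> 'w \<Rightarrow> ennreal"
  assumes p: "p \<in> distinct_pairs" and h: "h \<in> borel_measurable (\<N>\<^sub>p p)"
  shows "(\<integral>\<^sup>+\<omega>. at_points p h \<omega> \<partial>M) \<le> (\<integral>\<^sup>+z. h z \<partial>\<N>\<^sub>p p)"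
  using sum_at_points_le[of "{p}" "\<lambda>_. h", OF _ _ _ path_section_measurable[OF h]] p h
  by (simp add: nn_integral_path_section[OF h])

lemma square_integrable_at_points:
  assumes p: "p \<in> distinct_pairs" and D: "square_integrable (\<N>\<^sub>p p) D"
  shows "square_integrable M (at_points p D)"
    and "(\<integral>\<omega>. (at_points p D \<omega>)\<^sup>2 \<partial>M) \<le> (\<integral>z. (D z)\<^sup>2 \<partial>\<N>\<^sub>p p)"
proof -
  note Dm = square_integrableD(1)[OF D]
  have h: "(\<lambda>z. ennreal ((D z)\<^sup>2)) \<in> borel_measurable (\<N>\<^sub>p p)" using Dm by simp
  have "(\<integral>\<^sup>+\<omega>. ennreal ((at_points p D \<omega>)\<^sup>2) \<partial>M) = (\<integral>\<^sup>+\<omega>. at_points p (\<lambda>z. ennreal ((D z)\<^sup>2)) \<omega> \<partial>M)"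
    by (simp add: at_points_def)
  also have "\<dots> \<le> (\<integral>\<^sup>+z. ennreal ((D z)\<^sup>2) \<partial>\<N>\<^sub>p p)" by (rule at_points_le[OF p h])
  also have "\<dots> = ennreal (\<integral>z. (D z)\<^sup>2 \<partial>\<N>\<^sub>p p)" by (rule nn_integral_square[OF D])
  finally have le: "(\<integral>\<^sup>+\<omega>. ennreal ((at_points p D \<omega>)\<^sup>2) \<partial>M) \<le> ennreal (\<integral>z. (D z)\<^sup>2 \<partial>\<N>\<^sub>p p)" .
  show sq: "square_integrable M (at_points p D)"
    using le by (intro square_integrable_nn at_points_measurable_M Dm) (simp add: order.strict_trans1)
  show "(\<integral>\<omega>. (at_points p D \<omega>)\<^sup>2 \<partial>M) \<le> (\<integral>z. (D z)\<^sup>2 \<partial>\<N>\<^sub>p p)"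
    using le unfolding nn_integral_square[OF sq] by (subst (asm) ennreal_le_iff) simp_all
qed

text \<open>
  For given starting points the second moment of an approximation only involves the
  two-dimensional marginal laws of the two paths, and these are the same for all particles.
\<close>

lemma approx_second_moment:
  assumes jk: "j \<noteq> k" and A [measurable]: "A \<in> sets borel" and f: "f \<in> mollifiers" and \<epsilon>: "0 < \<epsilon>"
  shows "(\<integral>\<^sup>+\<omega>. ennreal ((approx j k f A \<epsilon> (a, b, \<omega>))\<^sup>2) \<partial>\<P> j k)
    = (\<integral>\<^sup>+\<tau>. \<integral>\<^sup>+\<omega>. \<integral>\<^sup>+\<omega>'.
        (ennreal (rescale f \<epsilon> (b + path 0 (fst (snd \<tau>)) \<omega>' - (a + path 0 (fst (fst \<tau>)) \<omega>))) * indicator A (a + path 0 (fst (fst \<tau>)) \<omega>))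
        * (ennreal (rescale f \<epsilon> (b + path 0 (snd (snd \<tau>)) \<omega>' - (a + path 0 (snd (fst \<tau>)) \<omega>))) * indicator A (a + path 0 (snd (fst \<tau>)) \<omega>))
        \<partial>M \<partial>M \<partial>((time_measure T \<Otimes>\<^sub>M time_measure T) \<Otimes>\<^sub>M (time_measure T \<Otimes>\<^sub>M time_measure T)))"
proof -
  interpret pp: path_pair "\<P> j k" "path j" "path k" T occ_density by (rule path_pair_system[OF jk])
  note [measurable] = rescale_mollifier(1)[OF f \<epsilon>]
  define Q where "Q = (\<lambda>z::(real \<times> real) \<times> (real \<times> real).
      (ennreal (rescale f \<epsilon> (b + fst (snd z) - (a + fst (fst z)))) * indicator A (a + fst (fst z)))
      * (ennreal (rescale f \<epsilon> (b + snd (snd z) - (a + snd (fst z)))) * indicator A (a + snd (fst z))))"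
  have Q [measurable]: "Q \<in> borel_measurable ((borel \<Otimes>\<^sub>M borel) \<Otimes>\<^sub>M (borel \<Otimes>\<^sub>M borel))"
    unfolding Q_def by measurable
  have pm: "path i u \<in> borel_measurable M" for i u
    by (rule measurable_source_algebra[OF path_measurable_each])
  have times: "(\<integral>\<^sup>+\<omega>. h (path i u \<omega>, path i u' \<omega>) \<partial>M) = (\<integral>\<^sup>+\<omega>. h (path i' u \<omega>, path i' u' \<omega>) \<partial>M)"
    if "h \<in> borel_measurable (borel \<Otimes>\<^sub>M borel)" for h :: "real \<times> real \<Rightarrow> ennreal" and i i' u u'
    unfolding path_def by (rule nn_integral_two_times[OF _ _ that]) auto
  have [measurable]: "path j u \<in> borel_measurable (\<P> j k)" "path k u \<in> borel_measurable (\<P> j k)" for u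
    using motion_measurable_path_pair[of "max 0 u"] by (simp_all add: path_def[abs_def])
  note [measurable] = pm
  have eq: "(\<integral>\<^sup>+\<omega>. \<integral>\<^sup>+\<omega>'. Q ((path j u \<omega>, path j u' \<omega>), (path k v \<omega>', path k v' \<omega>')) \<partial>\<P> j k \<partial>\<P> j k)
      = (\<integral>\<^sup>+\<omega>. \<integral>\<^sup>+\<omega>'. Q ((path 0 u \<omega>, path 0 u' \<omega>), (path 0 v \<omega>', path 0 v' \<omega>')) \<partial>M \<partial>M)" for u u' v v'
  proof -
    define R where "R c = (\<integral>\<^sup>+\<omega>'. Q (c, (path 0 v \<omega>', path 0 v' \<omega>')) \<partial>M)" for c
    have R: "R \<in> borel_measurable (borel \<Otimes>\<^sub>M borel)" unfolding R_def[abs_def] by measurable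
    have "(\<integral>\<^sup>+\<omega>'. Q (c, (path k v \<omega>', path k v' \<omega>')) \<partial>\<P> j k) = R c" for c
    proof -
      have Qc: "(\<lambda>d. Q (c, d)) \<in> borel_measurable (borel \<Otimes>\<^sub>M borel)"
        by (rule measurable_compose[OF measurable_Pair1' Q]) (simp add: space_pair_measure)
      from times[OF this, of k v v' 0]
      have "(\<integral>\<^sup>+\<omega>'. Q (c, (path k v \<omega>', path k v' \<omega>')) \<partial>M) = R c" by (simp only: R_def)
      moreover have "(\<integral>\<^sup>+\<omega>'. Q (c, (path k v \<omega>', path k v' \<omega>')) \<partial>\<P> j k) = (\<integral>\<^sup>+\<omega>'. Q (c, (path k v \<omega>', path k v' \<omega>')) \<partial>M)"
        by (rule nn_integral_path_pair, rule measurable_compose[OF _ Qc]) measurable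
      ultimately show ?thesis by simp
    qed
    then have "(\<integral>\<^sup>+\<omega>. \<integral>\<^sup>+\<omega>'. Q ((path j u \<omega>, path j u' \<omega>), (path k v \<omega>', path k v' \<omega>')) \<partial>\<P> j k \<partial>\<P> j k)
        = (\<integral>\<^sup>+\<omega>. R (path j u \<omega>, path j u' \<omega>) \<partial>\<P> j k)" by simp
    also have "\<dots> = (\<integral>\<^sup>+\<omega>. R (path j u \<omega>, path j u' \<omega>) \<partial>M)"
      by (rule nn_integral_path_pair, rule measurable_compose[OF _ R]) measurable
    also have "\<dots> = (\<integral>\<^sup>+\<omega>. R (path 0 u \<omega>, path 0 u' \<omega>) \<partial>M)" by (rule times[OF R])
    finally show ?thesis by (simp only: R_def)
  qed
  have "(\<integral>\<^sup>+\<omega>. ennreal ((approx j k f A \<epsilon> (a, b, \<omega>))\<^sup>2) \<partial>\<P> j k)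
      = (\<integral>\<^sup>+\<omega>. pp.smear (rescale f \<epsilon>) (indicator A) (a, b, \<omega>) * pp.smear (rescale f \<epsilon>) (indicator A) (a, b, \<omega>) \<partial>\<P> j k)"
  proof (rule nn_integral_cong)
    fix \<omega> assume "\<omega> \<in> space (\<P> j k)"
    then have z: "(a, b, \<omega>) \<in> space (\<N> j k)" by (simp add: space_pair_measure)
    show "ennreal ((approx j k f A \<epsilon> (a, b, \<omega>))\<^sup>2)
      = pp.smear (rescale f \<epsilon>) (indicator A) (a, b, \<omega>) * pp.smear (rescale f \<epsilon>) (indicator A) (a, b, \<omega>)"
      unfolding approx_def pp.approx_field_smear(1)[OF f \<epsilon> A z, symmetric]
      using pp.approx_field_smear(2)[OF f \<epsilon> A z] by (simp only: power2_eq_square ennreal_mult)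
  qed
  also have "\<dots> = (\<integral>\<^sup>+\<tau>. \<integral>\<^sup>+\<omega>. \<integral>\<^sup>+\<omega>'. Q ((path j (fst (fst \<tau>)) \<omega>, path j (snd (fst \<tau>)) \<omega>), (path k (fst (snd \<tau>)) \<omega>', path k (snd (snd \<tau>)) \<omega>'))
      \<partial>\<P> j k \<partial>\<P> j k \<partial>((time_measure T \<Otimes>\<^sub>M time_measure T) \<Otimes>\<^sub>M (time_measure T \<Otimes>\<^sub>M time_measure T)))"
    by (subst pp.nn_integral_smear_square_path) (simp_all add: Q_def)
  also have "\<dots> = (\<integral>\<^sup>+\<tau>. \<integral>\<^sup>+\<omega>. \<integral>\<^sup>+\<omega>'. Q ((path 0 (fst (fst \<tau>)) \<omega>, path 0 (snd (fst \<tau>)) \<omega>), (path 0 (fst (snd \<tau>)) \<omega>', path 0 (snd (snd \<tau>)) \<omega>'))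
      \<partial>M \<partial>M \<partial>((time_measure T \<Otimes>\<^sub>M time_measure T) \<Otimes>\<^sub>M (time_measure T \<Otimes>\<^sub>M time_measure T)))"
    unfolding eq ..
  finally show ?thesis by (simp only: Q_def fst_conv snd_conv)
qed

text \<open>
  Twice the constant in the bound on the energy, because the limit is compared with approximations.
\<close>

definition moment_const :: real where
  "moment_const = 4 * occ_const\<^sup>2 / (2 * \<alpha> - 1)"

text \<open>
  Inserting the points preserves convergence in mean square, and the second moments add up to at
  most the second moment of a single field, which is of order \<open>h\<^sup>2\<^sup>\<alpha>\<close> for a test set of diameter \<open>h\<close>.
\<close>

lemma sum_second_moments_le:
  assumes J: "finite J" "J \<subseteq> distinct_pairs" and A: "A \<in> sets borel" "A \<subseteq> {a..a + h}" "0 \<le> h" and f: "f \<in> mollifiers"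
    and D: "\<And>p. p \<in> J \<Longrightarrow> L2_tendsto (\<N>\<^sub>p p) (approx (fst p) (snd p) f A) (D p) (at_right 0)"
  shows "(\<Sum>p\<in>J. \<integral>\<omega>. (at_points p (D p) \<omega>)\<^sup>2 \<partial>M) \<le> moment_const * h powr (2 * \<alpha>)"
proof -
  interpret p01: path_pair "\<P> 0 1" "path 0" "path 1" T occ_density by (rule path_pair_system) simp
  define X where "X p = approx (fst p) (snd p) f A" for p
  have sqX: "\<forall>\<^sub>F \<epsilon> in at_right 0. \<forall>p\<in>J. square_integrable (\<N>\<^sub>p p) (X p \<epsilon>)"
    using D by (intro eventually_ball_finite J) (simp add: L2_tendsto_def X_def)
  have sqD: "square_integrable (\<N>\<^sub>p p) (D p)" if "p \<in> J" for p
    using D[OF that] by (simp add: L2_tendsto_def)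
  have "\<forall>\<^sub>F \<epsilon> in at_right 0. square_integrable (\<N> 0 1) (approx 0 1 f A \<epsilon>)"
    unfolding approx_def by (rule p01.eventually_approx_field_square_integrable[OF A f])
  note ev = sqX this eventually_at_right_less[of "0::real"]
  have lim01: "((\<lambda>\<epsilon>. \<integral>z. (approx 0 1 f A \<epsilon> z)\<^sup>2 \<partial>\<N> 0 1) \<longlongrightarrow> p01.energy A 0) (at_right 0)"
    unfolding approx_def by (rule p01.approx_field_energy[OF A f])
  have "((\<lambda>\<epsilon>. 2 * (\<integral>z. (approx 0 1 f A \<epsilon> z)\<^sup>2 \<partial>\<N> 0 1) + 2 * (\<Sum>p\<in>J. \<integral>z. (X p \<epsilon> z - D p z)\<^sup>2 \<partial>\<N>\<^sub>p p))
      \<longlongrightarrow> 2 * p01.energy A 0 + 2 * (\<Sum>p\<in>J. 0)) (at_right 0)"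
    using D by (intro tendsto_intros lim01) (simp add: L2_tendsto_def X_def)
  moreover have "\<forall>\<^sub>F \<epsilon> in at_right 0. (\<Sum>p\<in>J. \<integral>\<omega>. (at_points p (D p) \<omega>)\<^sup>2 \<partial>M)
      \<le> 2 * (\<integral>z. (approx 0 1 f A \<epsilon> z)\<^sup>2 \<partial>\<N> 0 1) + 2 * (\<Sum>p\<in>J. \<integral>z. (X p \<epsilon> z - D p z)\<^sup>2 \<partial>\<N>\<^sub>p p)"
    using ev
  proof eventually_elim
    case (elim \<epsilon>)
    have sqXe: "square_integrable (\<N>\<^sub>p p) (X p \<epsilon>)" if "p \<in> J" for p using elim(1) that by blast
    have dist: "p \<in> distinct_pairs" "fst p \<noteq> snd p" if "p \<in> J" for p
      using J(2) that by (auto simp: distinct_pairs_def)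
    have first: "(\<Sum>p\<in>J. \<integral>\<omega>. (at_points p (X p \<epsilon>) \<omega>)\<^sup>2 \<partial>M) \<le> (\<integral>z. (approx 0 1 f A \<epsilon> z)\<^sup>2 \<partial>\<N> 0 1)"
    proof -
      have m01: "(\<lambda>z. ennreal ((approx 0 1 f A \<epsilon> z)\<^sup>2)) \<in> borel_measurable (\<N> 0 1)"
        using square_integrableD(1)[OF elim(2)] by simp
      have "ennreal (\<Sum>p\<in>J. \<integral>\<omega>. (at_points p (X p \<epsilon>) \<omega>)\<^sup>2 \<partial>M)
          = (\<Sum>p\<in>J. ennreal (\<integral>\<omega>. (at_points p (X p \<epsilon>) \<omega>)\<^sup>2 \<partial>M))"
        by (rule sum_ennreal[symmetric]) simp
      also have "\<dots> = (\<Sum>p\<in>J. \<integral>\<^sup>+\<omega>. at_points p (\<lambda>z. ennreal ((X p \<epsilon> z)\<^sup>2)) \<omega> \<partial>M)"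
      proof (rule sum.cong[OF refl])
        fix p assume p: "p \<in> J"
        show "ennreal (\<integral>\<omega>. (at_points p (X p \<epsilon>) \<omega>)\<^sup>2 \<partial>M) = (\<integral>\<^sup>+\<omega>. at_points p (\<lambda>z. ennreal ((X p \<epsilon> z)\<^sup>2)) \<omega> \<partial>M)"
          using nn_integral_square[OF square_integrable_at_points(1)[OF dist(1)[OF p] sqXe[OF p]]]
          by (simp add: at_points_def)
      qed
      also have "\<dots> \<le> (\<integral>\<^sup>+z. \<integral>\<^sup>+\<omega>. ennreal ((approx 0 1 f A \<epsilon> (fst z, snd z, \<omega>))\<^sup>2) \<partial>\<P> 0 1 \<partial>(lborel \<Otimes>\<^sub>M lborel))"
      proof (rule sum_at_points_le[OF J _ path_section_measurable[OF m01]])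
        fix p assume p: "p \<in> J"
        show "(\<lambda>z. ennreal ((X p \<epsilon> z)\<^sup>2)) \<in> borel_measurable (\<N>\<^sub>p p)"
          using square_integrableD(1)[OF sqXe[OF p]] by simp
        fix z :: "real \<times> real"
        show "(\<integral>\<^sup>+\<omega>. ennreal ((X p \<epsilon> (fst z, snd z, \<omega>))\<^sup>2) \<partial>\<P> (fst p) (snd p))
          = (\<integral>\<^sup>+\<omega>. ennreal ((approx 0 1 f A \<epsilon> (fst z, snd z, \<omega>))\<^sup>2) \<partial>\<P> 0 1)"
          unfolding X_def approx_second_moment[OF dist(2)[OF p] A(1) f elim(3)]
            approx_second_moment[OF zero_neq_one A(1) f elim(3)] ..
      qed
      also have "\<dots> = (\<integral>\<^sup>+z. ennreal ((approx 0 1 f A \<epsilon> z)\<^sup>2) \<partial>\<N> 0 1)"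
        by (rule nn_integral_path_section[OF m01])
      also have "\<dots> = ennreal (\<integral>z. (approx 0 1 f A \<epsilon> z)\<^sup>2 \<partial>\<N> 0 1)"
        by (rule nn_integral_square[OF elim(2)])
      finally show ?thesis by (subst (asm) ennreal_le_iff) simp_all
    qed
    have each: "(\<integral>\<omega>. (at_points p (D p) \<omega>)\<^sup>2 \<partial>M)
        \<le> 2 * (\<integral>\<omega>. (at_points p (X p \<epsilon>) \<omega>)\<^sup>2 \<partial>M) + 2 * (\<integral>z. (X p \<epsilon> z - D p z)\<^sup>2 \<partial>\<N>\<^sub>p p)" if p: "p \<in> J" for p
    proof -
      have "square_integrable M (\<lambda>_. 0)" by (simp add: square_integrable_def)
      from integral_power2_diff_le[OF this square_integrable_at_points(1)[OF dist(1)[OF p] sqXe[OF p]]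
          square_integrable_at_points(1)[OF dist(1)[OF p] sqD[OF p]]]
      have "(\<integral>\<omega>. (at_points p (D p) \<omega>)\<^sup>2 \<partial>M)
          \<le> 2 * (\<integral>\<omega>. (at_points p (X p \<epsilon>) \<omega>)\<^sup>2 \<partial>M) + 2 * (\<integral>\<omega>. (at_points p (X p \<epsilon>) \<omega> - at_points p (D p) \<omega>)\<^sup>2 \<partial>M)"
        by simp
      moreover have "(\<integral>\<omega>. (at_points p (X p \<epsilon>) \<omega> - at_points p (D p) \<omega>)\<^sup>2 \<partial>M) \<le> (\<integral>z. (X p \<epsilon> z - D p z)\<^sup>2 \<partial>\<N>\<^sub>p p)"
        using square_integrable_at_points(2)[OF dist(1)[OF p] square_integrable_diff[OF sqXe[OF p] sqD[OF p]]]
        by (simp add: at_points_def)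
      ultimately show ?thesis by linarith
    qed
    have "(\<Sum>p\<in>J. \<integral>\<omega>. (at_points p (D p) \<omega>)\<^sup>2 \<partial>M)
        \<le> (\<Sum>p\<in>J. 2 * (\<integral>\<omega>. (at_points p (X p \<epsilon>) \<omega>)\<^sup>2 \<partial>M) + 2 * (\<integral>z. (X p \<epsilon> z - D p z)\<^sup>2 \<partial>\<N>\<^sub>p p))"
      by (rule sum_mono) (rule each)
    also have "\<dots> = 2 * (\<Sum>p\<in>J. \<integral>\<omega>. (at_points p (X p \<epsilon>) \<omega>)\<^sup>2 \<partial>M) + 2 * (\<Sum>p\<in>J. \<integral>z. (X p \<epsilon> z - D p z)\<^sup>2 \<partial>\<N>\<^sub>p p)"
      by (simp only: sum.distrib sum_distrib_left)
    finally show ?case using first by linarith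
  qed
  ultimately have "(\<Sum>p\<in>J. \<integral>\<omega>. (at_points p (D p) \<omega>)\<^sup>2 \<partial>M) \<le> 2 * p01.energy A 0 + 2 * (\<Sum>p\<in>J. 0)"
    by (rule tendsto_lowerbound) simp
  also have "\<dots> \<le> 2 * (2 * occ_const\<^sup>2 / (2 * \<alpha> - 1) * h powr (2 * \<alpha>))"
    using p01.energy_le[OF A \<alpha>(1) occ_density_le occ_const_nonneg] by simp
  finally show ?thesis by (simp add: moment_const_def)
qed

end

section \<open>Charges decouple the pairs\<close>

context charged_system
begin

lemma charge_values: "AE \<omega> in M. \<sigma> j \<omega> = 1 \<or> \<sigma> j \<omega> = - 1"
proof -
  note [measurable] = charge(1)
  have "prob ({\<omega> \<in> space M. \<sigma> j \<omega> = 1} \<union> {\<omega> \<in> space M. \<sigma> j \<omega> = - 1})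
      = prob {\<omega> \<in> space M. \<sigma> j \<omega> = 1} + prob {\<omega> \<in> space M. \<sigma> j \<omega> = - 1}"
    by (rule finite_measure_Union) auto
  then have "prob ({\<omega> \<in> space M. \<sigma> j \<omega> = 1} \<union> {\<omega> \<in> space M. \<sigma> j \<omega> = - 1}) = 1"
    by (simp add: charge)
  from AE_prob_1[OF this] show ?thesis by eventually_elim auto
qed

lemma charge_mean: "integrable M (\<sigma> j)" "expectation (\<sigma> j) = 0"
proof -
  note [measurable] = charge(1)
  have "AE \<omega> in M. norm (\<sigma> j \<omega>) \<le> 1" using charge_values[of j] by eventually_elim auto
  then show "integrable M (\<sigma> j)" by (intro integrable_const_bound) auto
  have "expectation (\<sigma> j) = (\<integral>\<omega>. indicator {\<omega> \<in> space M. \<sigma> j \<omega> = 1} \<omega> - indicator {\<omega> \<in> space M. \<sigma> j \<omega> = - 1} \<omega> \<partial>M)"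
  proof (rule integral_cong_AE)
    show "AE \<omega> in M. \<sigma> j \<omega> = indicator {\<omega> \<in> space M. \<sigma> j \<omega> = 1} \<omega> - indicator {\<omega> \<in> space M. \<sigma> j \<omega> = - 1} \<omega>"
      using charge_values[of j] AE_space by eventually_elim (auto simp: indicator_def)
  qed measurable
  also have "\<dots> = prob {\<omega> \<in> space M. \<sigma> j \<omega> = 1} - prob {\<omega> \<in> space M. \<sigma> j \<omega> = - 1}"
    by (subst Bochner_Integration.integral_diff) (simp_all add: emeasure_eq_measure)
  also have "\<dots> = 0" by (simp only: charge diff_self)
  finally show "expectation (\<sigma> j) = 0" .
qed

definition charged_term :: "(nat \<times> nat \<Rightarrow> real \<times> real \<times> 'w \<Rightarrow> real) \<Rightarrow> nat \<times> nat \<Rightarrow> 'w \<Rightarrow> real" where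
  "charged_term D p \<omega> = \<sigma> (fst p) \<omega> * \<sigma> (snd p) \<omega> * at_points p (D p) \<omega>"

context
  fixes D :: "nat \<times> nat \<Rightarrow> real \<times> real \<times> 'w \<Rightarrow> real"
begin

lemma charged_term_square:
  assumes p: "p \<in> distinct_pairs" and D: "square_integrable (\<N>\<^sub>p p) (D p)"
  shows "square_integrable M (charged_term D p)"
    and "(\<integral>\<omega>. (charged_term D p \<omega>)\<^sup>2 \<partial>M) = (\<integral>\<omega>. (at_points p (D p) \<omega>)\<^sup>2 \<partial>M)"
proof -
  note sq = square_integrable_at_points(1)[OF p D]
  note m [measurable] = square_integrableD(1)[OF sq] charge(1)
  have ctm [measurable]: "charged_term D p \<in> borel_measurable M"
    unfolding charged_term_def[abs_def] by measurable
  have ae: "AE \<omega> in M. (charged_term D p \<omega>)\<^sup>2 = (at_points p (D p) \<omega>)\<^sup>2"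
    using charge_values[of "fst p"] charge_values[of "snd p"]
    by eventually_elim (auto simp: charged_term_def power_mult_distrib)
  show "(\<integral>\<omega>. (charged_term D p \<omega>)\<^sup>2 \<partial>M) = (\<integral>\<omega>. (at_points p (D p) \<omega>)\<^sup>2 \<partial>M)"
    by (rule integral_cong_AE[OF _ _ ae]) measurable
  have "integrable M (\<lambda>\<omega>. (charged_term D p \<omega>)\<^sup>2)"
    by (rule integrable_cong_AE_imp[OF square_integrableD(2)[OF sq]]) (use ae in \<open>auto elim: eventually_mono\<close>)
  then show "square_integrable M (charged_term D p)" using ctm by (simp add: square_integrable_def)
qed

text \<open>
  A charge that occurs in one pair but not in the other one is centred and independent of
  everything else in the product.
\<close>

lemma charged_term_orthogonal_aux:
  assumes pq: "p \<in> distinct_pairs" "q \<in> distinct_pairs"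
    and D: "square_integrable (\<N>\<^sub>p p) (D p)" "square_integrable (\<N>\<^sub>p q) (D q)"
    and i: "{fst p, snd p} = {i, i'}" "i \<noteq> i'" "i \<notin> {fst q, snd q}"
  shows "(\<integral>\<omega>. charged_term D p \<omega> * charged_term D q \<omega> \<partial>M) = 0"
proof -
  let ?I = "- {Charge i}"
  define W where "W \<omega> = \<sigma> i' \<omega> * at_points p (D p) \<omega> * charged_term D q \<omega>" for \<omega>
  have "\<sigma> i' \<in> borel_measurable (\<A> ?I)" "\<sigma> (fst q) \<in> borel_measurable (\<A> ?I)" "\<sigma> (snd q) \<in> borel_measurable (\<A> ?I)"
    using i by (auto intro!: charge_measurable)
  moreover have "at_points p (D p) \<in> borel_measurable (\<A> ?I)" "at_points q (D q) \<in> borel_measurable (\<A> ?I)"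
    using square_integrableD(1)[OF D(1)] square_integrableD(1)[OF D(2)] by (auto intro!: at_points_measurable)
  ultimately have Wm: "W \<in> borel_measurable (\<A> ?I)"
    unfolding W_def[abs_def] charged_term_def by (intro borel_measurable_times)
  have "\<sigma> i \<in> borel_measurable (\<A> {Charge i})" by (rule charge_measurable) simp
  then have ind: "indep_var borel (\<sigma> i) borel W"
    by (rule indep_var_sources[of "{Charge i}" ?I, rotated]) (use Wm in auto)
  have int: "integrable M W"
  proof (rule Bochner_Integration.integrable_bound)
    show "integrable M (\<lambda>\<omega>. at_points p (D p) \<omega> * charged_term D q \<omega>)"
      by (rule square_integrable_mult[OF square_integrable_at_points(1)[OF pq(1) D(1)] charged_term_square(1)[OF pq(2) D(2)]])
    show "W \<in> borel_measurable M" by (rule measurable_source_algebra[OF Wm])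
    show "AE \<omega> in M. norm (W \<omega>) \<le> norm (at_points p (D p) \<omega> * charged_term D q \<omega>)"
      using charge_values[of i'] by eventually_elim (auto simp: W_def abs_mult)
  qed
  have prod: "\<sigma> (fst p) \<omega> * \<sigma> (snd p) \<omega> = \<sigma> i \<omega> * \<sigma> i' \<omega>" for \<omega>
    using i(1) by (auto simp: doubleton_eq_iff mult.commute)
  have "(\<integral>\<omega>. charged_term D p \<omega> * charged_term D q \<omega> \<partial>M) = (\<integral>\<omega>. \<sigma> i \<omega> * W \<omega> \<partial>M)"
    by (intro Bochner_Integration.integral_cong refl)
      (simp only: charged_term_def[of D p] prod W_def mult.assoc)
  also have "\<dots> = expectation (\<sigma> i) * expectation W"
    by (rule indep_var_lebesgue_integral[OF ind charge_mean(1) int])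
  finally show ?thesis by (simp add: charge_mean(2))
qed

lemma charged_term_orthogonal:
  assumes pq: "p \<in> distinct_pairs" "q \<in> distinct_pairs"
    and D: "square_integrable (\<N>\<^sub>p p) (D p)" "square_integrable (\<N>\<^sub>p q) (D q)"
    and ne: "q \<noteq> p" "q \<noteq> prod.swap p"
  shows "(\<integral>\<omega>. charged_term D p \<omega> * charged_term D q \<omega> \<partial>M) = 0"
proof -
  obtain j k j' k' where p: "p = (j, k)" and q: "q = (j', k')" by (cases p, cases q)
  have d: "j \<noteq> k" "j' \<noteq> k'" using pq by (auto simp: p q distinct_pairs_def)
  have "j \<notin> {j', k'} \<or> k \<notin> {j', k'}" using ne d by (auto simp: p q)
  then show ?thesis
  proof
    assume "j \<notin> {j', k'}"
    then show ?thesis using d by (intro charged_term_orthogonal_aux[OF pq D, of j k]) (simp_all add: p q)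
  next
    assume "k \<notin> {j', k'}"
    then show ?thesis using d by (intro charged_term_orthogonal_aux[OF pq D, of k j]) (simp_all add: p q insert_commute)
  qed
qed

text \<open>
  So the terms are orthogonal except for the two orders of one pair, which costs a factor two.
\<close>

lemma charged_sum_le:
  assumes J: "finite J" "J \<subseteq> distinct_pairs" and D: "\<And>p. p \<in> J \<Longrightarrow> square_integrable (\<N>\<^sub>p p) (D p)"
  shows "square_integrable M (\<lambda>\<omega>. \<Sum>p\<in>J. charged_term D p \<omega>)"
    and "(\<integral>\<omega>. (\<Sum>p\<in>J. charged_term D p \<omega>)\<^sup>2 \<partial>M) \<le> 2 * (\<Sum>p\<in>J. \<integral>\<omega>. (at_points p (D p) \<omega>)\<^sup>2 \<partial>M)"
proof -
  let ?c = "charged_term D"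
  define e where "e p = (\<integral>\<omega>. (at_points p (D p) \<omega>)\<^sup>2 \<partial>M)" for p
  have e0: "0 \<le> e p" for p by (simp add: e_def)
  have dp: "p \<in> distinct_pairs" if "p \<in> J" for p using J(2) that by auto
  have sq: "square_integrable M (?c p)" "(\<integral>\<omega>. (?c p \<omega>)\<^sup>2 \<partial>M) = e p" if "p \<in> J" for p
    using charged_term_square[OF dp[OF that] D[OF that]] by (simp_all add: e_def)
  show "square_integrable M (\<lambda>\<omega>. \<Sum>p\<in>J. ?c p \<omega>)"
    by (rule square_integrable_sum) (rule sq(1))
  define R where "R p q \<longleftrightarrow> q = p \<or> q = prod.swap p" for p q :: "nat \<times> nat"
  have R_sym: "R p q \<longleftrightarrow> R q p" for p q by (cases p; cases q) (auto simp: R_def)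
  have prod: "(\<integral>\<omega>. ?c p \<omega> * ?c q \<omega> \<partial>M) \<le> (if R p q then e p / 2 else 0) + (if R p q then e q / 2 else 0)"
    if pq: "p \<in> J" "q \<in> J" for p q
  proof (cases "R p q")
    case True
    have "(\<integral>\<omega>. ?c p \<omega> * ?c q \<omega> \<partial>M) \<le> (\<integral>\<omega>. (?c p \<omega>)\<^sup>2 / 2 + (?c q \<omega>)\<^sup>2 / 2 \<partial>M)"
    proof (rule integral_mono)
      show "integrable M (\<lambda>\<omega>. ?c p \<omega> * ?c q \<omega>)" by (rule square_integrable_mult[OF sq(1)[OF pq(1)] sq(1)[OF pq(2)]])
      show "integrable M (\<lambda>\<omega>. (?c p \<omega>)\<^sup>2 / 2 + (?c q \<omega>)\<^sup>2 / 2)"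
        using square_integrableD(2)[OF sq(1)[OF pq(1)]] square_integrableD(2)[OF sq(1)[OF pq(2)]] by simp
      fix \<omega>
      have "0 \<le> (?c p \<omega> - ?c q \<omega>)\<^sup>2" by simp
      then show "?c p \<omega> * ?c q \<omega> \<le> (?c p \<omega>)\<^sup>2 / 2 + (?c q \<omega>)\<^sup>2 / 2" unfolding power2_diff by linarith
    qed
    also have "\<dots> = e p / 2 + e q / 2"
      using square_integrableD(2)[OF sq(1)[OF pq(1)]] square_integrableD(2)[OF sq(1)[OF pq(2)]]
      by (simp add: sq(2) pq)
    finally show ?thesis using True by simp
  next
    case False
    then show ?thesis
      using charged_term_orthogonal[OF dp[OF pq(1)] dp[OF pq(2)] D[OF pq(1)] D[OF pq(2)]] by (simp add: R_def)
  qed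
  have half: "(\<Sum>p\<in>J. \<Sum>q\<in>J. if R p q then e p / 2 else 0) \<le> (\<Sum>p\<in>J. e p)"
  proof (rule sum_mono)
    fix p
    have "(\<Sum>q\<in>J. if R p q then e p / 2 else 0) = (\<Sum>q\<in>J \<inter> {q. R p q}. e p / 2)"
      using sum.inter_restrict[OF J(1), of "\<lambda>_. e p / 2" "{q. R p q}"] by (simp only: mem_Collect_eq)
    also have "\<dots> = real (card (J \<inter> {q. R p q})) * (e p / 2)" by simp
    also have "\<dots> \<le> 2 * (e p / 2)"
    proof (rule mult_right_mono)
      have "card (J \<inter> {q. R p q}) \<le> card {p, prod.swap p}" by (rule card_mono) (auto simp: R_def)
      also have "\<dots> \<le> 2" by (simp add: card_insert_if)
      finally show "real (card (J \<inter> {q. R p q})) \<le> 2" by simp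
    qed (use e0 in simp)
    finally show "(\<Sum>q\<in>J. if R p q then e p / 2 else 0) \<le> e p" by simp
  qed
  have half': "(\<Sum>p\<in>J. \<Sum>q\<in>J. if R p q then e q / 2 else 0) \<le> (\<Sum>p\<in>J. e p)"
    using half by (subst sum.swap) (simp only: R_sym[of _ p for p])
  have "(\<integral>\<omega>. (\<Sum>p\<in>J. ?c p \<omega>)\<^sup>2 \<partial>M) = (\<integral>\<omega>. (\<Sum>p\<in>J. \<Sum>q\<in>J. ?c p \<omega> * ?c q \<omega>) \<partial>M)"
    by (simp add: power2_eq_square sum_product)
  also have "\<dots> = (\<Sum>p\<in>J. \<Sum>q\<in>J. \<integral>\<omega>. ?c p \<omega> * ?c q \<omega> \<partial>M)"
    using square_integrable_mult[OF sq(1) sq(1)]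
    by (simp add: Bochner_Integration.integral_sum)
  also have "\<dots> \<le> (\<Sum>p\<in>J. \<Sum>q\<in>J. (if R p q then e p / 2 else 0) + (if R p q then e q / 2 else 0))"
    by (intro sum_mono prod)
  also have "\<dots> = (\<Sum>p\<in>J. \<Sum>q\<in>J. if R p q then e p / 2 else 0) + (\<Sum>p\<in>J. \<Sum>q\<in>J. if R p q then e q / 2 else 0)"
    by (simp only: sum.distrib)
  also have "\<dots> \<le> 2 * (\<Sum>p\<in>J. e p)" using half half' by linarith
  finally show "(\<integral>\<omega>. (\<Sum>p\<in>J. ?c p \<omega>)\<^sup>2 \<partial>M) \<le> 2 * (\<Sum>p\<in>J. \<integral>\<omega>. (at_points p (D p) \<omega>)\<^sup>2 \<partial>M)"
    by (simp only: e_def)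
qed

text \<open>
  A finite set of pairs whose sum of second moments nearly attains the supremum leaves little to all
  further pairs, and by the preceding bound little in mean square to the charged sum.
\<close>

lemma charged_series_converges:
  assumes D: "\<And>p. p \<in> distinct_pairs \<Longrightarrow> square_integrable (\<N>\<^sub>p p) (D p)"
    and bound: "\<And>J. finite J \<Longrightarrow> J \<subseteq> distinct_pairs \<Longrightarrow> (\<Sum>p\<in>J. \<integral>\<omega>. (at_points p (D p) \<omega>)\<^sup>2 \<partial>M) \<le> B"
  shows "\<exists>Z. L2_tendsto M (\<lambda>J \<omega>. (1 / T) * (\<Sum>p\<in>J. charged_term D p \<omega>)) Z (finite_subsets_at_top distinct_pairs)"
proof (rule L2_complete)
  let ?S = "\<lambda>J \<omega>. (1 / T) * (\<Sum>p\<in>J. charged_term D p \<omega>)"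
  define e where "e p = (\<integral>\<omega>. (at_points p (D p) \<omega>)\<^sup>2 \<partial>M)" for p
  let ?Js = "{J. finite J \<and> J \<subseteq> distinct_pairs}"
  have sqJ: "square_integrable M (?S J)" if "finite J" "J \<subseteq> distinct_pairs" for J
    using that D by (intro square_integrable_cmult charged_sum_le(1)) auto
  show "\<forall>\<^sub>F J in finite_subsets_at_top distinct_pairs. square_integrable M (?S J)"
    by (intro eventually_finite_subsets_at_top_weakI sqJ)
  fix \<eta> :: real assume \<eta>: "0 < \<eta>"
  \<comment> \<open>So that the bound \<open>2 \<delta> / T\<^sup>2\<close> for a tail of the charged sum is \<open>\<eta> / 4\<close>.\<close>
  define \<delta> where "\<delta> = \<eta> * T\<^sup>2 / 8"
  have \<delta>: "0 < \<delta>" using \<eta> T by (simp add: \<delta>_def)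
  have bdd: "bdd_above (sum e ` ?Js)" by (rule bdd_aboveI[of _ B]) (use bound in \<open>auto simp: e_def\<close>)
  have "\<exists>J0\<in>?Js. (SUP J\<in>?Js. sum e J) - \<delta> < sum e J0"
    using \<delta> by (subst less_cSUP_iff[OF _ bdd, symmetric]) auto
  then obtain J0 where J0: "finite J0" "J0 \<subseteq> distinct_pairs" "(SUP J\<in>?Js. sum e J) - \<delta> < sum e J0" by auto
  have tail: "sum e (J - J0) \<le> \<delta>" if J: "finite J" "J \<subseteq> distinct_pairs" "J0 \<subseteq> J" for J
  proof -
    have "sum e J \<le> (SUP J\<in>?Js. sum e J)" using J by (intro cSUP_upper[OF _ bdd]) simp
    moreover have "sum e J = sum e J0 + sum e (J - J0)" using J by (metis sum.subset_diff add.commute)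
    ultimately show ?thesis using J0(3) by linarith
  qed
  have tail_sum: "(\<integral>\<omega>. (?S J \<omega> - ?S J0 \<omega>)\<^sup>2 \<partial>M) \<le> \<eta> / 4" if J: "finite J" "J \<subseteq> distinct_pairs" "J0 \<subseteq> J" for J
  proof -
    have eq: "?S J \<omega> - ?S J0 \<omega> = (1 / T) * (\<Sum>p\<in>J - J0. charged_term D p \<omega>)" for \<omega>
      using J J0 by (simp add: sum_diff right_diff_distrib)
    have "(\<integral>\<omega>. (?S J \<omega> - ?S J0 \<omega>)\<^sup>2 \<partial>M) = (1 / T)\<^sup>2 * (\<integral>\<omega>. (\<Sum>p\<in>J - J0. charged_term D p \<omega>)\<^sup>2 \<partial>M)"
      unfolding eq power_mult_distrib by simp
    also have "\<dots> \<le> (1 / T)\<^sup>2 * (2 * sum e (J - J0))"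
      unfolding e_def using J D by (intro mult_left_mono charged_sum_le(2)) auto
    also have "\<dots> \<le> (1 / T)\<^sup>2 * (2 * \<delta>)"
      using tail[OF J] by (intro mult_left_mono) auto
    also have "\<dots> = \<eta> / 4" using T by (simp add: \<delta>_def power2_eq_square)
    finally show ?thesis .
  qed
  show "\<exists>Q. eventually Q (finite_subsets_at_top distinct_pairs) \<and>
      (\<forall>J J'. Q J \<longrightarrow> Q J' \<longrightarrow> (\<integral>\<omega>. (?S J \<omega> - ?S J' \<omega>)\<^sup>2 \<partial>M) \<le> \<eta>)"
  proof (intro exI[of _ "\<lambda>J. finite J \<and> J \<subseteq> distinct_pairs \<and> J0 \<subseteq> J"] conjI allI impI)
    show "\<forall>\<^sub>F J in finite_subsets_at_top distinct_pairs. finite J \<and> J \<subseteq> distinct_pairs \<and> J0 \<subseteq> J"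
      unfolding eventually_finite_subsets_at_top using J0 by (intro exI[of _ J0]) simp
    fix J J'
    assume J: "finite J \<and> J \<subseteq> distinct_pairs \<and> J0 \<subseteq> J" and J': "finite J' \<and> J' \<subseteq> distinct_pairs \<and> J0 \<subseteq> J'"
    have "(\<integral>\<omega>. (?S J \<omega> - ?S J' \<omega>)\<^sup>2 \<partial>M)
        \<le> 2 * (\<integral>\<omega>. (?S J \<omega> - ?S J0 \<omega>)\<^sup>2 \<partial>M) + 2 * (\<integral>\<omega>. (?S J0 \<omega> - ?S J' \<omega>)\<^sup>2 \<partial>M)"
      using J J' J0 by (intro integral_power2_diff_le sqJ) auto
    also have "(\<integral>\<omega>. (?S J0 \<omega> - ?S J' \<omega>)\<^sup>2 \<partial>M) = (\<integral>\<omega>. (?S J' \<omega> - ?S J0 \<omega>)\<^sup>2 \<partial>M)"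
      by (simp only: power2_commute)
    also have "2 * (\<integral>\<omega>. (?S J \<omega> - ?S J0 \<omega>)\<^sup>2 \<partial>M) + 2 * (\<integral>\<omega>. (?S J' \<omega> - ?S J0 \<omega>)\<^sup>2 \<partial>M) \<le> 2 * (\<eta> / 4) + 2 * (\<eta> / 4)"
      using J J' by (intro add_mono mult_left_mono tail_sum) auto
    finally show "(\<integral>\<omega>. (?S J \<omega> - ?S J' \<omega>)\<^sup>2 \<partial>M) \<le> \<eta>" by simp
  qed
qed simp

end

section \<open>The process\<close>

definition pair_ilt :: "real \<Rightarrow> nat \<times> nat \<Rightarrow> real \<times> real \<times> 'w \<Rightarrow> real" where
  "pair_ilt t p = ilt M T (indicator {0..t}) (\<rho> (fst p)) (\<rho> (snd p))"

lemma xi_partial_eq: "xi_partial M T x \<rho> \<sigma> t J \<omega> = (1 / T) * (\<Sum>p\<in>J. charged_term (pair_ilt t) p \<omega>)"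
  by (simp add: xi_partial_def charged_term_def at_points_def pair_ilt_def split_def)

lemma pair_ilt_square_integrable:
  assumes "0 \<le> t" "p \<in> distinct_pairs"
  shows "square_integrable (\<N>\<^sub>p p) (pair_ilt t p)"
proof -
  obtain f where f: "f \<in> mollifiers" using mollifiers_nonempty by blast
  have "fst p \<noteq> snd p" using assms(2) by (auto simp: distinct_pairs_def)
  from ilt_limit[OF this _ _ assms(1) f, of "{0..t}" 0] show ?thesis
    by (simp add: L2_tendsto_def pair_ilt_def)
qed

lemma xi_exists:
  assumes t: "0 \<le> t"
  shows "\<exists>Z. is_xi M T x \<rho> \<sigma> t Z"
proof -
  obtain f where f: "f \<in> mollifiers" using mollifiers_nonempty by blast
  have "\<exists>Z. L2_tendsto M (\<lambda>J \<omega>. (1 / T) * (\<Sum>p\<in>J. charged_term (pair_ilt t) p \<omega>)) Z (finite_subsets_at_top distinct_pairs)"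
  proof (rule charged_series_converges)
    show "square_integrable (\<N>\<^sub>p p) (pair_ilt t p)" if "p \<in> distinct_pairs" for p
      by (rule pair_ilt_square_integrable[OF t that])
    fix J assume J: "finite J" "J \<subseteq> distinct_pairs"
    show "(\<Sum>p\<in>J. \<integral>\<omega>. (at_points p (pair_ilt t p) \<omega>)\<^sup>2 \<partial>M) \<le> moment_const * t powr (2 * \<alpha>)"
    proof (rule sum_second_moments_le[OF J _ _ t f, of "{0..t}" 0])
      fix p assume "p \<in> J"
      then have "fst p \<noteq> snd p" using J by (auto simp: distinct_pairs_def)
      from ilt_limit[OF this _ _ t f, of "{0..t}" 0]
      show "L2_tendsto (\<N>\<^sub>p p) (approx (fst p) (snd p) f {0..t}) (pair_ilt t p) (at_right 0)"
        by (simp add: pair_ilt_def)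
    qed simp_all
  qed
  then show ?thesis by (simp add: is_xi_def xi_partial_eq[abs_def])
qed

text \<open>
  An increment of the process is the same series for the interval \<open>(s, t]\<close>, so its second moment is
  at most of order \<open>(t - s)\<^sup>2\<^sup>\<alpha>\<close>, and the exponent exceeds one.
\<close>

lemma xi_increment:
  assumes st: "0 \<le> s" "s \<le> t" and \<xi>: "is_xi M T x \<rho> \<sigma> s Y" "is_xi M T x \<rho> \<sigma> t Z"
  shows "(\<integral>\<omega>. (Z \<omega> - Y \<omega>)\<^sup>2 \<partial>M) \<le> 4 * moment_const / T\<^sup>2 * (t - s) powr (2 * \<alpha>)"
proof -
  obtain f where f: "f \<in> mollifiers" using mollifiers_nonempty by blast
  define D where "D p z = pair_ilt t p z - pair_ilt s p z" for p z
  have t: "0 \<le> t" using st by simp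
  have dist: "fst p \<noteq> snd p" if "p \<in> distinct_pairs" for p
    using that by (auto simp: distinct_pairs_def)
  have bound: "(\<integral>\<omega>. (xi_partial M T x \<rho> \<sigma> t J \<omega> - xi_partial M T x \<rho> \<sigma> s J \<omega>)\<^sup>2 \<partial>M)
      \<le> 2 * moment_const / T\<^sup>2 * (t - s) powr (2 * \<alpha>)" if J: "finite J" "J \<subseteq> distinct_pairs" for J
  proof -
    have sqD: "square_integrable (\<N>\<^sub>p p) (D p)" if "p \<in> J" for p
      unfolding D_def[abs_def] using J that st t by (intro square_integrable_diff pair_ilt_square_integrable) auto
    have eq: "xi_partial M T x \<rho> \<sigma> t J \<omega> - xi_partial M T x \<rho> \<sigma> s J \<omega> = (1 / T) * (\<Sum>p\<in>J. charged_term D p \<omega>)" for \<omega>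
      unfolding xi_partial_eq
      by (simp add: charged_term_def at_points_def D_def right_diff_distrib sum_subtractf diff_divide_distrib)
    have "(\<integral>\<omega>. (xi_partial M T x \<rho> \<sigma> t J \<omega> - xi_partial M T x \<rho> \<sigma> s J \<omega>)\<^sup>2 \<partial>M)
        = (1 / T)\<^sup>2 * (\<integral>\<omega>. (\<Sum>p\<in>J. charged_term D p \<omega>)\<^sup>2 \<partial>M)"
      unfolding eq power_mult_distrib by simp
    also have "\<dots> \<le> (1 / T)\<^sup>2 * (2 * (\<Sum>p\<in>J. \<integral>\<omega>. (at_points p (D p) \<omega>)\<^sup>2 \<partial>M))"
      using sqD by (intro mult_left_mono charged_sum_le(2)[OF J]) auto
    also have "\<dots> \<le> (1 / T)\<^sup>2 * (2 * (moment_const * (t - s) powr (2 * \<alpha>)))"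
    proof (intro mult_left_mono)
      show "(\<Sum>p\<in>J. \<integral>\<omega>. (at_points p (D p) \<omega>)\<^sup>2 \<partial>M) \<le> moment_const * (t - s) powr (2 * \<alpha>)"
      proof (rule sum_second_moments_le[OF J _ _ _ f, of "{s<..t}" s])
        fix p assume "p \<in> J"
        then have "fst p \<noteq> snd p" using J by (intro dist) auto
        then show "L2_tendsto (\<N>\<^sub>p p) (approx (fst p) (snd p) f {s<..t}) (D p) (at_right 0)"
          unfolding D_def[abs_def] pair_ilt_def by (rule ilt_increment_limit[OF _ st f])
      qed (use st in auto)
    qed simp_all
    also have "\<dots> = 2 * moment_const / T\<^sup>2 * (t - s) powr (2 * \<alpha>)" by (simp add: power_divide)
    finally show ?thesis .
  qed
  have "L2_tendsto M (\<lambda>J \<omega>. xi_partial M T x \<rho> \<sigma> t J \<omega> - xi_partial M T x \<rho> \<sigma> s J \<omega>) (\<lambda>\<omega>. Z \<omega> - Y \<omega>)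
      (finite_subsets_at_top distinct_pairs)"
    using \<xi> unfolding is_xi_def by (intro L2_tendsto_diff)
  then have "(\<integral>\<omega>. (Z \<omega> - Y \<omega>)\<^sup>2 \<partial>M) \<le> 2 * (2 * moment_const / T\<^sup>2 * (t - s) powr (2 * \<alpha>))"
    by (rule L2_tendsto_integral_le[OF _ _ _ tendsto_const])
      (use bound in \<open>auto intro!: eventually_finite_subsets_at_top_weakI\<close>)
  then show ?thesis by simp
qed

lemma xi_continuous_modification:
  assumes "\<And>t. 0 \<le> t \<Longrightarrow> is_xi M T x \<rho> \<sigma> t (\<xi> t)"
  shows "\<exists>Y. continuous_modification M \<xi> Y"
proof (rule continuous_modification_if_increments)
  show "square_integrable M (\<xi> t)" if "0 \<le> t" for t
    using assms[OF that] by (simp add: is_xi_def L2_tendsto_def)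
  show "(\<integral>\<omega>. (\<xi> t \<omega> - \<xi> s \<omega>)\<^sup>2 \<partial>M) \<le> 4 * moment_const / T\<^sup>2 * (t - s) powr (2 * \<alpha>)"
    if "0 \<le> s" "s \<le> t" for s t
    using that by (intro xi_increment assms) auto
  show "1 < 2 * \<alpha>" using \<alpha> by simp
qed

end

theorem lemma3p4:
  fixes M :: "'w measure" and \<alpha> T :: real
    and x :: "nat \<Rightarrow> 'w \<Rightarrow> real" and \<rho> :: "nat \<Rightarrow> real \<Rightarrow> 'w \<Rightarrow> real" and \<sigma> :: "nat \<Rightarrow> 'w \<Rightarrow> real"
  assumes "1 / 2 < \<alpha>" and "\<alpha> < 1" and "0 < T"
    and "charged_stable_system M \<alpha> x \<rho> \<sigma>"
  shows "(\<forall>t\<ge>0. \<exists>Z. is_xi M T x \<rho> \<sigma> t Z) \<and>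
    (\<forall>\<xi>. (\<forall>t\<ge>0. is_xi M T x \<rho> \<sigma> t (\<xi> t)) \<longrightarrow>
       (\<exists>Y. continuous_modification M \<xi> Y))"
proof -
  interpret prob_space M using assms(4) by (simp add: charged_stable_system_def)
  interpret charged_system M \<alpha> T x \<rho> \<sigma>
    using assms by unfold_locales
  show ?thesis using xi_exists xi_continuous_modification by simp
qed

end
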